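(* Let $G=G_1\times\cdots\times G_n$ be a product of topological groups with a continuous action by uniformly equicontinuous affine maps on a superreflexive topological vector space $B$ without $G$-fixed point. Assume that the associated linear $G$-representation $\varrho$ does not almost have non-zero invariant vectors. Then there is a $G$-invariant closed complemented affine subspace $\underline{B}\subseteq B$ and an affine equicontinuous $G$-equivariant isomorphism $\underline{B}\cong B_1\oplus\cdots\oplus B_n$, where each $B_i$ is a superreflexive Banach space with an equicontinuous affine $G$-action factoring through $G\to G_i$.
   Context: Here $n\ge 2$ and vector spaces are real. A topological vector space is superreflexive if it is isomorphic (as a topological vector space) to a uniformly convex Banach space. A group $G$ of transformations of a topological vector space $V$ is uniformly equicontinuous if for every neighbourhood $U$ of $0$ there is a neighbourhood $W$ of $0$ such that $x-y\in W$ implies $g(x)-g(y)\in U$ for all $g\in G$. An affine action has the form $g\cdot x=\varrho(g)x+c(g)$; the homomorphism $\varrho:G\to\mathbf{GL}(B)$ is the associated linear representation (linear part). A linear representation $\varrho$ on $B$ almost has (non-zero) invariant vectors if, for some (equivalently any) norm on $B$ defining its topology, for every compact $K\subseteq G$ one has $\inf_{\|v\|=1}\mathrm{diam}(\varrho(K)v)=0$. A closed affine subspace is complemented if its direction (underlying linear subspace) $X$ admits a closed linear subspace $Y$ with $B=X\oplus Y$ algebraically and topologically. *)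

theory Defs
  imports
    "HOL-Analysis.Analysis"
    "HOL-Algebra.Product_Groups"
    "HOL-Algebra.Group_Action"
begin

definition topological_group :: "('g, 'm) monoid_scheme \<Rightarrow> 'g topology \<Rightarrow> bool" where
  "topological_group G TG \<longleftrightarrow>
     group G \<and> topspace TG = carrier G \<and>
     continuous_map (prod_topology TG TG) TG (\<lambda>(x, y). x \<otimes>\<^bsub>G\<^esub> y) \<and>
     continuous_map TG TG (\<lambda>x. inv\<^bsub>G\<^esub> x)"

text \<open>
  A topological vector space is given by its topology \<open>T\<close>; the underlying vector space is the
  linear subspace \<open>topspace T\<close> of an ambient real vector space, which carries no topology itself.
\<close>

definition topological_vector_space :: "'b::real_vector topology \<Rightarrow> bool" where
  "topological_vector_space T \<longleftrightarrow>
     subspace (topspace T) \<and>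
     continuous_map (prod_topology T T) T (\<lambda>(x, y). x + y) \<and>
     continuous_map (prod_topology euclideanreal T) T (\<lambda>(a, x). a *\<^sub>R x)"

definition linear_between :: "'b::real_vector set \<Rightarrow> 'c::real_vector set \<Rightarrow> ('b \<Rightarrow> 'c) \<Rightarrow> bool" where
  "linear_between V W f \<longleftrightarrow>
     f ` V \<subseteq> W \<and>
     (\<forall>x\<in>V. \<forall>y\<in>V. f (x + y) = f x + f y) \<and>
     (\<forall>a. \<forall>x\<in>V. f (a *\<^sub>R x) = a *\<^sub>R f x)"

definition norm_on :: "'b::real_vector set \<Rightarrow> ('b \<Rightarrow> real) \<Rightarrow> bool" where
  "norm_on V N \<longleftrightarrow>
     subspace V \<and>
     (\<forall>x\<in>V. 0 \<le> N x \<and> (N x = 0 \<longleftrightarrow> x = 0)) \<and>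
     (\<forall>a. \<forall>x\<in>V. N (a *\<^sub>R x) = \<bar>a\<bar> * N x) \<and>
     (\<forall>x\<in>V. \<forall>y\<in>V. N (x + y) \<le> N x + N y)"

text \<open>
  The locale \<open>Metric_space\<close> asks for nonnegativity and symmetry also outside the carrier, whence
  the default value.
\<close>

definition norm_dist :: "'b::real_vector set \<Rightarrow> ('b \<Rightarrow> real) \<Rightarrow> 'b \<Rightarrow> 'b \<Rightarrow> real" where
  "norm_dist V N x y = (if x \<in> V \<and> y \<in> V then N (x - y) else 0)"

definition norm_topology :: "'b::real_vector set \<Rightarrow> ('b \<Rightarrow> real) \<Rightarrow> 'b topology" where
  "norm_topology V N = Metric_space.mtopology V (norm_dist V N)"

definition banach_space :: "'b::real_vector set \<Rightarrow> ('b \<Rightarrow> real) \<Rightarrow> bool" where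
  "banach_space V N \<longleftrightarrow> norm_on V N \<and> Metric_space.mcomplete V (norm_dist V N)"

definition uniformly_convex :: "'b::real_vector set \<Rightarrow> ('b \<Rightarrow> real) \<Rightarrow> bool" where
  "uniformly_convex V N \<longleftrightarrow>
     (\<forall>\<epsilon>>0. \<exists>\<delta>>0. \<forall>x\<in>V. \<forall>y\<in>V.
        N x \<le> 1 \<and> N y \<le> 1 \<and> \<epsilon> \<le> N (x - y) \<longrightarrow> N ((1/2) *\<^sub>R (x + y)) \<le> 1 - \<delta>)"

text \<open>
  The Banach space \<open>(V, N)\<close> may be sought in the same ambient vector space: a linear isomorphism
  from \<open>topspace T\<close> transports any other model there.
\<close>

definition superreflexive :: "'b::real_vector topology \<Rightarrow> bool" where
  "superreflexive T \<longleftrightarrow>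
     topological_vector_space T \<and>
     (\<exists>(V::'b set) N f.
        banach_space V N \<and> uniformly_convex V N \<and>
        linear_between (topspace T) V f \<and> homeomorphic_map T (norm_topology V N) f)"

definition affine_action ::
  "('g, 'm) monoid_scheme \<Rightarrow> 'b::real_vector topology \<Rightarrow>
     ('g \<Rightarrow> 'b \<Rightarrow> 'b) \<Rightarrow> ('g \<Rightarrow> 'b \<Rightarrow> 'b) \<Rightarrow> ('g \<Rightarrow> 'b) \<Rightarrow> bool" where
  "affine_action G T act \<rho> c \<longleftrightarrow>
     group_action G (topspace T) act \<and>
     (\<forall>g\<in>carrier G.
        linear_between (topspace T) (topspace T) (\<rho> g) \<and> c g \<in> topspace T \<and>
        (\<forall>x\<in>topspace T. act g x = \<rho> g x + c g))"

definition continuous_action :: "'g topology \<Rightarrow> 'b topology \<Rightarrow> ('g \<Rightarrow> 'b \<Rightarrow> 'b) \<Rightarrow> bool" where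
  "continuous_action TG T act \<longleftrightarrow> continuous_map (prod_topology TG T) T (\<lambda>(g, x). act g x)"

definition uniformly_equicontinuous :: "'b::real_vector topology \<Rightarrow> ('b \<Rightarrow> 'b) set \<Rightarrow> bool" where
  "uniformly_equicontinuous T F \<longleftrightarrow>
     (\<forall>U. openin T U \<and> 0 \<in> U \<longrightarrow>
        (\<exists>W. openin T W \<and> 0 \<in> W \<and>
           (\<forall>x\<in>topspace T. \<forall>y\<in>topspace T. x - y \<in> W \<longrightarrow> (\<forall>f\<in>F. f x - f y \<in> U))))"

text \<open>
  Diameters and their infimum are taken in \<open>[0, \<infinity>]\<close>, so that the infimum over an empty unit
  sphere is \<open>\<infinity>\<close> and the zero space has no almost invariant vectors.
\<close>

definition norm_diameter :: "('b::real_vector \<Rightarrow> real) \<Rightarrow> 'b set \<Rightarrow> ennreal" where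
  "norm_diameter N S = (SUP x\<in>S. SUP y\<in>S. ennreal (N (x - y)))"

definition almost_has_invariant_vectors ::
  "'g topology \<Rightarrow> 'b::real_vector topology \<Rightarrow> ('g \<Rightarrow> 'b \<Rightarrow> 'b) \<Rightarrow> bool" where
  "almost_has_invariant_vectors TG T \<rho> \<longleftrightarrow>
     (\<exists>N. norm_on (topspace T) N \<and> norm_topology (topspace T) N = T \<and>
        (\<forall>K. compactin TG K \<longrightarrow>
           (INF v\<in>{v \<in> topspace T. N v = 1}. norm_diameter N ((\<lambda>g. \<rho> g v) ` K)) = 0))"

definition closed_affine_subspace :: "'b::real_vector topology \<Rightarrow> 'b set \<Rightarrow> bool" where
  "closed_affine_subspace T S \<longleftrightarrow> S \<noteq> {} \<and> affine S \<and> closedin T S"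

definition complemented :: "'b::real_vector topology \<Rightarrow> 'b set \<Rightarrow> bool" where
  "complemented T S \<longleftrightarrow>
     (let X = {x - y |x y. x \<in> S \<and> y \<in> S} in
      \<exists>Y. subspace Y \<and> closedin T Y \<and> X \<inter> Y = {0} \<and>
        {x + y |x y. x \<in> X \<and> y \<in> Y} = topspace T \<and>
        homeomorphic_map (prod_topology (subtopology T X) (subtopology T Y)) T (\<lambda>(x, y). x + y))"

text \<open>
  An affine isomorphism from the affine subspace \<open>S\<close> onto the finite direct sum of the spaces
  \<open>T' i\<close>. Elements of the direct sum are the extensional families on \<open>I\<close>, with componentwise
  operations and the product topology. The last two conjuncts are the uniform continuity of
  \<open>\<Phi>\<close> and of its inverse.
\<close>

definition affine_isomorphism_direct_sum ::
  "'b::real_vector topology \<Rightarrow> 'b set \<Rightarrow> 'i set \<Rightarrow> ('i \<Rightarrow> 'c::real_vector topology) \<Rightarrow>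
     ('b \<Rightarrow> 'i \<Rightarrow> 'c) \<Rightarrow> bool" where
  "affine_isomorphism_direct_sum T S I T' \<Phi> \<longleftrightarrow>
     homeomorphic_map (subtopology T S) (product_topology T' I) \<Phi> \<and>
     (\<forall>i\<in>I. \<forall>x\<in>S. \<forall>y\<in>S. \<forall>t.
        \<Phi> ((1 - t) *\<^sub>R x + t *\<^sub>R y) i = (1 - t) *\<^sub>R \<Phi> x i + t *\<^sub>R \<Phi> y i) \<and>
     (\<forall>U. (\<forall>i\<in>I. openin (T' i) (U i) \<and> 0 \<in> U i) \<longrightarrow>
        (\<exists>W. openin T W \<and> 0 \<in> W \<and>
           (\<forall>x\<in>S. \<forall>y\<in>S. x - y \<in> W \<longrightarrow> (\<forall>i\<in>I. \<Phi> x i - \<Phi> y i \<in> U i)))) \<and>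
     (\<forall>W. openin T W \<and> 0 \<in> W \<longrightarrow>
        (\<exists>U. (\<forall>i\<in>I. openin (T' i) (U i) \<and> 0 \<in> U i) \<and>
           (\<forall>x\<in>S. \<forall>y\<in>S. (\<forall>i\<in>I. \<Phi> x i - \<Phi> y i \<in> U i) \<longrightarrow> x - y \<in> W)))"

definition factors_through_component ::
  "'i set \<Rightarrow> ('i \<Rightarrow> ('g, 'm) monoid_scheme) \<Rightarrow> 'i \<Rightarrow> 'b set \<Rightarrow> (('i \<Rightarrow> 'g) \<Rightarrow> 'b \<Rightarrow> 'b) \<Rightarrow> bool" where
  "factors_through_component I G i V act \<longleftrightarrow>
     (\<exists>\<alpha>. group_action (G i) V \<alpha> \<and>
        (\<forall>g\<in>carrier (product_group I G). act g = \<alpha> (g i)))"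

end

theory Submission
  imports Defs
begin

text \<open>
  A supremum over the group turns the given norm into an invariant one which is still uniformly
  convex. For a group \<open>H\<close> of linear isometries of a uniformly convex space, the vector of least
  norm in the closed convex hull of an orbit is fixed. This defines a linear projection onto the
  fixed vectors because fixed vectors are separated by invariant functionals; no duality is used:
  a minimal invariant sublinear functional is linear, since on a uniformly convex space every
  functional below the norm has almost flat points (otherwise dyadic martingales with bounded
  increments would grow linearly, against the uniform convexity of their \<open>L\<^sup>2\<close>-norm).

  Let \<open>p\<^sub>i\<close> be the projection for the product \<open>H\<^sub>i\<close> of all factors but \<open>G\<^sub>i\<close>. The \<open>p\<^sub>i\<close> commute with \<open>G\<close> and
  \<open>p\<^sub>i p\<^sub>j = 0\<close> for \<open>i \<noteq> j\<close>, as there are no \<open>G\<close>-fixed vectors. On the kernel of \<open>\<Sum>\<^sub>i p\<^sub>i\<close> averages over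
  \<open>H\<^sub>i\<close> make the displacements by \<open>G\<^sub>i\<close> small, and since almost invariant vectors are excluded these
  averages stay bounded; so the action induced on this kernel has a fixed point \<open>y\<close>. The affine
  subspace of points with component \<open>y\<close> in the kernel is invariant and is identified by the \<open>p\<^sub>i\<close>
  with the sum of the spaces of \<open>H\<^sub>i\<close>-fixed vectors.
\<close>

section \<open>Uniformly convex norms on a subspace\<close>


text \<open>A fixed vector in the hull of each orbit is easy to find; the obstacle is that it must
  be the only one, or it would not depend linearly on the orbit. Uniqueness is a separation
  property, and the functionals given by Hahn-Banach are not invariant; averaging them would call
  for convexity of the dual norm, which uniform convexity of the norm does not supply. Hence
  invariance is built into Zorn's lemma, and linearity of the minimal object is bought by flatness.
  The second obstacle is that the group is neither locally compact nor compactly generated. The only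
  finiteness is one compact set \<open>K\<close> some element of which moves each vector by a fixed
  proportion of its length. Since coordinate projections are continuous, the cocycle is bounded on
  the components of \<open>K\<close>, and this bound is what the fixed point argument for a single
  factor uses. Common points of bounded closed convex sets come from points of least norm, in place
  of weak compactness.\<close>

locale normed_set =
  fixes V :: "'b::real_vector set" and N :: "'b \<Rightarrow> real"
  assumes norm_on: "norm_on V N"
begin

lemma sub: "subspace V"
  using norm_on by (simp add: norm_on_def)

lemma in_V [simp]:
  "0 \<in> V" "x \<in> V \<Longrightarrow> y \<in> V \<Longrightarrow> x + y \<in> V" "x \<in> V \<Longrightarrow> y \<in> V \<Longrightarrow> x - y \<in> V"
  "x \<in> V \<Longrightarrow> a *\<^sub>R x \<in> V" "x \<in> V \<Longrightarrow> - x \<in> V"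
  using sub by (simp_all add: subspace_0 subspace_add subspace_diff subspace_scale subspace_neg)

lemma N_nonneg [simp]: "x \<in> V \<Longrightarrow> 0 \<le> N x"
  and N_eq_0: "x \<in> V \<Longrightarrow> N x = 0 \<longleftrightarrow> x = 0"
  and N_scale: "x \<in> V \<Longrightarrow> N (a *\<^sub>R x) = \<bar>a\<bar> * N x"
  and N_add: "x \<in> V \<Longrightarrow> y \<in> V \<Longrightarrow> N (x + y) \<le> N x + N y"
  using norm_on by (simp_all add: norm_on_def)

lemma N_0 [simp]: "N 0 = 0"
  using N_eq_0 by simp

lemma N_minus: "x \<in> V \<Longrightarrow> N (- x) = N x"
  using N_scale[of x "-1"] by simp

lemma N_diff: "x \<in> V \<Longrightarrow> y \<in> V \<Longrightarrow> N (x - y) \<le> N x + N y"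
  using N_add[of x "- y"] N_minus[of y] by simp

lemma N_diff_commute: "x \<in> V \<Longrightarrow> y \<in> V \<Longrightarrow> N (x - y) = N (y - x)"
  using N_minus[of "x - y"] by simp

lemma N_triangle: "x \<in> V \<Longrightarrow> y \<in> V \<Longrightarrow> z \<in> V \<Longrightarrow> N (x - z) \<le> N (x - y) + N (y - z)"
  using N_add[of "x - y" "y - z"] by simp

lemma N_rev_triangle: "x \<in> V \<Longrightarrow> y \<in> V \<Longrightarrow> N x \<le> N y + N (x - y)"
  using N_add[of y "x - y"] by simp

lemma N_convex:
  assumes "x \<in> V" "y \<in> V" "0 \<le> t" "t \<le> 1"
  shows "N ((1 - t) *\<^sub>R x + t *\<^sub>R y) \<le> (1 - t) * N x + t * N y"
  using N_add[of "(1 - t) *\<^sub>R x" "t *\<^sub>R y"] assms by (simp add: N_scale)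

lemma Metric: "Metric_space V (norm_dist V N)"
proof
  fix x y z
  show "0 \<le> norm_dist V N x y" by (auto simp: norm_dist_def)
  show "norm_dist V N x y = norm_dist V N y x"
    by (auto simp: norm_dist_def N_diff_commute)
  show "(norm_dist V N x y = 0) = (x = y)" if "x \<in> V" "y \<in> V"
    using that N_eq_0[of "x - y"] by (auto simp: norm_dist_def)
  show "norm_dist V N x z \<le> norm_dist V N x y + norm_dist V N y z"
    if "x \<in> V" "y \<in> V" "z \<in> V"
    using that N_triangle by (auto simp: norm_dist_def)
qed

end

lemma linearD:
  assumes "linear_between V W f"
  shows "x \<in> V \<Longrightarrow> f x \<in> W" "x \<in> V \<Longrightarrow> y \<in> V \<Longrightarrow> f (x + y) = f x + f y"
    "x \<in> V \<Longrightarrow> f (a *\<^sub>R x) = a *\<^sub>R f x"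
  using assms by (auto simp: linear_between_def)

lemma linear_more:
  assumes "linear_between V W f" "subspace V"
  shows "f 0 = 0" "x \<in> V \<Longrightarrow> f (- x) = - f x" "x \<in> V \<Longrightarrow> y \<in> V \<Longrightarrow> f (x - y) = f x - f y"
proof -
  show "f 0 = 0"
    using linearD(3)[OF assms(1), of 0 0] subspace_0[OF assms(2)] by simp
  show neg: "f (- x) = - f x" if "x \<in> V" for x
    using linearD(3)[OF assms(1) that, of "-1"] by simp
  show "f (x - y) = f x - f y" if "x \<in> V" "y \<in> V"
    using linearD(2)[OF assms(1), of x "- y"] that neg subspace_neg[OF assms(2)] by simp
qed

locale uc_banach = normed_set +
  assumes complete: "Metric_space.mcomplete V (norm_dist V N)"
    and uc: "uniformly_convex V N"
begin

lemma Cauchy_limit: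
  fixes y :: "nat \<Rightarrow> 'a"
  assumes "\<And>n. y n \<in> V"
    and "\<And>e. e > 0 \<Longrightarrow> \<exists>M. \<forall>m\<ge>M. \<forall>n\<ge>M. N (y m - y n) < e"
  obtains l where "l \<in> V" "(\<lambda>n. N (y n - l)) \<longlonglongrightarrow> 0"
proof -
  interpret M: Metric_space V "norm_dist V N" by (rule Metric)
  have "M.MCauchy y"
    using assms by (fastforce simp: M.MCauchy_def norm_dist_def)
  then obtain l where l: "limitin M.mtopology y l sequentially"
    using complete by (auto simp: M.mcomplete_def)
  have "l \<in> V" using l M.limitin_mspace by blast
  moreover have "(\<lambda>n. N (y n - l)) \<longlonglongrightarrow> 0"
  proof -
    have "(\<lambda>n. norm_dist V N (y n) l) \<longlonglongrightarrow> 0"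
      using l by (simp add: M.limitin_metric_dist_null)
    then show ?thesis using assms(1) \<open>l \<in> V\<close> by (simp add: norm_dist_def)
  qed
  ultimately show ?thesis using that by blast
qed

lemma limit_unique:
  assumes "\<And>n. y n \<in> V" "k \<in> V" "l \<in> V"
    and "(\<lambda>n. N (y n - k)) \<longlonglongrightarrow> 0" "(\<lambda>n. N (y n - l)) \<longlonglongrightarrow> 0"
  shows "k = l"
proof -
  have "N (k - l) \<le> N (y n - k) + N (y n - l)" for n
    using N_triangle[of k "y n" l] N_diff_commute[of k "y n"] assms(1-3) by simp
  moreover have "(\<lambda>n. N (y n - k) + N (y n - l)) \<longlonglongrightarrow> 0"
    using tendsto_add[OF assms(4,5)] by simp
  ultimately have "N (k - l) \<le> 0" by (meson LIMSEQ_le_const)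
  then have "N (k - l) = 0" using N_nonneg[of "k - l"] assms(2,3) by (simp add: antisym)
  then show ?thesis using N_eq_0[of "k - l"] assms(2,3) by simp
qed

text \<open>The errors in the norms are proportional to \<open>d\<close>, so one
  \<open>\<tau>\<close> serves all radii. This uniformity is what later handles vectors of unbounded
  length.\<close>

lemma uc_scaled:
  assumes "\<eta> > 0"
  obtains \<tau> where "\<tau> > 0" "\<And>d a b. \<lbrakk>d > 0; a \<in> V; b \<in> V; N a \<le> d * (1 + \<tau>); N b \<le> d * (1 + \<tau>);
     d * (1 - \<tau>) \<le> N ((1/2) *\<^sub>R (a + b))\<rbrakk> \<Longrightarrow> N (a - b) \<le> \<eta> * d"
proof -
  obtain \<delta> where \<delta>: "\<delta> > 0" "\<And>x y. \<lbrakk>x \<in> V; y \<in> V; N x \<le> 1; N y \<le> 1; \<eta>/2 \<le> N (x - y)\<rbrakk>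
      \<Longrightarrow> N ((1/2) *\<^sub>R (x + y)) \<le> 1 - \<delta>"
    using uc assms unfolding uniformly_convex_def by (metis half_gt_zero)
  \<comment> \<open>Dividing by \<open>d * (1 + \<tau>)\<close>, which is at most 2 d, costs the
    factor 2 in \<open>\<eta>/2\<close>. The 3 makes (1 + \<tau>)(1 - 3 \<tau>) drop below 1 -
    \<tau>, against the lower bound for the midpoint.\<close>
  define \<tau> where "\<tau> = min 1 \<delta> / 3"
  have \<tau>: "\<tau> > 0" "\<tau> \<le> 1" "3 * \<tau> \<le> \<delta>" using \<delta>(1) by (auto simp: \<tau>_def)
  show ?thesis
  proof (rule that[OF \<tau>(1)])
    fix d a b assume a: "d > 0" "a \<in> V" "b \<in> V" "N a \<le> d * (1 + \<tau>)" "N b \<le> d * (1 + \<tau>)"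
     and mid: "d * (1 - \<tau>) \<le> N ((1/2) *\<^sub>R (a + b))"
    show "N (a - b) \<le> \<eta> * d"
    proof (rule ccontr)
      assume far: "\<not> N (a - b) \<le> \<eta> * d"
      define s where "s = inverse (d * (1 + \<tau>))"
      have s: "s > 0" "s * (d * (1 + \<tau>)) = 1" using a(1) \<tau>(1)
        by (simp_all add: s_def del: inverse_mult_distrib)
      have 1: "N (s *\<^sub>R a) \<le> 1" "N (s *\<^sub>R b) \<le> 1"
        using mult_left_mono[OF a(4), of s] mult_left_mono[OF a(5), of s] s a(2,3)
        by (simp_all add: N_scale)
      have "d * (1 + \<tau>) \<le> d * 2" using a(1) \<tau>(2) by simp
      then have "\<eta>/2 * (d * (1 + \<tau>)) \<le> \<eta>/2 * (d * 2)"
        by (rule mult_left_mono) (use assms in simp)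
      also have "\<dots> \<le> N (a - b)" using far by (simp add: mult.commute)
      finally have "s * (\<eta>/2 * (d * (1 + \<tau>))) \<le> s * N (a - b)" using s(1) by simp
      moreover have "s * (\<eta>/2 * (d * (1 + \<tau>))) = \<eta>/2"
      proof -
        have "s * (\<eta>/2 * (d * (1 + \<tau>))) = \<eta>/2 * (s * (d * (1 + \<tau>)))" by (simp only: mult.left_commute)
        then show ?thesis by (simp only: s(2) mult_1_right)
      qed
      moreover have "s *\<^sub>R a - s *\<^sub>R b = s *\<^sub>R (a - b)" by (simp add: algebra_simps)
      moreover have "N (s *\<^sub>R (a - b)) = s * N (a - b)" using a(2,3) s(1) N_scale[of "a - b" s] by simp
      ultimately have 2: "\<eta>/2 \<le> N (s *\<^sub>R a - s *\<^sub>R b)" by metis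
      have "(1/2) *\<^sub>R (s *\<^sub>R a + s *\<^sub>R b) = s *\<^sub>R ((1/2) *\<^sub>R (a + b))" by (simp add: algebra_simps)
      then have "s * N ((1/2) *\<^sub>R (a + b)) \<le> 1 - \<delta>"
        using \<delta>(2)[OF _ _ 1 2] a(2,3) s(1) by (simp add: N_scale)
      then have "d * (1 + \<tau>) * (s * N ((1/2) *\<^sub>R (a + b))) \<le> d * (1 + \<tau>) * (1 - \<delta>)"
        using a(1) \<tau>(1) by (intro mult_left_mono) auto
      moreover have "d * (1 + \<tau>) * (s * N ((1/2) *\<^sub>R (a + b))) = N ((1/2) *\<^sub>R (a + b))"
        using s(2) by (metis mult.assoc mult.commute mult_1)
      ultimately have "d * (1 - \<tau>) \<le> d * (1 + \<tau>) * (1 - \<delta>)" using mid by linarith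
      then have "d * (1 - \<tau>) \<le> d * ((1 + \<tau>) * (1 - \<delta>))" by (simp only: mult.assoc)
      then have "1 - \<tau> \<le> (1 + \<tau>) * (1 - \<delta>)" using a(1) by simp
      also have "\<dots> \<le> (1 + \<tau>) * (1 - 3 * \<tau>)" using \<tau> by (intro mult_left_mono) auto
      also have "\<dots> = 1 - 2 * \<tau> - 3 * (\<tau> * \<tau>)" by (simp add: algebra_simps)
      finally have "\<tau> + 3 * (\<tau> * \<tau>) \<le> 0" by simp
      moreover have "\<tau> * \<tau> > 0" using \<tau>(1) by simp
      ultimately show False using \<tau>(1) by linarith
    qed
  qed
qed

text \<open>The additive form for one fixed radius, which may be 0; it fits infima and suprema of
  norms.\<close>

lemma uc_near:
  assumes "d \<ge> 0" "\<eta> > 0"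
  obtains \<tau> where "\<tau> > 0" "\<And>a b. \<lbrakk>a \<in> V; b \<in> V; N a \<le> d + \<tau>; N b \<le> d + \<tau>;
     d - \<tau> \<le> N ((1/2) *\<^sub>R (a + b))\<rbrakk> \<Longrightarrow> N (a - b) \<le> \<eta>"
proof (cases "d = 0")
  case True
  show ?thesis
  proof (rule that[of "\<eta>/2"])
    fix a b assume "a \<in> V" "b \<in> V" "N a \<le> d + \<eta>/2" "N b \<le> d + \<eta>/2"
    then show "N (a - b) \<le> \<eta>" using True N_diff[of a b] by simp
  qed (use assms in auto)
next
  case False
  then have d: "d > 0" using assms by simp
  have "\<eta> / d > 0" using d assms by simp
  then obtain \<tau> where \<tau>: "\<tau> > 0" "\<And>d' a b. \<lbrakk>d' > 0; a \<in> V; b \<in> V; N a \<le> d' * (1 + \<tau>); N b \<le> d' * (1 + \<tau>);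
     d' * (1 - \<tau>) \<le> N ((1/2) *\<^sub>R (a + b))\<rbrakk> \<Longrightarrow> N (a - b) \<le> \<eta> / d * d'"
    using uc_scaled[of "\<eta> / d"] by blast
  show ?thesis
  proof (rule that[of "d * \<tau>"])
    show "d * \<tau> > 0" using d \<tau> by simp
    fix a b assume "a \<in> V" "b \<in> V" "N a \<le> d + d * \<tau>" "N b \<le> d + d * \<tau>"
      "d - d * \<tau> \<le> N ((1/2) *\<^sub>R (a + b))"
    then show "N (a - b) \<le> \<eta>" using \<tau>(2)[OF d, of a b] d by (simp add: algebra_simps)
  qed
qed

text \<open>A uniformly convex norm need not satisfy an inequality of power type 2, whence the slack
  \<open>\<delta> / 4\<close> on the right. Convexity enters only at the separation 1/2: with s the
  sum of the two squares, pairs with 4 N(x - z)^2 \<le> s are paid for by the slack, and all others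
  gain a definite fraction of s.\<close>

lemma uc_quadratic:
  obtains \<delta> where "\<delta> > 0" "\<delta> \<le> 1" "\<And>x z. \<lbrakk>x \<in> V; z \<in> V\<rbrakk> \<Longrightarrow>
    (N (x + z))\<^sup>2 + \<delta> * (N (x - z))\<^sup>2 \<le> (2 + \<delta> / 4) * ((N x)\<^sup>2 + (N z)\<^sup>2)"
proof -
  have "(1/2::real) > 0" by simp
  then obtain \<delta>' where \<delta>': "\<delta>' > 0" "\<And>x y. \<lbrakk>x \<in> V; y \<in> V; N x \<le> 1; N y \<le> 1; 1/2 \<le> N (x - y)\<rbrakk>
      \<Longrightarrow> N ((1/2) *\<^sub>R (x + y)) \<le> 1 - \<delta>'"
    using uc unfolding uniformly_convex_def by metis
  define e where "e = min 1 \<delta>'"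
  have e: "0 < e" "e \<le> 1" "e \<le> \<delta>'" using \<delta>'(1) by (auto simp: e_def)
  define \<gamma> where "\<gamma> = e\<^sup>2 / 8"
  have e2: "e\<^sup>2 \<le> e" using e by (simp add: power2_eq_square mult_left_le)
  have \<gamma>: "0 < \<gamma>" "\<gamma> \<le> e" "\<gamma> \<le> 1" using e e2 by (auto simp: \<gamma>_def)
  have key: "(N (x + z))\<^sup>2 \<le> (2 - \<gamma>) * ((N x)\<^sup>2 + (N z)\<^sup>2)"
    if xz: "x \<in> V" "z \<in> V" and far: "(N x)\<^sup>2 + (N z)\<^sup>2 < 4 * (N (x - z))\<^sup>2" for x z
  proof -
    define M where "M = max (N x) (N z)"
    define s where "s = (N x)\<^sup>2 + (N z)\<^sup>2"
    have M0: "M \<ge> 0" using xz by (simp add: M_def le_max_iff_disj)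
    have Ms: "M\<^sup>2 \<le> s" "s \<le> 2 * M\<^sup>2"
      using xz by (auto simp: M_def s_def max_def intro: power_mono)
    have M: "M > 0"
    proof (rule ccontr)
      assume "\<not> M > 0"
      then have "N x = 0" "N z = 0"
        using N_nonneg[OF xz(1)] N_nonneg[OF xz(2)] by (simp_all add: M_def less_max_iff_disj)
      then show False using far xz by (simp add: N_eq_0)
    qed
    have "(N (x + z))\<^sup>2 \<le> (N x + N z)\<^sup>2" using N_add xz by (intro power_mono) auto
    also have "\<dots> = 2 * s - (N x - N z)\<^sup>2" by (simp add: s_def power2_eq_square algebra_simps)
    finally have 1: "(N (x + z))\<^sup>2 \<le> 2 * s - (N x - N z)\<^sup>2" .
    \<comment> \<open>Either the two norms differ, and the scalar identity for (N x + N z)^2 gains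
      at least e^2 M^2 / 4 = 2 \<gamma> M^2 \<ge> \<gamma> s, which is the origin of
      \<open>\<gamma>\<close>; or both vectors are near the sphere of radius \<open>M\<close>, where
      uniform convexity applies.\<close>
    show ?thesis
    proof (cases "\<bar>N x - N z\<bar> \<ge> e/2 * M")
      case True
      then have "(e/2 * M)\<^sup>2 \<le> (N x - N z)\<^sup>2"
        using e M by (metis abs_le_square_iff abs_of_nonneg le_less_trans less_imp_le mult_nonneg_nonneg half_gt_zero)
      moreover have "\<gamma> * s \<le> \<gamma> * (2 * M\<^sup>2)" using Ms \<gamma> by (intro mult_left_mono) auto
      moreover have "\<gamma> * (2 * M\<^sup>2) = (e/2 * M)\<^sup>2" by (simp add: \<gamma>_def power2_eq_square)
      ultimately show ?thesis using 1 by (simp add: s_def[symmetric] algebra_simps)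
    next
      case False
      define m where "m = min (N x) (N z)"
      have m: "m \<ge> M - e/2 * M" "m \<ge> 0" "s = M\<^sup>2 + m\<^sup>2"
        using False xz by (auto simp: m_def M_def s_def max_def min_def split: if_splits)
      have pos: "M * (1 - e/2) \<ge> 0" using M e by simp
      have "(M * (1 - e/2))\<^sup>2 \<le> m\<^sup>2" using m pos by (intro power_mono) (auto simp: algebra_simps)
      \<comment> \<open>Turns a gain measured against \<open>M\<^sup>2\<close> into one measured
        against \<open>s\<close>.\<close>
      then have sm: "M\<^sup>2 * (2 - e) \<le> s"
      proof -
        have "(M * (1 - e/2))\<^sup>2 = M\<^sup>2 * (1 - e + e\<^sup>2/4)" by (simp add: power2_eq_square algebra_simps)
        moreover have "M\<^sup>2 * (1 - e + e\<^sup>2/4) \<ge> M\<^sup>2 * (1 - e)" by (intro mult_left_mono) auto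
        ultimately have "M\<^sup>2 * (1 - e) \<le> m\<^sup>2" using \<open>(M * (1 - e/2))\<^sup>2 \<le> m\<^sup>2\<close> by linarith
        then show ?thesis using m(3) by (simp add: algebra_simps)
      qed
      have "M\<^sup>2 < 4 * (N (x - z))\<^sup>2" using Ms far by (simp add: s_def)
      then have "M\<^sup>2 < (2 * N (x - z))\<^sup>2" by (simp add: power_mult_distrib)
      then have "M < 2 * N (x - z)" using xz by (meson N_nonneg in_V(3) power_less_imp_less_base mult_nonneg_nonneg zero_le_numeral)
      then have 2: "1/2 \<le> N (inverse M *\<^sub>R x - inverse M *\<^sub>R z)"
      proof -
        have "inverse M *\<^sub>R x - inverse M *\<^sub>R z = inverse M *\<^sub>R (x - z)" by (simp add: algebra_simps)
        then have "N (inverse M *\<^sub>R x - inverse M *\<^sub>R z) = inverse M * N (x - z)"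
          using M xz by (simp add: N_scale)
        moreover have "1/2 \<le> inverse M * N (x - z)" using \<open>M < 2 * N (x - z)\<close> M by (simp add: field_simps)
        ultimately show ?thesis by simp
      qed
      have "N (inverse M *\<^sub>R x) \<le> 1" "N (inverse M *\<^sub>R z) \<le> 1"
        using M xz by (simp_all add: N_scale M_def field_simps)
      then have "N ((1/2) *\<^sub>R (inverse M *\<^sub>R x + inverse M *\<^sub>R z)) \<le> 1 - \<delta>'"
        using \<delta>'(2)[OF _ _ _ _ 2] xz by simp
      moreover have "(1/2) *\<^sub>R (inverse M *\<^sub>R x + inverse M *\<^sub>R z) = (inverse M / 2) *\<^sub>R (x + z)"
        by (simp add: algebra_simps)
      moreover have "N ((inverse M / 2) *\<^sub>R (x + z)) = N (x + z) / (2 * M)"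
        using xz M N_scale[of "x + z" "inverse M / 2"] by (simp add: field_simps)
      ultimately have "N (x + z) / (2 * M) \<le> 1 - \<delta>'" by metis
      then have "N (x + z) / (2 * M) \<le> 1 - e" using e by linarith
      then have "N (x + z) \<le> 2 * M * (1 - e)" using M by (simp add: field_simps)
      then have "(N (x + z))\<^sup>2 \<le> (2 * M * (1 - e))\<^sup>2" using xz by (intro power_mono) auto
      also have "\<dots> = 4 * M\<^sup>2 * (1 - e)\<^sup>2" by (simp add: power2_eq_square)
      also have "\<dots> \<le> 4 * M\<^sup>2 * (1 - e)"
        using e by (intro mult_left_mono) (auto simp: power2_eq_square mult_left_le)
      also have "\<dots> \<le> (2 - e) * (M\<^sup>2 * (2 - e))"
      proof -
        have "4 * (1 - e) \<le> (2 - e) * (2 - e)" by (simp add: algebra_simps)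
        then have "M\<^sup>2 * (4 * (1 - e)) \<le> M\<^sup>2 * ((2 - e) * (2 - e))" by (intro mult_left_mono) auto
        then show ?thesis by (simp add: algebra_simps)
      qed
      also have "\<dots> \<le> (2 - e) * s" using sm e by (intro mult_left_mono) auto
      also have "\<dots> \<le> (2 - \<gamma>) * s" using \<gamma> Ms M by (intro mult_right_mono) (auto simp: s_def)
      finally show ?thesis by (simp add: s_def)
    qed
  qed
  show ?thesis
  \<comment> \<open>Since N(x - z)^2 \<le> 2 s, the coefficient \<open>\<gamma>/2\<close> makes the
    added term consume no more than the gain \<gamma> s of the separated case.\<close>
  proof (rule that[of "\<gamma>/2"])
    show "\<gamma>/2 > 0" "\<gamma>/2 \<le> 1" using \<gamma> by auto
    fix x z assume xz: "x \<in> V" "z \<in> V"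
    define s where "s = (N x)\<^sup>2 + (N z)\<^sup>2"
    have par: "(N (x + z))\<^sup>2 \<le> 2 * s" "(N (x - z))\<^sup>2 \<le> 2 * s"
    proof -
      have "(N x + N z)\<^sup>2 = 2 * s - (N x - N z)\<^sup>2" by (simp add: s_def power2_eq_square algebra_simps)
      then have *: "(N x + N z)\<^sup>2 \<le> 2 * s" by simp
      show "(N (x + z))\<^sup>2 \<le> 2 * s" by (rule order_trans[OF power_mono[OF N_add[OF xz]] *]) (use xz in simp)
      show "(N (x - z))\<^sup>2 \<le> 2 * s" by (rule order_trans[OF power_mono[OF N_diff[OF xz]] *]) (use xz in simp)
    qed
    have s0: "s \<ge> 0" by (simp add: s_def)
    have "(N (x + z))\<^sup>2 + \<gamma>/2 * (N (x - z))\<^sup>2 \<le> (2 + \<gamma>/2/4) * s"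
    proof (cases "s < 4 * (N (x - z))\<^sup>2")
      case True
      have "\<gamma>/2 * (N (x - z))\<^sup>2 \<le> \<gamma>/2 * (2 * s)" using par \<gamma> by (intro mult_left_mono) auto
      moreover have "(N (x + z))\<^sup>2 \<le> (2 - \<gamma>) * s" using key[OF xz] True by (simp add: s_def)
      moreover have "\<gamma> * s \<ge> 0" using \<gamma> s0 by simp
      ultimately show ?thesis by (simp add: algebra_simps)
    next
      case False
      then have "\<gamma>/2 * (N (x - z))\<^sup>2 \<le> \<gamma>/2 * (s/4)" using \<gamma> by (intro mult_left_mono) auto
      then show ?thesis using par by (simp add: algebra_simps)
    qed
    then show "(N (x + z))\<^sup>2 + \<gamma>/2 * (N (x - z))\<^sup>2 \<le> (2 + \<gamma>/2/4) * ((N x)\<^sup>2 + (N z)\<^sup>2)"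
      by (simp add: s_def)
  qed
qed

end

section \<open>Almost flat points of sublinear functionals\<close>


context normed_set
begin

text \<open>\<open>L\<close> sends a function to its expectation at time \<open>n\<close>, for a
  martingale started at \<open>v\<close> whose increments are random signs times vectors of the unit
  ball, chosen depending on the past. Keeping only this functional avoids probability spaces:
  estimates become inductions over the tree of steps.\<close>

inductive mart :: "nat \<Rightarrow> 'b \<Rightarrow> (('b \<Rightarrow> real) \<Rightarrow> real) \<Rightarrow> bool" where
  zero: "v \<in> V \<Longrightarrow> mart 0 v (\<lambda>\<phi>. \<phi> v)"
| step: "v \<in> V \<Longrightarrow> x \<in> V \<Longrightarrow> N x \<le> 1 \<Longrightarrow> mart n (v + x) L1 \<Longrightarrow> mart n (v - x) L2 \<Longrightarrow>
    mart (Suc n) v (\<lambda>\<phi>. (L1 \<phi> + L2 \<phi>) / 2)"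

lemma mart_affine: "mart n v L \<Longrightarrow> L (\<lambda>z. a * \<phi> z + b * \<psi> z + k) = a * L \<phi> + b * L \<psi> + k"
  by (induction rule: mart.induct) (simp_all add: field_simps)

lemma mart_mono: "mart n v L \<Longrightarrow> (\<And>z. z \<in> V \<Longrightarrow> \<phi> z \<le> \<psi> z) \<Longrightarrow> L \<phi> \<le> L \<psi>"
  by (induction rule: mart.induct) (simp_all add: add_mono)

text \<open>Jensen's inequality for midpoint convex functions; the mean position is the starting
  point.\<close>

lemma mart_ge:
  "mart n v L \<Longrightarrow> (\<And>z x. z \<in> V \<Longrightarrow> x \<in> V \<Longrightarrow> 2 * \<phi> z \<le> \<phi> (z + x) + \<phi> (z - x)) \<Longrightarrow> \<phi> v \<le> L \<phi>"
proof (induction rule: mart.induct)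
  case (step v x n L1 L2)
  from step.IH step.prems[OF step.hyps(1,2)] step.prems show ?case by fastforce
qed simp

lemma mart_translate: "mart n v L \<Longrightarrow> a \<in> V \<Longrightarrow> mart n (v + a) (\<lambda>\<phi>. L (\<lambda>z. \<phi> (z + a)))"
proof (induction rule: mart.induct)
  case (zero v)
  then show ?case using mart.zero[of "v + a"] by simp
next
  case (step v x n L1 L2)
  then have "mart n (v + a + x) (\<lambda>\<phi>. L1 (\<lambda>z. \<phi> (z + a)))" "mart n (v + a - x) (\<lambda>\<phi>. L2 (\<lambda>z. \<phi> (z + a)))"
    by (simp_all add: algebra_simps)
  from mart.step[OF _ _ _ this] step show ?case by simp
qed

text \<open>The tower property as an inequality: a bound \<open>\<psi> y\<close> for the last
  \<open>n\<close> steps, conditional on the position \<open>y\<close> at time \<open>m\<close>,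
  replaces these steps.\<close>

lemma mart_split:
  assumes "\<And>y L. y \<in> V \<Longrightarrow> mart n y L \<Longrightarrow> L \<phi> \<le> \<psi> y"
  shows "mart (m + n) v L \<Longrightarrow> v \<in> V \<Longrightarrow> \<exists>L'. mart m v L' \<and> L \<phi> \<le> L' \<psi>"
proof (induction m arbitrary: v L)
  case 0
  then have "mart 0 v (\<lambda>\<phi>. \<phi> v)" "L \<phi> \<le> (\<lambda>\<phi>. \<phi> v) \<psi>" using assms[of v L] mart.zero[of v] by auto
  then show ?case by blast
next
  case (Suc m)
  from Suc.prems(1) obtain x L1 L2 where L: "L = (\<lambda>\<phi>. (L1 \<phi> + L2 \<phi>) / 2)" and x: "x \<in> V" "N x \<le> 1"
    and 12: "mart (m + n) (v + x) L1" "mart (m + n) (v - x) L2"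
    by (auto elim: mart.cases)
  from Suc.IH[OF 12(1)] Suc.IH[OF 12(2)] x Suc.prems(2) obtain L1' L2' where
    "mart m (v + x) L1'" "L1 \<phi> \<le> L1' \<psi>" "mart m (v - x) L2'" "L2 \<phi> \<le> L2' \<psi>" by auto
  then have "mart (Suc m) v (\<lambda>\<phi>. (L1' \<phi> + L2' \<phi>) / 2)" "L \<phi> \<le> (\<lambda>\<phi>. (L1' \<phi> + L2' \<phi>) / 2) \<psi>"
    using mart.step[of v x m L1' L2'] x Suc.prems(2) L by auto
  then show ?case by blast
qed

text \<open>Taking at every position the increment with large second difference raises the mean of
  \<open>f\<close> by at least \<open>e / 2\<close> per step.\<close>

lemma mart_growth:
  fixes e :: real
  assumes "\<And>v. v \<in> V \<Longrightarrow> \<exists>x\<in>V. N x \<le> 1 \<and> f (v + x) + f (v - x) - 2 * f v \<ge> e"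
  shows "v \<in> V \<Longrightarrow> \<exists>L. mart n v L \<and> L f \<ge> f v + n * e / 2"
proof (induction n arbitrary: v)
  case 0
  then have "mart 0 v (\<lambda>\<phi>. \<phi> v)" "(\<lambda>\<phi>. \<phi> v) f \<ge> f v + real 0 * e / 2" using mart.zero[of v] by auto
  then show ?case by blast
next
  case (Suc n)
  obtain x where x: "x \<in> V" "N x \<le> 1" "f (v + x) + f (v - x) - 2 * f v \<ge> e"
    using assms Suc.prems by blast
  with Suc obtain L1 L2 where L: "mart n (v + x) L1" "L1 f \<ge> f (v + x) + n * e / 2"
    "mart n (v - x) L2" "L2 f \<ge> f (v - x) + n * e / 2" by (meson in_V(2,3))
  show ?case
  proof (intro exI conjI)
    show "mart (Suc n) v (\<lambda>\<phi>. (L1 \<phi> + L2 \<phi>) / 2)" using mart.step[OF Suc.prems x(1,2) L(1,3)] .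
    show "f v + real (Suc n) * e / 2 \<le> (L1 f + L2 f) / 2" using L(2,4) x(3) by (simp add: field_simps)
  qed
qed

end

section \<open>Second moments and almost flat points\<close>

context uc_banach
begin

text \<open>The triangle inequality gives a factor 4 for each doubling of time; the task is to get
  below 4. Given the position \<open>y\<close> at half time, \<open>uc_quadratic\<close> is applied
  to \<open>y\<close> and the later displacement \<open>z\<close>. Jensen shows that the mean of N(y
  - z)^2 is at least N(y)^2, so the negative term survives averaging.\<close>

lemma mart_square_bound:
  obtains \<theta> where "\<theta> < 4" "\<theta> > 0" "\<And>k L. mart (2 ^ k) 0 L \<Longrightarrow> L (\<lambda>z. (N z)\<^sup>2) \<le> \<theta> ^ k"
proof -
  obtain d where d: "d > 0" "d \<le> 1" "\<And>x z. \<lbrakk>x \<in> V; z \<in> V\<rbrakk> \<Longrightarrow>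
    (N (x + z))\<^sup>2 + d * (N (x - z))\<^sup>2 \<le> (2 + d / 4) * ((N x)\<^sup>2 + (N z)\<^sup>2)"
    using uc_quadratic by blast
  have double: "L (\<lambda>z. (N z)\<^sup>2) \<le> (4 - d / 2) * s"
    if s: "\<And>L. mart m 0 L \<Longrightarrow> L (\<lambda>z. (N z)\<^sup>2) \<le> s" and L: "mart (m + m) 0 L" for L m s
  proof -
    \<comment> \<open>The coefficient 2 + d/4 loses \<open>d\<close> to the negative term, leaving 2
      - 3d/4; averaging over \<open>y\<close> then adds up to 4 - d/2. The summand with factor 0
      only fits the shape of \<open>mart_affine\<close>.\<close>
    define \<psi> where "\<psi> y = (2 - 3 * d / 4) * (N y)\<^sup>2 + 0 * (N y)\<^sup>2 + (2 + d / 4) * s" for y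
    have "L' (\<lambda>z. (N z)\<^sup>2) \<le> \<psi> y" if y: "y \<in> V" and L': "mart m y L'" for y L'
    proof -
      let ?L = "\<lambda>\<phi>. L' (\<lambda>z. \<phi> (z - y))"
      have L0: "mart m 0 ?L" using mart_translate[OF L', of "- y"] y by simp
      have "L' (\<lambda>z. (N z)\<^sup>2) = ?L (\<lambda>z. (N (y + z))\<^sup>2)" by simp
      also have "\<dots> \<le> ?L (\<lambda>z. (2 + d / 4) * (N z)\<^sup>2 + (- d) * (N (y - z))\<^sup>2 + (2 + d / 4) * (N y)\<^sup>2)"
        using d(3)[OF y] by (intro mart_mono[OF L0]) (simp add: algebra_simps)
      also have "\<dots> = (2 + d / 4) * ?L (\<lambda>z. (N z)\<^sup>2) + (- d) * ?L (\<lambda>z. (N (y - z))\<^sup>2) + (2 + d / 4) * (N y)\<^sup>2"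
        by (rule mart_affine[OF L0])
      also have "\<dots> \<le> (2 + d / 4) * s + (- d) * (N y)\<^sup>2 + (2 + d / 4) * (N y)\<^sup>2"
      proof -
        have "2 * (N (y - z))\<^sup>2 \<le> (N (y - (z + x)))\<^sup>2 + (N (y - (z - x)))\<^sup>2" if "z \<in> V" "x \<in> V" for z x
        proof -
          have "2 *\<^sub>R (y - z) = (y - (z + x)) + (y - (z - x))" by (simp add: scaleR_2)
          then have "2 * N (y - z) \<le> N (y - (z + x)) + N (y - (z - x))"
            using N_add[of "y - (z + x)" "y - (z - x)"] N_scale[of "y - z" 2] that y by simp
          then have "(2 * N (y - z))\<^sup>2 \<le> (N (y - (z + x)) + N (y - (z - x)))\<^sup>2"
            using that y by (intro power_mono) auto
          moreover have "(a + b)\<^sup>2 = 2 * (a\<^sup>2 + b\<^sup>2) - (a - b)\<^sup>2" for a b :: real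
            by (simp add: power2_eq_square algebra_simps)
          ultimately have "4 * (N (y - z))\<^sup>2 \<le> 2 * ((N (y - (z + x)))\<^sup>2 + (N (y - (z - x)))\<^sup>2)"
            by (smt (verit) power_mult_distrib zero_le_power2 power2_eq_square)
          then show ?thesis by simp
        qed
        then have "(N (y - 0))\<^sup>2 \<le> ?L (\<lambda>z. (N (y - z))\<^sup>2)" by (intro mart_ge[OF L0]) auto
        then have "(- d) * ?L (\<lambda>z. (N (y - z))\<^sup>2) \<le> (- d) * (N y)\<^sup>2" using d(1) by simp
        moreover have "(2 + d / 4) * ?L (\<lambda>z. (N z)\<^sup>2) \<le> (2 + d / 4) * s"
          using s[OF L0] d(1) by (intro mult_left_mono) auto
        ultimately show ?thesis by linarith
      qed
      also have "\<dots> = \<psi> y" by (simp add: \<psi>_def algebra_simps)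
      finally show ?thesis .
    qed
    then obtain L' where L': "mart m 0 L'" "L (\<lambda>z. (N z)\<^sup>2) \<le> L' \<psi>"
      using mart_split[of m "\<lambda>z. (N z)\<^sup>2" \<psi> m 0 L] L by auto
    note L'(2)
    also have "L' \<psi> = (2 - 3 * d / 4) * L' (\<lambda>z. (N z)\<^sup>2) + 0 * L' (\<lambda>z. (N z)\<^sup>2) + (2 + d / 4) * s"
      unfolding \<psi>_def by (rule mart_affine[OF L'(1)])
    also have "\<dots> \<le> (2 - 3 * d / 4) * s + (2 + d / 4) * s"
      using s[OF L'(1)] d(2) by (simp add: mult_left_mono)
    also have "\<dots> = (4 - d / 2) * s" by (simp add: algebra_simps)
    finally show ?thesis .
  qed
  have "mart (2 ^ k) 0 L \<Longrightarrow> L (\<lambda>z. (N z)\<^sup>2) \<le> (4 - d / 2) ^ k" for k L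
  proof (induction k arbitrary: L)
    case 0
    then have "mart (Suc 0) 0 L" by simp
    then obtain x L1 L2 where L: "L = (\<lambda>\<phi>. (L1 \<phi> + L2 \<phi>) / 2)" and x: "x \<in> V" "N x \<le> 1"
      and 12: "mart 0 (0 + x) L1" "mart 0 (0 - x) L2"
      by (auto elim: mart.cases)
    then have "L1 = (\<lambda>\<phi>. \<phi> (0 + x))" "L2 = (\<lambda>\<phi>. \<phi> (0 - x))" by (auto elim: mart.cases)
    moreover have "(N x)\<^sup>2 \<le> 1" using x by (simp add: power_le_one)
    ultimately show ?case using x by (simp add: L N_minus)
  next
    case (Suc k)
    have "L (\<lambda>z. (N z)\<^sup>2) \<le> (4 - d / 2) * (4 - d / 2) ^ k"
      by (rule double[of "2 ^ k"]) (use Suc in \<open>simp_all add: mult_2\<close>)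
    then show ?case by simp
  qed
  then show ?thesis using that[of "4 - d / 2"] d by simp
qed

text \<open>With second differences at least \<open>e\<close> everywhere, a martingale of 2^k steps
  would have mean of \<open>f\<close>, hence of \<open>N\<close>, at least 2^k e / 2. Its second
  moment would be at least 4^k e^2 / 4, which outgrows \<theta>^k.\<close>

lemma asymptotically_flat:
  assumes le: "\<And>v. v \<in> V \<Longrightarrow> f v \<le> N v" and "f 0 = 0" "e > 0"
  shows "\<exists>v\<in>V. \<forall>x\<in>V. N x \<le> 1 \<longrightarrow> f (v + x) + f (v - x) - 2 * f v < e"
proof (rule ccontr)
  assume "\<not> ?thesis"
  then have H: "\<And>v. v \<in> V \<Longrightarrow> \<exists>x\<in>V. N x \<le> 1 \<and> f (v + x) + f (v - x) - 2 * f v \<ge> e"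
    by (meson linorder_not_less)
  obtain \<theta> where \<theta>: "\<theta> < 4" "\<theta> > 0" "\<And>k L. mart (2 ^ k) 0 L \<Longrightarrow> L (\<lambda>z. (N z)\<^sup>2) \<le> \<theta> ^ k"
    using mart_square_bound by blast
  have lower: "(2 ^ k * e / 2)\<^sup>2 \<le> \<theta> ^ k" for k
  proof -
    define t where "t = 2 ^ k * e / 2"
    obtain L where L: "mart (2 ^ k) 0 L" "L f \<ge> t"
      using mart_growth[OF H, of 0 "2 ^ k"] \<open>f 0 = 0\<close> by (auto simp: t_def)
    have "t \<ge> 0" using \<open>e > 0\<close> by (simp add: t_def)
    have "t \<le> L N" using mart_mono[OF L(1), of f N] le L(2) by auto
    \<comment> \<open>The square of a mean is below the mean of the square: the pointwise bound 2 t
      N - t^2 \<le> N^2 is averaged, with \<open>t\<close> the lower bound for the mean of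
      \<open>N\<close>.\<close>
    then have "2 * t * t - t\<^sup>2 \<le> 2 * t * L N + 0 * L N - t\<^sup>2"
      using \<open>t \<ge> 0\<close> by (simp add: mult_left_mono)
    also have "\<dots> = L (\<lambda>z. 2 * t * N z + 0 * N z + - t\<^sup>2)"
      using mart_affine[OF L(1), of "2 * t" N 0 N "- t\<^sup>2"] by simp
    also have "\<dots> \<le> L (\<lambda>z. (N z)\<^sup>2)"
    proof (rule mart_mono[OF L(1)])
      fix z
      have "0 \<le> (N z - t)\<^sup>2" by simp
      then show "2 * t * N z + 0 * N z + - t\<^sup>2 \<le> (N z)\<^sup>2" by (simp add: power2_eq_square algebra_simps)
    qed
    also have "\<dots> \<le> \<theta> ^ k" using \<theta>(3)[OF L(1)] .
    finally show ?thesis by (simp add: t_def[symmetric] power2_eq_square)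
  qed
  have "(\<lambda>k. (\<theta> / 4) ^ k) \<longlonglongrightarrow> 0" using \<theta> by (intro LIMSEQ_power_zero) auto
  moreover have "e\<^sup>2 / 4 \<le> (\<theta> / 4) ^ k" for k
  proof -
    have "(2 ^ k * e / 2)\<^sup>2 = 4 ^ k * (e\<^sup>2 / 4)"
    proof -
      have "((2::real) ^ k)\<^sup>2 = 4 ^ k" by (simp add: power2_eq_square flip: power_mult_distrib)
      then show ?thesis by (simp add: power_mult_distrib power_divide)
    qed
    then have "4 ^ k * (e\<^sup>2 / 4) \<le> \<theta> ^ k" using lower[of k] by metis
    then show ?thesis by (simp add: power_divide field_simps)
  qed
  ultimately have "e\<^sup>2 / 4 \<le> 0" by (meson LIMSEQ_le_const)
  then show False using \<open>e > 0\<close> by simp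
qed

end

section \<open>Invariant functionals\<close>


locale isometries = uc_banach +
  fixes H :: "('a \<Rightarrow> 'a) set"
  assumes lin: "h \<in> H \<Longrightarrow> linear_between V V h"
    and iso: "h \<in> H \<Longrightarrow> v \<in> V \<Longrightarrow> N (h v) = N v"
    and inverse: "h \<in> H \<Longrightarrow> \<exists>k\<in>H. \<forall>v\<in>V. k (h v) = v \<and> h (k v) = v"
begin

text \<open>The convex semigroup of operators generated by \<open>H\<close>. Its values at
  \<open>v\<close> fill the convex hull of the orbit, but operators can also be composed and applied
  to several vectors at once, which making finitely many displacements small will require.\<close>

inductive_set avg :: "('a \<Rightarrow> 'a) set" where
  id: "(\<lambda>v. v) \<in> avg"
| map: "h \<in> H \<Longrightarrow> h \<in> avg"
| comp: "A \<in> avg \<Longrightarrow> B \<in> avg \<Longrightarrow> (\<lambda>v. A (B v)) \<in> avg"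
| conv: "A \<in> avg \<Longrightarrow> B \<in> avg \<Longrightarrow> 0 \<le> t \<Longrightarrow> t \<le> 1 \<Longrightarrow> (\<lambda>v. (1 - t) *\<^sub>R A v + t *\<^sub>R B v) \<in> avg"

lemma avg_lin: "A \<in> avg \<Longrightarrow> linear_between V V A"
proof (induction rule: avg.induct)
  case (map h) then show ?case by (rule lin)
next
  case (conv A B t)
  note A = linearD[OF conv.IH(1)] and B = linearD[OF conv.IH(2)]
  show ?case unfolding linear_between_def
    using A B by (auto simp: algebra_simps)
next
  case (comp A B)
  then show ?case using linearD[OF comp.IH(1)] linearD[OF comp.IH(2)]
    by (auto simp: linear_between_def)
qed (auto simp: linear_between_def)

lemmas avg_in [simp] = linearD(1)[OF avg_lin]
  and avg_neg = linear_more(2)[OF avg_lin sub]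

lemma H_in [simp]: "h \<in> H \<Longrightarrow> v \<in> V \<Longrightarrow> h v \<in> V"
  using linearD(1)[OF lin] .

lemma avg_contract: "A \<in> avg \<Longrightarrow> v \<in> V \<Longrightarrow> N (A v) \<le> N v"
proof (induction arbitrary: v rule: avg.induct)
  case (comp A B)
  then have "N (A (B v)) \<le> N (B v)" "N (B v) \<le> N v" by simp_all
  then show ?case by linarith
next
  case (conv A B t)
  have "N ((1 - t) *\<^sub>R A v + t *\<^sub>R B v) \<le> (1 - t) * N (A v) + t * N (B v)"
    using conv by (intro N_convex) auto
  also have "\<dots> \<le> (1 - t) * N v + t * N v" using conv by (intro add_mono mult_left_mono) auto
  finally show ?case by (simp add: algebra_simps)
qed (auto simp: iso)

section \<open>Fixed vectors, invariant functionals and epigraph cones\<close>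

definition fixed :: "'a set" where
  "fixed = {v \<in> V. \<forall>h\<in>H. h v = v}"

definition invfun :: "('a \<Rightarrow> real) \<Rightarrow> bool" where
  "invfun f \<longleftrightarrow> (\<forall>x\<in>V. \<forall>y\<in>V. f (x + y) = f x + f y) \<and> (\<forall>a. \<forall>x\<in>V. f (a *\<^sub>R x) = a * f x) \<and>
     (\<forall>x\<in>V. \<bar>f x\<bar> \<le> N x) \<and> (\<forall>h\<in>H. \<forall>x\<in>V. f (h x) = f x)"

lemma invfunD:
  assumes "invfun f"
  shows "x \<in> V \<Longrightarrow> y \<in> V \<Longrightarrow> f (x + y) = f x + f y" "x \<in> V \<Longrightarrow> f (a *\<^sub>R x) = a * f x"
    "x \<in> V \<Longrightarrow> \<bar>f x\<bar> \<le> N x" "h \<in> H \<Longrightarrow> x \<in> V \<Longrightarrow> f (h x) = f x"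
  using assms by (auto simp: invfun_def)

lemma invfun_diff: "invfun f \<Longrightarrow> x \<in> V \<Longrightarrow> y \<in> V \<Longrightarrow> f (x - y) = f x - f y"
  using invfunD(1)[of f x "- y"] invfunD(2)[of f y "-1"] by simp

lemma invfun_avg: "A \<in> avg \<Longrightarrow> invfun f \<Longrightarrow> v \<in> V \<Longrightarrow> f (A v) = f v"
proof (induction arbitrary: v rule: avg.induct)
  case (conv A B t)
  have "f ((1 - t) *\<^sub>R A v + t *\<^sub>R B v) = (1 - t) * f (A v) + t * f (B v)"
    using conv by (simp add: invfunD)
  then show ?case using conv by (simp add: algebra_simps)
qed (auto simp: invfunD)

text \<open>Stands for the epigraph of an invariant sublinear functional. Smaller functionals have
  larger epigraphs, so minimal functionals become maximal cones and, in Zorn's lemma, unions of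
  chains replace pointwise infima. The last clause keeps the functional above minus
  infinity.\<close>

definition inv_cone :: "('a \<times> real) set \<Rightarrow> bool" where
  "inv_cone E \<longleftrightarrow> E \<subseteq> V \<times> UNIV \<and>
     (\<forall>v r w s. (v, r) \<in> E \<longrightarrow> (w, s) \<in> E \<longrightarrow> (v + w, r + s) \<in> E) \<and>
     (\<forall>v r t. t > 0 \<longrightarrow> (v, r) \<in> E \<longrightarrow> (t *\<^sub>R v, t * r) \<in> E) \<and>
     (\<forall>h\<in>H. \<forall>v r. (v, r) \<in> E \<longrightarrow> (h v, r) \<in> E) \<and>
     (\<forall>r. (0, r) \<in> E \<longrightarrow> r \<ge> 0)"

text \<open>
  A minimal invariant sublinear functional is linear: minimality makes every vector have averages
  on which the functional almost attains \<open>- f (- w)\<close>, so \<open>f w + f (- w)\<close> can be read off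
  at a point where \<open>f\<close> is almost flat.
\<close>

lemma inv_cone_maximal_linear:
  assumes E: "inv_cone E" and NE: "\<And>v r. v \<in> V \<Longrightarrow> N v \<le> r \<Longrightarrow> (v, r) \<in> E"
    and max: "\<And>E'. inv_cone E' \<Longrightarrow> E \<subseteq> E' \<Longrightarrow> E' = E"
  shows "\<exists>f. invfun f \<and> (\<forall>v r. (v, r) \<in> E \<longrightarrow> f v \<le> r)"
proof -
  have EV: "(v, r) \<in> E \<Longrightarrow> v \<in> V"
    and Eadd: "(v, r) \<in> E \<Longrightarrow> (w, s) \<in> E \<Longrightarrow> (v + w, r + s) \<in> E"
    and Escale: "t > 0 \<Longrightarrow> (v, r) \<in> E \<Longrightarrow> (t *\<^sub>R v, t * r) \<in> E"
    and EH: "h \<in> H \<Longrightarrow> (v, r) \<in> E \<Longrightarrow> (h v, r) \<in> E"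
    and E0: "(0, r) \<in> E \<Longrightarrow> r \<ge> 0" for v r w s t h
    using E by (auto simp: inv_cone_def)
  define f where "f v = Inf {r. (v, r) \<in> E}" for v
  have lower: "- N v \<le> r" if "(v, r) \<in> E" for v r
    using Eadd[OF that NE[of "- v" "N v"]] EV[OF that] E0[of "r + N v"] by (simp add: N_minus)
  have bdd: "bdd_below {r. (v, r) \<in> E}" for v
    using lower by (intro bdd_belowI[of _ "- N v"]) auto
  have ne: "{r. (v, r) \<in> E} \<noteq> {}" if "v \<in> V" for v
    using NE[OF that order_refl] by blast
  have f_le: "f v \<le> r" if "(v, r) \<in> E" for v r
    unfolding f_def using that bdd by (intro cInf_lower) auto
  have f_ge: "a \<le> f v" if "v \<in> V" "\<And>r. (v, r) \<in> E \<Longrightarrow> a \<le> r" for a v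
    unfolding f_def using that ne by (intro cInf_greatest) auto
  have sub_add: "f (v + w) \<le> f v + f w" if "v \<in> V" "w \<in> V" for v w
  proof -
    have "f (v + w) - s \<le> f v" if "(w, s) \<in> E" for s
      using f_le[OF Eadd[OF _ that]] by (intro f_ge[OF \<open>v \<in> V\<close>]) fastforce
    then have "f (v + w) - f v \<le> f w" by (intro f_ge[OF \<open>w \<in> V\<close>]) fastforce
    then show ?thesis by simp
  qed
  have scale_le: "f (t *\<^sub>R v) \<le> t * f v" if "t > 0" "v \<in> V" for t v
  proof -
    have "f (t *\<^sub>R v) / t \<le> f v"
      using f_le[OF Escale[OF \<open>t > 0\<close>]] \<open>t > 0\<close>
      by (intro f_ge[OF \<open>v \<in> V\<close>]) (simp add: divide_le_eq mult.commute)
    then show ?thesis using \<open>t > 0\<close> by (simp add: divide_le_eq mult.commute)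
  qed
  have scale: "f (t *\<^sub>R v) = t * f v" if "t > 0" "v \<in> V" for t v
  proof (rule antisym[OF scale_le[OF that]])
    have "f (inverse t *\<^sub>R (t *\<^sub>R v)) \<le> inverse t * f (t *\<^sub>R v)" using that by (intro scale_le) auto
    then show "t * f v \<le> f (t *\<^sub>R v)" using that by (simp add: field_simps)
  qed
  have leN: "f v \<le> N v" if "v \<in> V" for v
    using f_le[OF NE[OF that order_refl]] .
  have f0: "f 0 = 0"
    using leN[of 0] f_ge[of 0 0] E0 by (intro antisym) simp_all
  have H_le: "f (h v) \<le> f v" if "h \<in> H" "v \<in> V" for h v
    using f_le[OF EH[OF \<open>h \<in> H\<close>]] by (intro f_ge[OF \<open>v \<in> V\<close>]) auto
  have H_eq: "f (h v) = f v" if "h \<in> H" "v \<in> V" for h v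
  proof (rule antisym[OF H_le[OF that]])
    obtain k where "k \<in> H" "k (h v) = v" using inverse \<open>h \<in> H\<close> \<open>v \<in> V\<close> by blast
    then show "f v \<le> f (h v)" using H_le[of k "h v"] that by simp
  qed
  have minimal: "f (- w) \<le> - a" if w: "w \<in> V" and a: "\<And>A. A \<in> avg \<Longrightarrow> a \<le> f (A w)" for w a
  proof -
    \<comment> \<open>\<open>E\<close> enlarged by the rays through \<open>(- A w, - a)\<close> for
      all averages \<open>A\<close>. It stays proper because \<open>a\<close> is a lower bound of
      \<open>f\<close> on the averages of \<open>w\<close>; maximality then puts
      \<open>(- w, - a)\<close> into \<open>E\<close>.\<close>
    define E' where "E' = {(x, r). x \<in> V \<and> (\<exists>A\<in>avg. \<exists>t\<ge>0. (x + t *\<^sub>R A w, r + t * a) \<in> E)}"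
    have E'I: "(x, r) \<in> E'" if "A \<in> avg" "x \<in> V" "t \<ge> 0" "(x + t *\<^sub>R A w, r + t * a) \<in> E" for A x r t
      using that by (auto simp: E'_def)
    have "E \<subseteq> E'"
    proof clarify
      fix v r assume "(v, r) \<in> E"
      then have "v \<in> V" "(v + 0 *\<^sub>R w, r + 0 * a) \<in> E" using EV by auto
      then show "(v, r) \<in> E'" using E'I[OF avg.id, of v 0 r] by simp
    qed
    moreover have "inv_cone E'"
      unfolding inv_cone_def
    proof (intro conjI allI impI ballI)
      show "E' \<subseteq> V \<times> UNIV" by (auto simp: E'_def)
    next
      fix v r v' r' assume "(v, r) \<in> E'" "(v', r') \<in> E'"
      then obtain A t A' t' where A: "A \<in> avg" "t \<ge> 0" "(v + t *\<^sub>R A w, r + t * a) \<in> E"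
        "A' \<in> avg" "t' \<ge> 0" "(v' + t' *\<^sub>R A' w, r' + t' * a) \<in> E" and v: "v \<in> V" "v' \<in> V"
        by (auto simp: E'_def)
      \<comment> \<open>Convexity merges two rays into one average. If both coefficients vanish,
        division by zero gives weight 0 and \<open>A''\<close> is \<open>A\<close>.\<close>
      define A'' where "A'' x = (1 - t' / (t + t')) *\<^sub>R A x + (t' / (t + t')) *\<^sub>R A' x" for x
      have "A'' \<in> avg" unfolding A''_def using A by (intro avg.conv) (auto simp: divide_le_eq)
      moreover have "(t + t') *\<^sub>R A'' w = t *\<^sub>R A w + t' *\<^sub>R A' w"
      proof (cases "t + t' = 0")
        case True
        then have "t = 0" "t' = 0" using A by auto
        then show ?thesis by simp
      next
        case False
        have "(t + t') * (1 - t' / (t + t')) = t" "(t + t') * (t' / (t + t')) = t'"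
          using False by (simp_all add: right_diff_distrib)
        then show ?thesis by (simp add: A''_def scaleR_add_right)
      qed
      then have "v + v' + (t + t') *\<^sub>R A'' w = (v + t *\<^sub>R A w) + (v' + t' *\<^sub>R A' w)" by simp
      then have "(v + v' + (t + t') *\<^sub>R A'' w, r + r' + (t + t') * a) \<in> E"
        using Eadd[OF A(3) A(6)] by (simp add: algebra_simps)
      ultimately show "(v + v', r + r') \<in> E'"
        using E'I[of A'' "v + v'" "t + t'"] A(2,5) v by simp
    next
      fix v r and s :: real assume s: "0 < s" and "(v, r) \<in> E'"
      then obtain A t where A: "A \<in> avg" "t \<ge> 0" "(v + t *\<^sub>R A w, r + t * a) \<in> E" "v \<in> V" by (auto simp: E'_def)
      have "(s *\<^sub>R v + (s * t) *\<^sub>R A w, s * r + (s * t) * a) \<in> E"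
        using Escale[OF s A(3)] by (simp add: algebra_simps)
      then show "(s *\<^sub>R v, s * r) \<in> E'" using E'I[of A "s *\<^sub>R v" "s * t"] A s by simp
    next
      fix h v r assume h: "h \<in> H" and "(v, r) \<in> E'"
      then obtain A t where A: "A \<in> avg" "t \<ge> 0" "(v + t *\<^sub>R A w, r + t * a) \<in> E" "v \<in> V" by (auto simp: E'_def)
      note l = linearD[OF lin[OF h]]
      have "(h v + t *\<^sub>R h (A w), r + t * a) \<in> E"
        using EH[OF h A(3)] A w by (simp add: l)
      moreover have "(\<lambda>x. h (A x)) \<in> avg" using avg.comp[OF avg.map[OF h] A(1)] .
      ultimately show "(h v, r) \<in> E'" using E'I[of "\<lambda>x. h (A x)" "h v" t r] A h by simp
    next
      fix r assume "(0, r) \<in> E'"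
      then obtain A t where A: "A \<in> avg" "t \<ge> 0" "(t *\<^sub>R A w, r + t * a) \<in> E" by (auto simp: E'_def)
      show "0 \<le> r"
      proof (cases "t = 0")
        case True
        then show ?thesis using A E0 by simp
      next
        case False
        then have "t * f (A w) \<le> r + t * a" using f_le[OF A(3)] scale[of t "A w"] A w by simp
        moreover have "t * a \<le> t * f (A w)" using a A by (intro mult_left_mono) auto
        ultimately show ?thesis by simp
      qed
    qed
    ultimately have "E' = E" using max by blast
    moreover have "(- w, - a) \<in> E'"
    proof -
      have "(- w + 1 *\<^sub>R w, - a + 1 * a) \<in> E" using NE[of 0 0] by simp
      then show ?thesis using E'I[OF avg.id, of "- w" 1 "- a"] w by simp
    qed
    ultimately show ?thesis using f_le by simp
  qed
  have flat: "f x + f (- x) \<le> e" if x: "x \<in> V" "N x \<le> 1" and e: "e > 0" for x e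
  proof -
    have "e/2 > 0" using e by simp
    then obtain v where v: "v \<in> V" and fl: "\<And>x. x \<in> V \<Longrightarrow> N x \<le> 1 \<Longrightarrow> f (v + x) + f (v - x) - 2 * f v < e/2"
      using asymptotically_flat[of f "e/2"] leN f0 by blast
    \<comment> \<open>The bound refers to \<open>f v\<close>, not to \<open>f y\<close>; in this
      form it is inherited under \<open>H\<close> and convex combinations, and so passes from
      \<open>v\<close> to all its averages.\<close>
    define P where "P y \<longleftrightarrow> (\<forall>x\<in>V. N x \<le> 1 \<longrightarrow> f (y + x) + f (y - x) \<le> 2 * f v + e/2)" for y
    have PA: "A \<in> avg \<Longrightarrow> y \<in> V \<Longrightarrow> P y \<Longrightarrow> P (A y)" for A y
    proof (induction arbitrary: y rule: avg.induct)
      case (map h)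
      show ?case unfolding P_def
      proof (intro ballI impI)
        fix x assume x: "x \<in> V" "N x \<le> 1"
        obtain k where k: "k \<in> H" "\<And>v. v \<in> V \<Longrightarrow> h (k v) = v" using inverse map by blast
        note l = linearD[OF lin[OF map.hyps]] linear_more[OF lin[OF map.hyps] sub]
        have "h y + x = h (y + k x)" "h y - x = h (y - k x)" using l map.prems x k by simp_all
        then have "f (h y + x) = f (y + k x)" "f (h y - x) = f (y - k x)"
          using H_eq map x k by simp_all
        then show "f (h y + x) + f (h y - x) \<le> 2 * f v + e/2"
          using map.prems x k iso[of k x] by (simp add: P_def)
      qed
    next
      case (conv A B t)
      show ?case unfolding P_def
      proof (intro ballI impI)
        fix x assume x: "x \<in> V" "N x \<le> 1"
        have c: "f ((1 - t) *\<^sub>R p + t *\<^sub>R q) \<le> (1 - t) * f p + t * f q" if "p \<in> V" "q \<in> V" for p q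
        proof (cases "t = 0 \<or> t = 1")
          case False
          then show ?thesis
            using sub_add[of "(1 - t) *\<^sub>R p" "t *\<^sub>R q"] scale[of "1 - t" p] scale[of t q] that conv.hyps by simp
        qed auto
        have "(1 - t) *\<^sub>R A y + t *\<^sub>R B y + x = (1 - t) *\<^sub>R (A y + x) + t *\<^sub>R (B y + x)"
          "(1 - t) *\<^sub>R A y + t *\<^sub>R B y - x = (1 - t) *\<^sub>R (A y - x) + t *\<^sub>R (B y - x)"
          by (simp_all add: algebra_simps)
        then have "f ((1 - t) *\<^sub>R A y + t *\<^sub>R B y + x) + f ((1 - t) *\<^sub>R A y + t *\<^sub>R B y - x)
           \<le> (1 - t) * (f (A y + x) + f (A y - x)) + t * (f (B y + x) + f (B y - x))"
          using c[of "A y + x" "B y + x"] c[of "A y - x" "B y - x"] conv x by (simp add: algebra_simps)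
        also have "\<dots> \<le> (1 - t) * (2 * f v + e/2) + t * (2 * f v + e/2)"
        proof (rule add_mono[OF mult_left_mono mult_left_mono])
          show "f (A y + x) + f (A y - x) \<le> 2 * f v + e/2" "f (B y + x) + f (B y - x) \<le> 2 * f v + e/2"
            using conv.IH(1)[OF conv.prems] conv.IH(2)[OF conv.prems] x by (simp_all add: P_def)
        qed (use conv.hyps in auto)
        also have "\<dots> = 2 * f v + e/2" by (simp add: field_simps)
        finally show "f ((1 - t) *\<^sub>R A y + t *\<^sub>R B y + x) + f ((1 - t) *\<^sub>R A y + t *\<^sub>R B y - x) \<le> 2 * f v + e/2" .
      qed
    qed auto
    have Pv: "P v" using fl by (fastforce simp: P_def)
    \<comment> \<open>Otherwise \<open>minimal\<close> with \<open>w = - v\<close> would give f v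
      \<le> f v - e/4. For such an \<open>A\<close> the value at - A v nearly cancels f v, and
      subadditivity around A v bounds f x + f (- x) by e/2 + 2 (e/4).\<close>
    have "\<exists>A\<in>avg. f (A (- v)) < - f v + e/4"
    proof (rule ccontr)
      assume "\<not> ?thesis"
      then have "f (- (- v)) \<le> - (- f v + e/4)" using v by (intro minimal) (auto simp: not_less)
      then show False using e by simp
    qed
    then obtain A where A: "A \<in> avg" "f (- A v) < - f v + e/4" using v avg_neg by fastforce
    have "f (A v + x) + f (A v - x) \<le> 2 * f v + e/2" using PA[OF A(1) v Pv] x by (simp add: P_def)
    moreover have "f x \<le> f (A v + x) + f (- A v)" "f (- x) \<le> f (A v - x) + f (- A v)"
      using sub_add[of "A v + x" "- A v"] sub_add[of "A v - x" "- A v"] A v x by simp_all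
    ultimately show ?thesis using A(2) by linarith
  qed
  have neg: "f (- x) = - f x" if x: "x \<in> V" for x
  proof -
    \<comment> \<open>Scales \<open>x\<close> into the unit ball, where \<open>flat\<close> applies;
      the 1 covers \<open>x = 0\<close>.\<close>
    define s where "s = inverse (N x + 1)"
    have Nx: "N x \<ge> 0" using x by simp
    then have s: "s > 0" "s * N x \<le> 1" by (simp_all add: s_def field_simps)
    have "f (s *\<^sub>R x) + f (- (s *\<^sub>R x)) \<le> 0"
      using flat[of "s *\<^sub>R x"] x s by (simp add: N_scale field_le_epsilon)
    then have "s * (f x + f (- x)) \<le> 0" using scale[of s x] scale[of s "- x"] s x by (simp add: algebra_simps)
    then have "f x + f (- x) \<le> 0" using s by (simp add: mult_le_0_iff)
    then show ?thesis using sub_add[of x "- x"] x f0 by simp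
  qed
  have "invfun f" unfolding invfun_def
  proof (intro conjI ballI allI)
    fix x y assume xy: "x \<in> V" "y \<in> V"
    show "f (x + y) = f x + f y"
      using sub_add[OF xy] sub_add[of "- x" "- y"] neg[of "x + y"] neg[of x] neg[of y] xy by simp
  next
    fix a x assume x: "x \<in> V"
    show "f (a *\<^sub>R x) = a * f x"
      using scale[of a x] scale[of "- a" x] neg[of "a *\<^sub>R x"] x f0 by (cases "a = 0"; cases "a > 0") auto
  next
    fix x assume x: "x \<in> V"
    show "\<bar>f x\<bar> \<le> N x" using leN[of x] leN[of "- x"] neg x by (simp add: N_minus)
  qed (simp add: H_eq)
  then show ?thesis using f_le by blast
qed

lemma inv_cone_Union:
  assumes "\<C> \<noteq> {}" "subset.chain {E. inv_cone E} \<C>"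
  shows "inv_cone (\<Union> \<C>)"
proof -
  have C: "inv_cone E" if "E \<in> \<C>" for E using assms(2) that by (auto simp: subset_chain_def)
  show ?thesis unfolding inv_cone_def
  proof (intro conjI allI impI ballI)
    fix v r w s assume "(v, r) \<in> \<Union> \<C>" "(w, s) \<in> \<Union> \<C>"
    then obtain E1 E2 where E: "E1 \<in> \<C>" "E2 \<in> \<C>" "(v, r) \<in> E1" "(w, s) \<in> E2" by blast
    then have "E1 \<subseteq> E2 \<or> E2 \<subseteq> E1" using assms(2) by (auto simp: subset_chain_def)
    then show "(v + w, r + s) \<in> \<Union> \<C>" using E C unfolding inv_cone_def by (meson Union_iff subsetD)
  qed (use C in \<open>unfold inv_cone_def, blast+\<close>)
qed

text \<open>An invariant norming functional. Zorn's lemma is started below a sublinear functional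
  whose value at \<open>- u\<close> is already \<open>- N u\<close>, and every functional below that
  one is nonzero at \<open>u\<close>.\<close>

lemma invariant_functional:
  assumes u: "u \<in> fixed" "u \<noteq> 0"
  obtains f where "invfun f" "f u \<noteq> 0"
proof -
  have uV: "u \<in> V" using u by (simp add: fixed_def)
  \<comment> \<open>In essence the epigraph of the infimum over s \<ge> 0 of N(v + s u) - s N(u). It
    is invariant because \<open>u\<close> is fixed, and proper because N(s u) = s N(u); s = 1 yields
    the point \<open>(- u, - N u)\<close>.\<close>
  define E0 where "E0 = {(v, r). v \<in> V \<and> (\<exists>s\<ge>0. N (v + s *\<^sub>R u) - s * N u \<le> r)}"
  have E0: "inv_cone E0" unfolding inv_cone_def
  proof (intro conjI allI impI ballI)
    fix v r w s assume "(v, r) \<in> E0" "(w, s) \<in> E0"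
    then obtain a b where a: "v \<in> V" "w \<in> V" "a \<ge> 0" "N (v + a *\<^sub>R u) - a * N u \<le> r" "b \<ge> 0" "N (w + b *\<^sub>R u) - b * N u \<le> s"
      by (auto simp: E0_def)
    then have "N (v + w + (a + b) *\<^sub>R u) - (a + b) * N u \<le> r + s"
      using N_add[of "v + a *\<^sub>R u" "w + b *\<^sub>R u"] uV by (simp add: algebra_simps)
    then show "(v + w, r + s) \<in> E0" unfolding E0_def using a by (auto intro!: exI[of _ "a + b"])
  next
    fix v r and t :: real assume t: "t > 0" and "(v, r) \<in> E0"
    then obtain a where a: "v \<in> V" "a \<ge> 0" "N (v + a *\<^sub>R u) - a * N u \<le> r" by (auto simp: E0_def)
    then have "t * (N (v + a *\<^sub>R u) - a * N u) \<le> t * r" using t by simp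
    moreover have "N (t *\<^sub>R v + (t * a) *\<^sub>R u) = t * N (v + a *\<^sub>R u)"
      using N_scale[of "v + a *\<^sub>R u" t] t a uV by (simp add: scaleR_add_right)
    ultimately have "N (t *\<^sub>R v + (t * a) *\<^sub>R u) - (t * a) * N u \<le> t * r" by (simp add: algebra_simps)
    then show "(t *\<^sub>R v, t * r) \<in> E0" unfolding E0_def using a t by (auto intro!: exI[of _ "t * a"])
  next
    fix h v r assume h: "h \<in> H" and "(v, r) \<in> E0"
    then obtain a where a: "v \<in> V" "a \<ge> 0" "N (v + a *\<^sub>R u) - a * N u \<le> r" by (auto simp: E0_def)
    note l = linearD[OF lin[OF h]]
    have "h u = u" using u h by (simp add: fixed_def)
    then have "h v + a *\<^sub>R u = h (v + a *\<^sub>R u)" using l a uV by simp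
    then have "N (h v + a *\<^sub>R u) = N (v + a *\<^sub>R u)" using iso h a uV by simp
    then show "(h v, r) \<in> E0" unfolding E0_def using a h by auto
  qed (auto simp: E0_def N_scale uV)
  have "\<exists>M\<in>{E. inv_cone E \<and> E0 \<subseteq> E}. \<forall>X\<in>{E. inv_cone E \<and> E0 \<subseteq> E}. M \<subseteq> X \<longrightarrow> X = M"
  proof (rule subset_Zorn_nonempty)
    show "{E. inv_cone E \<and> E0 \<subseteq> E} \<noteq> {}" using E0 by blast
    fix \<C> assume C: "\<C> \<noteq> {}" "subset.chain {E. inv_cone E \<and> E0 \<subseteq> E} \<C>"
    then have "inv_cone (\<Union> \<C>)" by (intro inv_cone_Union) (auto simp: subset_chain_def)
    moreover obtain E where "E \<in> \<C>" using C(1) by blast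
    moreover have "E0 \<subseteq> E" using C(2) \<open>E \<in> \<C>\<close> by (auto simp: subset_chain_def)
    ultimately show "\<Union> \<C> \<in> {E. inv_cone E \<and> E0 \<subseteq> E}" by blast
  qed
  then obtain E where E': "E \<in> {E. inv_cone E \<and> E0 \<subseteq> E}"
    and max': "\<forall>X\<in>{E. inv_cone E \<and> E0 \<subseteq> E}. E \<subseteq> X \<longrightarrow> X = E" by (rule bexE)
  have E: "inv_cone E" "E0 \<subseteq> E" using E' by simp_all
  have max: "X = E" if "inv_cone X" "E \<subseteq> X" for X
  proof -
    have "X \<in> {E. inv_cone E \<and> E0 \<subseteq> E}" using that E(2) by simp
    then show ?thesis using max' that(2) by simp
  qed
  have "(v, r) \<in> E0" if "v \<in> V" "N v \<le> r" for v r
    unfolding E0_def using that by (auto intro!: exI[of _ 0])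
  then obtain f where f: "invfun f" "\<And>v r. (v, r) \<in> E \<Longrightarrow> f v \<le> r"
    using inv_cone_maximal_linear[OF E(1) _ max] E(2) by blast
  have "(- u, - N u) \<in> E0" unfolding E0_def using uV by (auto intro!: exI[of _ 1])
  then have "f (- u) \<le> - N u" using f(2) E(2) by blast
  moreover have "N u > 0" using uV u N_eq_0[of u] by (simp add: less_le)
  moreover have "f (- u) = - f u" using invfunD(2)[OF f(1) uV, of "-1"] by simp
  ultimately have "f u \<noteq> 0" by simp
  then show ?thesis using that f(1) by blast
qed

end

section \<open>Fixed vectors and the invariant projection\<close>


lemma eventually_inverse_Suc_less:
  assumes "(\<tau>::real) > 0"
  obtains M where "\<And>n. n \<ge> M \<Longrightarrow> inverse (real (Suc n)) < \<tau>"
  using order_tendstoD(2)[OF LIMSEQ_inverse_real_of_nat assms] by (auto simp: eventually_sequentially)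

section \<open>Points of least norm and a substitute for weak compactness\<close>

context uc_banach
begin

definition norm_closed :: "'a set \<Rightarrow> bool" where
  "norm_closed C \<longleftrightarrow> C \<subseteq> V \<and>
     (\<forall>y l. (\<forall>n::nat. y n \<in> C) \<longrightarrow> l \<in> V \<longrightarrow> (\<lambda>n. N (y n - l)) \<longlonglongrightarrow> 0 \<longrightarrow> l \<in> C)"

lemma norm_closedD:
  "norm_closed C \<Longrightarrow> (\<And>n. y n \<in> C) \<Longrightarrow> l \<in> V \<Longrightarrow> (\<lambda>n. N (y n - l)) \<longlonglongrightarrow> 0 \<Longrightarrow> l \<in> C"
  by (auto simp: norm_closed_def)

lemma convex_midpoint:
  fixes C :: "'a set"
  assumes "convex C" "a \<in> C" "b \<in> C"
  shows "(1/2) *\<^sub>R (a + b) \<in> C"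
  using convexD[OF assms, of "1/2" "1/2"] by (simp add: scaleR_add_right)

text \<open>Midpoints do not fall below the infimum \<open>d\<close>, so uniform convexity brings
  the terms together. Stated for sequences to serve closed convex sets as well as averages of one
  vector.\<close>

lemma minimizing_Cauchy:
  assumes V: "\<And>n. y n \<in> V" and "d \<ge> 0"
    and y: "\<And>n. N (y n) < d + inverse (real (Suc n))"
    and mid: "\<And>m n. d \<le> N ((1/2) *\<^sub>R (y m + y n))"
  obtains l where "l \<in> V" "(\<lambda>n. N (y n - l)) \<longlonglongrightarrow> 0"
proof (rule Cauchy_limit[of y])
  show "y n \<in> V" for n by (rule V)
next
  fix e :: real assume "e > 0"
  then have "e/2 > 0" by simp
  then obtain \<tau> where \<tau>: "\<tau> > 0" "\<And>a b. \<lbrakk>a \<in> V; b \<in> V; N a \<le> d + \<tau>; N b \<le> d + \<tau>;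
     d - \<tau> \<le> N ((1/2) *\<^sub>R (a + b))\<rbrakk> \<Longrightarrow> N (a - b) \<le> e/2"
    using uc_near[OF \<open>d \<ge> 0\<close>] by blast
  obtain M where M: "\<And>n. n \<ge> M \<Longrightarrow> inverse (real (Suc n)) < \<tau>"
    using eventually_inverse_Suc_less \<tau>(1) by blast
  have "N (y m - y n) < e" if "m \<ge> M" "n \<ge> M" for m n
  proof -
    have "N (y m - y n) \<le> e/2"
      using y[of m] y[of n] mid[of m n] M[OF that(1)] M[OF that(2)] \<tau>(1) V by (intro \<tau>(2)) auto
    then show ?thesis using \<open>e > 0\<close> by simp
  qed
  then show "\<exists>M. \<forall>m\<ge>M. \<forall>n\<ge>M. N (y m - y n) < e" by blast
qed (use that in blast)

lemma norm_le_of_limit: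
  assumes "\<And>n. y n \<in> V" "l \<in> V" "(\<lambda>n. N (y n - l)) \<longlonglongrightarrow> 0" "\<And>n. N (y n) \<le> a n" "a \<longlonglongrightarrow> b"
  shows "N l \<le> b"
proof -
  have "N l \<le> a n + N (y n - l)" for n
    using N_rev_triangle[of l "y n"] N_diff_commute[of l "y n"] assms(1)[of n] assms(2) assms(4)[of n] by simp
  moreover have "(\<lambda>n. a n + N (y n - l)) \<longlonglongrightarrow> b" using tendsto_add[OF assms(5,3)] by simp
  ultimately show ?thesis by (meson LIMSEQ_le_const)
qed

lemma exists_min_norm:
  assumes C: "norm_closed C" "convex C" "C \<noteq> {}"
  obtains x where "x \<in> C" "\<And>y. y \<in> C \<Longrightarrow> N x \<le> N y"
proof -
  have CV: "C \<subseteq> V" using C(1) by (simp add: norm_closed_def)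
  define d where "d = Inf (N ` C)"
  have bdd: "bdd_below (N ` C)" using CV by (intro bdd_belowI[of _ 0]) auto
  have d: "d \<le> N y" if "y \<in> C" for y unfolding d_def using that bdd by (intro cInf_lower) auto
  have "d \<ge> 0" unfolding d_def using C(3) CV by (intro cInf_greatest) auto
  have "\<exists>y\<in>C. N y < d + inverse (real (Suc n))" for n
    using cInf_lessD[of "N ` C" "d + inverse (real (Suc n))"] C(3) by (auto simp: d_def)
  then obtain y where y: "\<And>n. y n \<in> C" "\<And>n. N (y n) < d + inverse (real (Suc n))" by metis
  obtain l where l: "l \<in> V" "(\<lambda>n. N (y n - l)) \<longlonglongrightarrow> 0"
    using minimizing_Cauchy[of y d] y CV \<open>d \<ge> 0\<close> d[OF convex_midpoint[OF C(2)]] by blast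
  have "l \<in> C" using norm_closedD[OF C(1) y(1) l] .
  moreover have "N l \<le> d + 0"
  proof (rule norm_le_of_limit[OF _ l])
    show "y n \<in> V" for n using y(1) CV by blast
    show "N (y n) \<le> d + inverse (real (Suc n))" for n using y(2) by (rule less_imp_le)
    show "(\<lambda>n. d + inverse (real (Suc n))) \<longlonglongrightarrow> d + 0"
      by (rule tendsto_add[OF tendsto_const LIMSEQ_inverse_real_of_nat])
  qed
  ultimately show ?thesis using that[of l] d by (metis add.right_neutral order_trans)
qed

text \<open>Takes the part of weak compactness of balls. Least norms grow as the sets shrink and are
  bounded by \<open>D\<close>; near their supremum, passing to a smaller set hardly moves the point
  of least norm.\<close>

lemma directed_Inter_nonempty:
  assumes ne: "\<C> \<noteq> {}"
    and C: "\<And>C. C \<in> \<C> \<Longrightarrow> norm_closed C" "\<And>C. C \<in> \<C> \<Longrightarrow> convex C"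
    and D: "\<And>C. C \<in> \<C> \<Longrightarrow> \<exists>x\<in>C. N x \<le> D"
    and dir: "\<And>C C'. C \<in> \<C> \<Longrightarrow> C' \<in> \<C> \<Longrightarrow> \<exists>C''\<in>\<C>. C'' \<subseteq> C \<inter> C'"
  obtains x where "\<And>C. C \<in> \<C> \<Longrightarrow> x \<in> C"
proof -
  have "\<exists>x. x \<in> C \<and> (\<forall>y\<in>C. N x \<le> N y)" if "C \<in> \<C>" for C
  proof -
    have "C \<noteq> {}" using D[OF that] by blast
    from exists_min_norm[OF C[OF that] this] show ?thesis by metis
  qed
  then obtain m where m: "\<And>C. C \<in> \<C> \<Longrightarrow> m C \<in> C" "\<And>C y. C \<in> \<C> \<Longrightarrow> y \<in> C \<Longrightarrow> N (m C) \<le> N y" by metis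
  have mV: "m C \<in> V" if "C \<in> \<C>" for C using m(1)[OF that] C(1)[OF that] by (auto simp: norm_closed_def)
  define s where "s = (SUP C\<in>\<C>. N (m C))"
  have "N (m C) \<le> D" if "C \<in> \<C>" for C using D[OF that] m(2)[OF that] by force
  then have bdd: "bdd_above ((\<lambda>C. N (m C)) ` \<C>)" by (intro bdd_aboveI[of _ D]) auto
  have s: "N (m C) \<le> s" if "C \<in> \<C>" for C unfolding s_def using that bdd by (intro cSUP_upper)
  have "s \<ge> 0" using ne s mV N_nonneg by (metis all_not_in_conv order_trans)
  \<comment> \<open>The midpoint of the two least-norm points lies in the larger set
    \<open>C\<close>, so its norm is at least that of \<open>m C\<close>, which is almost
    \<open>s\<close>.\<close>
  have near: "N (m C'' - m C) \<le> \<eta>"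
    if \<tau>: "\<And>a b. \<lbrakk>a \<in> V; b \<in> V; N a \<le> s + \<tau>; N b \<le> s + \<tau>; s - \<tau> \<le> N ((1/2) *\<^sub>R (a + b))\<rbrakk> \<Longrightarrow> N (a - b) \<le> \<eta>"
      and "\<tau> > 0" "C \<in> \<C>" "C'' \<in> \<C>" "C'' \<subseteq> C" "s - \<tau> < N (m C)" for C C'' \<eta> \<tau>
  proof (rule \<tau>)
    have "N (m C) \<le> N ((1/2) *\<^sub>R (m C'' + m C))"
      using m(1)[OF that(3)] m(1)[OF that(4)] that by (intro m(2) convex_midpoint C) auto
    then show "s - \<tau> \<le> N ((1/2) *\<^sub>R (m C'' + m C))" using that by simp
    show "N (m C'') \<le> s + \<tau>" "N (m C) \<le> s + \<tau>" using s that by (simp_all add: add_increasing2)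
  qed (use that mV in auto)
  have "\<exists>C\<in>\<C>. s - inverse (real (Suc k)) < N (m C)" for k
    using less_cSUP_iff[OF ne bdd, of "s - inverse (real (Suc k))"] by (simp add: s_def)
  then obtain Q where Q: "\<And>k. Q k \<in> \<C>" "\<And>k. s - inverse (real (Suc k)) < N (m (Q k))" by metis
  have close: "\<exists>K. \<forall>k\<ge>K. \<forall>C\<in>\<C>. C \<subseteq> Q k \<longrightarrow> N (m C - m (Q k)) \<le> \<eta>" if "\<eta> > 0" for \<eta>
  proof -
    obtain \<tau> where \<tau>: "\<tau> > 0" "\<And>a b. \<lbrakk>a \<in> V; b \<in> V; N a \<le> s + \<tau>; N b \<le> s + \<tau>;
       s - \<tau> \<le> N ((1/2) *\<^sub>R (a + b))\<rbrakk> \<Longrightarrow> N (a - b) \<le> \<eta>"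
      using uc_near[OF \<open>s \<ge> 0\<close> \<open>\<eta> > 0\<close>] by blast
    obtain K where K: "\<And>n. n \<ge> K \<Longrightarrow> inverse (real (Suc n)) < \<tau>"
      using eventually_inverse_Suc_less \<tau>(1) by blast
    have "N (m C - m (Q k)) \<le> \<eta>" if "k \<ge> K" "C \<in> \<C>" "C \<subseteq> Q k" for k C
      using Q(2)[of k] K[OF that(1)] by (intro near[OF \<tau>(2) \<tau>(1) Q(1) that(2,3)]) auto
    then show ?thesis by blast
  qed
  have "\<exists>K. \<forall>k\<ge>K. \<forall>j\<ge>K. N (m (Q k) - m (Q j)) < e" if "e > 0" for e
  proof -
    have "e/3 > 0" using that by simp
    from close[OF this] obtain K where K: "\<And>k C. k \<ge> K \<Longrightarrow> C \<in> \<C> \<Longrightarrow> C \<subseteq> Q k \<Longrightarrow> N (m C - m (Q k)) \<le> e/3" by blast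
    have "N (m (Q k) - m (Q j)) < e" if kj: "k \<ge> K" "j \<ge> K" for k j
    proof -
      obtain C where C: "C \<in> \<C>" "C \<subseteq> Q k \<inter> Q j" using dir Q(1) by blast
      have "N (m C - m (Q k)) \<le> e/3" "N (m C - m (Q j)) \<le> e/3" using K[OF kj(1) C(1)] K[OF kj(2) C(1)] C(2) by simp_all
      then show ?thesis
        using N_triangle[OF mV[OF Q(1)[of k]] mV[OF C(1)] mV[OF Q(1)[of j]]]
          N_diff_commute[OF mV[OF C(1)] mV[OF Q(1)[of k]]] \<open>e > 0\<close> by linarith
    qed
    then show ?thesis by blast
  qed
  then obtain l where l: "l \<in> V" "(\<lambda>k. N (m (Q k) - l)) \<longlonglongrightarrow> 0"
    using Cauchy_limit[of "\<lambda>k. m (Q k)"] mV Q(1) by blast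
  \<comment> \<open>\<open>l\<close> comes from the sequence \<open>Q\<close> alone. Refining each
    \<open>Q k\<close> by \<open>C\<close> gives least-norm points that lie in \<open>C\<close> and
    have the same limit.\<close>
  have "l \<in> C" if CC: "C \<in> \<C>" for C
  proof -
    have "\<exists>B\<in>\<C>. B \<subseteq> C \<inter> Q k" for k using dir[OF CC Q(1)] .
    then obtain B where B: "\<And>k. B k \<in> \<C>" "\<And>k. B k \<subseteq> C \<inter> Q k" by metis
    have "(\<lambda>k. N (m (B k) - m (Q k))) \<longlonglongrightarrow> 0"
    proof (rule LIMSEQ_I)
      fix r :: real assume "0 < r"
      then have "r/2 > 0" by simp
      from close[OF this] obtain K where K: "\<And>k C. k \<ge> K \<Longrightarrow> C \<in> \<C> \<Longrightarrow> C \<subseteq> Q k \<Longrightarrow> N (m C - m (Q k)) \<le> r/2" by blast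
      have "norm (N (m (B k) - m (Q k)) - 0) < r" if "k \<ge> K" for k
      proof -
        have "N (m (B k) - m (Q k)) \<le> r/2" using K[OF that B(1)[of k]] B(2)[of k] by simp
        then show ?thesis using mV[OF B(1)] mV[OF Q(1)] \<open>0 < r\<close> by simp
      qed
      then show "\<exists>no. \<forall>n\<ge>no. norm (N (m (B n) - m (Q n)) - 0) < r" by blast
    qed
    from tendsto_add[OF this l(2)] have lim: "(\<lambda>k. N (m (B k) - m (Q k)) + N (m (Q k) - l)) \<longlonglongrightarrow> 0" by simp
    have "(\<lambda>k. N (m (B k) - l)) \<longlonglongrightarrow> 0"
    proof (rule tendsto_sandwich[OF _ _ tendsto_const lim])
      show "\<forall>\<^sub>F k in sequentially. 0 \<le> N (m (B k) - l)" using mV B(1) l(1) by simp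
      show "\<forall>\<^sub>F k in sequentially. N (m (B k) - l) \<le> N (m (B k) - m (Q k)) + N (m (Q k) - l)"
        using mV B(1) Q(1) l(1) N_triangle by simp
    qed
    moreover have "m (B k) \<in> C" for k using m(1)[OF B(1)] B(2) by blast
    ultimately show ?thesis using norm_closedD[OF C(1)[OF CC], of "\<lambda>k. m (B k)" l] l(1) by simp
  qed
  then show ?thesis using that by blast
qed

end

section \<open>The invariant projection\<close>

context isometries
begin

lemma fixed_in [simp]: "u \<in> fixed \<Longrightarrow> u \<in> V"
  by (simp add: fixed_def)

lemma fixedD: "u \<in> fixed \<Longrightarrow> h \<in> H \<Longrightarrow> h u = u"
  unfolding fixed_def by blast

lemma fixedI: "u \<in> V \<Longrightarrow> (\<And>h. h \<in> H \<Longrightarrow> h u = u) \<Longrightarrow> u \<in> fixed"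
  unfolding fixed_def by blast

lemma fixed_linear:
  "u \<in> fixed \<Longrightarrow> w \<in> fixed \<Longrightarrow> u + w \<in> fixed" "u \<in> fixed \<Longrightarrow> a *\<^sub>R u \<in> fixed"
  "u \<in> fixed \<Longrightarrow> w \<in> fixed \<Longrightarrow> u - w \<in> fixed" "0 \<in> fixed"
proof -
  have *: "h (u + w) = u + w" "h (a *\<^sub>R u) = a *\<^sub>R u" "h (u - w) = u - w"
    if "h \<in> H" "u \<in> fixed" "w \<in> fixed" for h u w a
    using linearD(2,3)[OF lin[OF that(1)], of u] linear_more(3)[OF lin[OF that(1)] sub, of u w]
      fixedD[OF that(2,1)] fixedD[OF that(3,1)] that(2,3) by simp_all
  show "u \<in> fixed \<Longrightarrow> w \<in> fixed \<Longrightarrow> u + w \<in> fixed" "u \<in> fixed \<Longrightarrow> a *\<^sub>R u \<in> fixed"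
    "u \<in> fixed \<Longrightarrow> w \<in> fixed \<Longrightarrow> u - w \<in> fixed"
    by (rule fixedI; simp add: *)+
  show "0 \<in> fixed"
    using linear_more(1)[OF lin sub] by (intro fixedI) simp_all
qed

text \<open>If \<open>A v\<close> almost minimizes the norm among the averages of \<open>v\<close>,
  then so does its image under \<open>h\<close>, and uniform convexity makes the two close. The
  limit of a minimizing sequence is therefore fixed.\<close>

lemma fixed_point_in_hull:
  assumes v: "v \<in> V"
  shows "\<exists>u\<in>fixed. N u \<le> N v \<and> (\<forall>e>0. \<exists>A\<in>avg. N (A v - u) < e)"
proof -
  define d where "d = Inf ((\<lambda>A. N (A v)) ` avg)"
  have bdd: "bdd_below ((\<lambda>A. N (A v)) ` avg)" using v by (intro bdd_belowI[of _ 0]) auto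
  have ne: "(\<lambda>A. N (A v)) ` avg \<noteq> {}" using avg.id by blast
  have d: "d \<le> N (A v)" if "A \<in> avg" for A unfolding d_def using that bdd by (intro cInf_lower) auto
  have "d \<ge> 0" unfolding d_def using ne v by (intro cInf_greatest) auto
  have "\<exists>A\<in>avg. N (A v) < d + inverse (real (Suc n))" for n
    using cInf_lessD[OF ne, of "d + inverse (real (Suc n))"] by (auto simp: d_def)
  then obtain A where A: "\<And>n. A n \<in> avg" "\<And>n. N (A n v) < d + inverse (real (Suc n))" by metis
  have mid: "d \<le> N ((1/2) *\<^sub>R (B v + B' v))" if "B \<in> avg" "B' \<in> avg" for B B'
    using d[OF avg.conv[OF that, of "1/2"]] by (simp add: scaleR_add_right)
  obtain l where l: "l \<in> V" "(\<lambda>n. N (A n v - l)) \<longlonglongrightarrow> 0"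
    using minimizing_Cauchy[of "\<lambda>n. A n v" d] A v \<open>d \<ge> 0\<close> mid by auto
  have "h l = l" if h: "h \<in> H" for h
  proof (rule limit_unique)
    show "h (A n v) \<in> V" for n using h A v by simp
    note hl = linear_more[OF lin[OF h] sub]
    show "(\<lambda>n. N (h (A n v) - h l)) \<longlonglongrightarrow> 0"
      using l(2) iso[OF h] hl(3)[of "A _ v" l] A(1) v l(1) by (simp flip: hl(3))
    have "(\<lambda>n. N (h (A n v) - A n v)) \<longlonglongrightarrow> 0"
    proof (rule LIMSEQ_I)
      fix r :: real assume "0 < r"
      then have "r/2 > 0" by simp
      then obtain \<tau> where \<tau>: "\<tau> > 0" "\<And>a b. \<lbrakk>a \<in> V; b \<in> V; N a \<le> d + \<tau>; N b \<le> d + \<tau>;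
         d - \<tau> \<le> N ((1/2) *\<^sub>R (a + b))\<rbrakk> \<Longrightarrow> N (a - b) \<le> r/2"
        using uc_near[OF \<open>d \<ge> 0\<close>] by blast
      obtain M where M: "\<And>n. n \<ge> M \<Longrightarrow> inverse (real (Suc n)) < \<tau>"
        using eventually_inverse_Suc_less \<tau>(1) by blast
      have "norm (N (h (A n v) - A n v) - 0) < r" if "n \<ge> M" for n
      proof -
        have "N (A n v) \<le> d + \<tau>" using A(2)[of n] M[OF that] by simp
        moreover have "N (h (A n v)) = N (A n v)" using iso h A(1) v by simp
        moreover have "d \<le> N ((1/2) *\<^sub>R (h (A n v) + A n v))" using mid[OF avg.comp[OF avg.map[OF h] A(1)] A(1)] .
        ultimately have "N (h (A n v) - A n v) \<le> r/2"
          using A(1) v h \<tau>(1) by (intro \<tau>(2)) auto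
        then show ?thesis using \<open>0 < r\<close> A(1) v h by simp
      qed
      then show "\<exists>no. \<forall>n\<ge>no. norm (N (h (A n v) - A n v) - 0) < r" by blast
    qed
    from tendsto_add[OF this l(2)] have lim: "(\<lambda>n. N (h (A n v) - A n v) + N (A n v - l)) \<longlonglongrightarrow> 0" by simp
    show "(\<lambda>n. N (h (A n v) - l)) \<longlonglongrightarrow> 0"
    proof (rule tendsto_sandwich[OF _ _ tendsto_const lim])
      show "\<forall>\<^sub>F n in sequentially. 0 \<le> N (h (A n v) - l)" using h A v l(1) by simp
      show "\<forall>\<^sub>F n in sequentially. N (h (A n v) - l) \<le> N (h (A n v) - A n v) + N (A n v - l)"
        using h A v l(1) N_triangle by simp
    qed
  qed (use l h in auto)
  then have "l \<in> fixed" using l(1) by (intro fixedI)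
  moreover have "N l \<le> N v"
    using norm_le_of_limit[OF _ l, of "\<lambda>_. N v" "N v"] A(1) v avg_contract by simp
  moreover have "\<exists>A\<in>avg. N (A v - l) < e" if "e > 0" for e
  proof -
    have "\<forall>\<^sub>F n in sequentially. N (A n v - l) < e" using order_tendstoD(2)[OF l(2) that] .
    then show ?thesis using A(1) by (auto simp: eventually_sequentially)
  qed
  ultimately show ?thesis by blast
qed

text \<open>Characterized by invariant functionals instead of least norm, so that linearity and
  equivariance follow from uniqueness alone.\<close>

definition proj :: "'a \<Rightarrow> 'a" where
  "proj v = (THE u. u \<in> fixed \<and> (\<forall>f. invfun f \<longrightarrow> f v = f u))"

lemma fixed_eqI:
  assumes "u \<in> fixed" "w \<in> fixed" "\<And>f. invfun f \<Longrightarrow> f u = f w"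
  shows "u = w"
proof (rule ccontr)
  assume "u \<noteq> w"
  then obtain f where "invfun f" "f (u - w) \<noteq> 0"
    using invariant_functional[of "u - w"] fixed_linear(3) assms by auto
  then show False using invfun_diff[of f u w] assms by simp
qed

lemma proj_eqI:
  assumes "u \<in> fixed" "\<And>f. invfun f \<Longrightarrow> f v = f u"
  shows "proj v = u"
  unfolding proj_def
proof (rule the_equality)
  fix w assume w: "w \<in> fixed \<and> (\<forall>f. invfun f \<longrightarrow> f v = f w)"
  show "w = u"
  proof (rule fixed_eqI)
    fix f assume "invfun f"
    then have "f v = f w" "f v = f u" using w assms(2) by blast+
    then show "f w = f u" by metis
  qed (use w assms(1) in auto)
qed (use assms in blast)

text \<open>Averages do not change the values of invariant functionals, and these are bounded by
  \<open>N\<close>; so the fixed vector in the hull has the values of \<open>v\<close>.\<close>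

lemma proj_props:
  assumes v: "v \<in> V"
  shows proj_fixed: "proj v \<in> fixed" and invfun_proj: "invfun f \<Longrightarrow> f (proj v) = f v"
    and proj_contract: "N (proj v) \<le> N v" and proj_approx: "e > 0 \<Longrightarrow> \<exists>A\<in>avg. N (A v - proj v) < e"
proof -
  obtain u where u: "u \<in> fixed" "N u \<le> N v" "\<And>e. e > 0 \<Longrightarrow> \<exists>A\<in>avg. N (A v - u) < e"
    using fixed_point_in_hull[OF v] by blast
  have f: "f v = f u" if "invfun f" for f
  proof -
    have "\<bar>f v - f u\<bar> \<le> 0 + e" if "e > 0" for e
    proof -
      obtain A where A: "A \<in> avg" "N (A v - u) < e" using u(3) \<open>e > 0\<close> by blast
      have "f v - f u = f (A v - u)"
        using invfun_diff[OF \<open>invfun f\<close>, of "A v" u] invfun_avg[OF A(1) \<open>invfun f\<close> v] A v u by simp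
      then show ?thesis using invfunD(3)[OF \<open>invfun f\<close>, of "A v - u"] A v u by simp
    qed
    then have "\<bar>f v - f u\<bar> \<le> 0" by (rule field_le_epsilon)
    then show ?thesis by simp
  qed
  have "proj v = u" by (rule proj_eqI[OF u(1)]) (rule f)
  then show "proj v \<in> fixed" "N (proj v) \<le> N v" "e > 0 \<Longrightarrow> \<exists>A\<in>avg. N (A v - proj v) < e"
    using u by simp_all
  show "invfun f \<Longrightarrow> f (proj v) = f v" using f[of f] \<open>proj v = u\<close> by simp
qed

lemma proj_in [simp]: "v \<in> V \<Longrightarrow> proj v \<in> V"
  using proj_fixed by simp

lemma proj_of_fixed: "v \<in> fixed \<Longrightarrow> proj v = v"
  by (rule proj_eqI) auto

lemma proj_linear: "linear_between V V proj"
  unfolding linear_between_def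
proof (intro conjI ballI allI)
  fix x y assume "x \<in> V" "y \<in> V"
  then show "proj (x + y) = proj x + proj y"
    by (intro proj_eqI) (auto simp: fixed_linear proj_fixed invfunD invfun_proj)
next
  fix a x assume "x \<in> V"
  then show "proj (a *\<^sub>R x) = a *\<^sub>R proj x"
    by (intro proj_eqI) (auto simp: fixed_linear proj_fixed invfunD invfun_proj)
qed auto

lemma proj_avg: "A \<in> avg \<Longrightarrow> v \<in> V \<Longrightarrow> proj (A v) = proj v"
  by (rule proj_eqI) (auto simp: proj_fixed invfun_proj invfun_avg)

text \<open>For \<open>g\<close> normalizing \<open>H\<close>: by \<open>hg\<close> it maps fixed
  vectors to fixed vectors, and by \<open>gh\<close> the composite of an invariant functional with
  \<open>g\<close> is again invariant.\<close>

lemma proj_equivariant: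
  assumes g: "linear_between V V g" "\<And>v. v \<in> V \<Longrightarrow> N (g v) = N v"
    and hg: "\<And>h. h \<in> H \<Longrightarrow> \<exists>k\<in>H. \<forall>v\<in>V. h (g v) = g (k v)"
    and gh: "\<And>h. h \<in> H \<Longrightarrow> \<exists>k\<in>H. \<forall>v\<in>V. g (h v) = k (g v)"
    and v: "v \<in> V"
  shows "proj (g v) = g (proj v)"
proof (rule proj_eqI)
  note l = linearD[OF g(1)]
  show "g (proj v) \<in> fixed"
  proof (rule fixedI)
    show "g (proj v) \<in> V" using v l by simp
    fix h assume "h \<in> H"
    then obtain k where k: "k \<in> H" "h (g (proj v)) = g (k (proj v))" using hg proj_in[OF v] by blast
    then show "h (g (proj v)) = g (proj v)" using fixedD[OF proj_fixed[OF v] k(1)] by simp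
  qed
  fix f assume f: "invfun f"
  have "invfun (\<lambda>x. f (g x))"
    unfolding invfun_def
  proof (intro conjI ballI allI)
    fix h x assume "h \<in> H" "x \<in> V"
    then obtain k where "k \<in> H" "g (h x) = k (g x)" using gh by blast
    then show "f (g (h x)) = f (g x)" using invfunD(4)[OF f] l(1) \<open>x \<in> V\<close> by simp
  next
    fix x assume "x \<in> V"
    then show "\<bar>f (g x)\<bar> \<le> N x" using invfunD(3)[OF f, of "g x"] g(2) l(1) by simp
  qed (use invfunD[OF f] l in auto)
  then show "f (g v) = f (g (proj v))" using invfun_proj[OF v] by metis
qed

end

section \<open>Fixed points of affine isometric actions\<close>


locale affine_isometric = uc_banach V N for V :: "'b::real_vector set" and N +
  fixes \<G> :: "('g, 'm) monoid_scheme" (structure) and \<rho> :: "'g \<Rightarrow> 'b \<Rightarrow> 'b" and c :: "'g \<Rightarrow> 'b"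
  assumes group: "group \<G>"
    and \<rho>_lin: "g \<in> carrier \<G> \<Longrightarrow> linear_between V V (\<rho> g)"
    and \<rho>_iso: "g \<in> carrier \<G> \<Longrightarrow> v \<in> V \<Longrightarrow> N (\<rho> g v) = N v"
    and \<rho>_mult: "g \<in> carrier \<G> \<Longrightarrow> h \<in> carrier \<G> \<Longrightarrow> v \<in> V \<Longrightarrow> \<rho> (g \<otimes> h) v = \<rho> g (\<rho> h v)"
    and \<rho>_one: "v \<in> V \<Longrightarrow> \<rho> \<one> v = v"
    and c_in [simp]: "g \<in> carrier \<G> \<Longrightarrow> c g \<in> V"
    and c_mult: "g \<in> carrier \<G> \<Longrightarrow> h \<in> carrier \<G> \<Longrightarrow> c (g \<otimes> h) = \<rho> g (c h) + c g"
begin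

interpretation group \<G> by (rule group)

lemmas \<rho>_in [simp] = linearD(1)[OF \<rho>_lin]
  and \<rho>_add = linearD(2)[OF \<rho>_lin]
  and \<rho>_scale = linearD(3)[OF \<rho>_lin]
  and \<rho>_diff = linear_more(3)[OF \<rho>_lin sub]

definition aff :: "'g \<Rightarrow> 'b \<Rightarrow> 'b" where
  "aff g x = \<rho> g x + c g"

lemma aff_in [simp]: "g \<in> carrier \<G> \<Longrightarrow> x \<in> V \<Longrightarrow> aff g x \<in> V"
  by (simp add: aff_def)

lemma aff_mult:
  "g \<in> carrier \<G> \<Longrightarrow> h \<in> carrier \<G> \<Longrightarrow> x \<in> V \<Longrightarrow> aff (g \<otimes> h) x = aff g (aff h x)"
  by (simp add: aff_def \<rho>_mult c_mult \<rho>_add)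

lemma aff_diff: "g \<in> carrier \<G> \<Longrightarrow> x \<in> V \<Longrightarrow> y \<in> V \<Longrightarrow> aff g x - aff g y = \<rho> g (x - y)"
  by (simp add: aff_def \<rho>_diff)

lemma aff_conv:
  assumes "g \<in> carrier \<G>" "x \<in> V" "y \<in> V"
  shows "aff g ((1 - t) *\<^sub>R x + t *\<^sub>R y) = (1 - t) *\<^sub>R aff g x + t *\<^sub>R aff g y"
proof -
  have "(1 - t) *\<^sub>R c g + t *\<^sub>R c g = c g" by (simp flip: scaleR_left_distrib)
  moreover have "\<rho> g ((1 - t) *\<^sub>R x + t *\<^sub>R y) = (1 - t) *\<^sub>R \<rho> g x + t *\<^sub>R \<rho> g y"
    using assms by (simp add: \<rho>_add \<rho>_scale)
  moreover have "(1 - t) *\<^sub>R aff g x + t *\<^sub>R aff g y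
      = ((1 - t) *\<^sub>R \<rho> g x + t *\<^sub>R \<rho> g y) + ((1 - t) *\<^sub>R c g + t *\<^sub>R c g)"
    by (simp add: aff_def scaleR_add_right)
  ultimately show ?thesis by (simp add: aff_def)
qed

lemma aff_one: "x \<in> V \<Longrightarrow> aff \<one> x = x"
proof -
  have "c \<one> = 0" using c_mult[of "\<one>" "\<one>"] by (simp add: \<rho>_one)
  then show "x \<in> V \<Longrightarrow> aff \<one> x = x" by (simp add: aff_def \<rho>_one)
qed

text \<open>This is how averaging over a commuting subgroup acts on displacements: moving the base
  point by \<open>h\<close> applies the isometry \<open>\<rho> h\<close> to the displacement by
  \<open>l\<close>.\<close>

lemma aff_commute:
  assumes "l \<in> carrier \<G>" "h \<in> carrier \<G>" "l \<otimes> h = h \<otimes> l" "x \<in> V"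
  shows "aff l (aff h x) - aff h x = \<rho> h (aff l x - x)"
  using aff_mult[of l h x] aff_mult[of h l x] assms aff_diff[of h "aff l x" x] by simp

lemma isometries_subgroup:
  assumes "subgroup K \<G>"
  shows "isometries V N (\<rho> ` K)"
proof
  note K = subgroup.mem_carrier[OF assms]
  fix h assume "h \<in> \<rho> ` K"
  then obtain k where k: "k \<in> K" "h = \<rho> k" by blast
  show "linear_between V V h" using k K \<rho>_lin by simp
  show "v \<in> V \<Longrightarrow> N (h v) = N v" for v using k K \<rho>_iso by simp
  have "\<rho> (inv k) (h v) = v" "h (\<rho> (inv k) v) = v" if "v \<in> V" for v
    using \<rho>_mult[of k "inv k" v] \<rho>_mult[of "inv k" k v] K[OF k(1)] k(2) that
    by (simp_all add: \<rho>_one)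
  then show "\<exists>h'\<in>\<rho> ` K. \<forall>v\<in>V. h' (h v) = v \<and> h (h' v) = v"
    using subgroup.m_inv_closed[OF assms k(1)] by blast
qed

section \<open>Sets of points with bounded displacement\<close>

lemma aff_displacement_Lipschitz:
  assumes "l \<in> carrier \<G>" "y \<in> V" "z \<in> V"
  shows "N (aff l y - y) \<le> N (aff l z - z) + 2 * N (z - y)"
proof -
  have "aff l y - y = (aff l z - z) + ((z - y) - (aff l z - aff l y))"
    by simp
  also have "\<dots> = (aff l z - z) + ((z - y) - \<rho> l (z - y))"
    using aff_diff[of l z y] assms by simp
  finally have eq: "aff l y - y = (aff l z - z) + ((z - y) - \<rho> l (z - y))" .
  have "N ((aff l z - z) + ((z - y) - \<rho> l (z - y))) \<le> N (aff l z - z) + N ((z - y) - \<rho> l (z - y))"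
    using assms by (intro N_add) auto
  moreover have "N ((z - y) - \<rho> l (z - y)) \<le> N (z - y) + N (z - y)"
    using N_diff[of "z - y" "\<rho> l (z - y)"] assms \<rho>_iso[of l "z - y"] by simp
  ultimately show ?thesis unfolding eq by linarith
qed

text \<open>Each group element carries its own radius: a common bound for many elements is combined
  with a small one for finitely many, and radius 0 describes fixed points.\<close>

definition displaced :: "'b set \<Rightarrow> ('g \<times> real) set \<Rightarrow> 'b set" where
  "displaced Z F = {y \<in> Z. \<forall>(l, r)\<in>F. N (aff l y - y) \<le> r}"

lemma displaced_closed:
  assumes F: "fst ` F \<subseteq> carrier \<G>" and Z: "norm_closed Z"
  shows "norm_closed (displaced Z F)"
  unfolding norm_closed_def
proof (intro conjI allI impI)
  have ZV: "Z \<subseteq> V" using Z by (simp add: norm_closed_def)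
  then show "displaced Z F \<subseteq> V" by (auto simp: displaced_def)
  fix y :: "nat \<Rightarrow> 'b" and z assume y: "\<forall>n. y n \<in> displaced Z F" and z: "z \<in> V"
    and lim: "(\<lambda>n. N (y n - z)) \<longlonglongrightarrow> 0"
  have yZ: "y n \<in> Z" and yF: "(l, r) \<in> F \<Longrightarrow> N (aff l (y n) - y n) \<le> r" for n l r
    using y by (auto simp: displaced_def)
  have "N (aff l z - z) \<le> r" if lr: "(l, r) \<in> F" for l r
  proof -
    have l: "l \<in> carrier \<G>" using F lr by force
    have "N (aff l z - z) \<le> r + 2 * N (y n - z)" for n
      using aff_displacement_Lipschitz[OF l z, of "y n"] yF[OF lr, of n] yZ[of n] ZV by auto
    moreover have "(\<lambda>n. r + 2 * N (y n - z)) \<longlonglongrightarrow> r + 2 * 0"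
      by (intro tendsto_intros lim)
    ultimately show ?thesis using LIMSEQ_le_const by fastforce
  qed
  then show "z \<in> displaced Z F" using norm_closedD[OF Z yZ z lim] by (auto simp: displaced_def)
qed

lemma displaced_convex:
  assumes F: "fst ` F \<subseteq> carrier \<G>" and Z: "convex Z" "Z \<subseteq> V"
  shows "convex (displaced Z F)"
  unfolding convex_alt
proof (intro ballI allI impI)
  fix x y and u :: real
  assume x: "x \<in> displaced Z F" and y: "y \<in> displaced Z F" and u: "0 \<le> u \<and> u \<le> 1"
  let ?z = "(1 - u) *\<^sub>R x + u *\<^sub>R y"
  have xy: "x \<in> Z" "y \<in> Z" "x \<in> V" "y \<in> V" using x y Z by (auto simp: displaced_def)
  have "N (aff l ?z - ?z) \<le> r" if lr: "(l, r) \<in> F" for l r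
  proof -
    have l: "l \<in> carrier \<G>" using F lr by force
    have e: "aff l ?z - ?z = (1 - u) *\<^sub>R (aff l x - x) + u *\<^sub>R (aff l y - y)"
      unfolding aff_conv[OF l xy(3,4)] by (simp add: algebra_simps)
    have "N (aff l ?z - ?z) \<le> (1 - u) * N (aff l x - x) + u * N (aff l y - y)"
      unfolding e using xy l u by (intro N_convex) auto
    also have "\<dots> \<le> (1 - u) * r + u * r"
      using x y u lr by (intro add_mono mult_left_mono) (auto simp: displaced_def)
    finally show ?thesis by (simp add: algebra_simps)
  qed
  moreover have "?z \<in> Z" using Z(1) u xy by (simp add: convex_alt)
  ultimately show "?z \<in> displaced Z F" by (auto simp: displaced_def)
qed

text \<open>
  Averaging over \<open>H\<close> makes the displacement by any finite part of \<open>L\<close> small. The points so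
  obtained stay bounded: far out, the point of least norm in an \<open>H\<close>-invariant convex set would be
  almost \<open>H\<close>-invariant by uniform convexity, and it is moved by a bounded amount under \<open>L\<close>.
\<close>

lemma fixed_point_step:
  assumes H: "subgroup H \<G>" and L: "L \<subseteq> carrier \<G>"
    and comm: "\<And>l h. l \<in> L \<Longrightarrow> h \<in> H \<Longrightarrow> l \<otimes> h = h \<otimes> l"
    and Z: "norm_closed Z" "convex Z" "Z \<noteq> {}" "\<And>g x. g \<in> carrier \<G> \<Longrightarrow> x \<in> Z \<Longrightarrow> aff g x \<in> Z"
    and kill: "\<And>l x. l \<in> L \<Longrightarrow> x \<in> Z \<Longrightarrow> isometries.proj V N (\<rho> ` H) (aff l x - x) = 0"
    and gap: "e > 0" "\<And>v. v \<in> V \<Longrightarrow> \<exists>k\<in>K. e * N v \<le> N (\<rho> k v - v)"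
    and K: "\<And>k. k \<in> K \<Longrightarrow> \<exists>l\<in>L. \<exists>h\<in>H. k = l \<otimes> h \<and> N (c l) \<le> M \<and> N (c h) \<le> M"
  shows "\<exists>x\<in>Z. \<forall>l\<in>L. aff l x = x"
proof -
  interpret I: isometries V N "\<rho> ` H" by (rule isometries_subgroup[OF H])
  have Hc [simp]: "h \<in> carrier \<G>" if "h \<in> H" for h using subgroup.mem_carrier[OF H that] .
  have Lc [simp]: "l \<in> carrier \<G>" if "l \<in> L" for l using L that by blast
  have ZV [simp]: "x \<in> V" if "x \<in> Z" for x using Z(1) that by (auto simp: norm_closed_def)
  \<comment> \<open>An average of the displacement vectors at \<open>x\<close> is again the system
    of displacements at an actual point of \<open>Z\<close>, the same point for all
    \<open>l\<close>. Composition moves the point twice; convex combinations use convexity of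
    \<open>Z\<close>.\<close>
  have average: "\<exists>y\<in>Z. \<forall>l\<in>L. aff l y - y = A (aff l x - x)" if "A \<in> I.avg" "x \<in> Z" for A x
    using that
  proof (induction arbitrary: x rule: I.avg.induct)
    case id
    then show ?case by blast
  next
    case (map h)
    then obtain g where g: "g \<in> H" "h = \<rho> g" by blast
    have "aff l (aff g x) - aff g x = h (aff l x - x)" if "l \<in> L" for l
      unfolding g(2) using that g map.prems by (intro aff_commute comm) simp_all
    then show ?case using Z(4)[of g x] g(1) map.prems by auto
  next
    case (comp A B)
    from comp.IH(2)[OF comp.prems] obtain y where y: "y \<in> Z" "\<forall>l\<in>L. aff l y - y = B (aff l x - x)" by blast
    from comp.IH(1)[OF y(1)] obtain z where z: "z \<in> Z" "\<forall>l\<in>L. aff l z - z = A (aff l y - y)" by blast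
    show ?case using y z by (intro bexI[of _ z]) auto
  next
    case (conv A B t)
    from conv.IH(1)[OF conv.prems] obtain y where y: "y \<in> Z" "\<forall>l\<in>L. aff l y - y = A (aff l x - x)" by blast
    from conv.IH(2)[OF conv.prems] obtain z where z: "z \<in> Z" "\<forall>l\<in>L. aff l z - z = B (aff l x - x)" by blast
    let ?w = "(1 - t) *\<^sub>R y + t *\<^sub>R z"
    have "?w \<in> Z" using Z(2) conv.hyps y(1) z(1) by (simp add: convex_alt)
    moreover have "aff l ?w - ?w = (1 - t) *\<^sub>R (aff l y - y) + t *\<^sub>R (aff l z - z)" if "l \<in> L" for l
      unfolding aff_conv[OF Lc[OF that] ZV[OF y(1)] ZV[OF z(1)]] by (simp add: algebra_simps)
    ultimately show ?case using y(2) z(2) by (intro bexI[of _ ?w]) auto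
  qed
  obtain x0 where x0: "x0 \<in> Z" using Z(3) by blast
  \<comment> \<open>The displacement by a new element is killed by the projection, hence made small
    by a further average; contractivity preserves the bounds already reached.\<close>
  have simultaneous: "\<exists>A\<in>I.avg. \<forall>l\<in>F. N (A (aff l x0 - x0)) \<le> \<delta>" if "finite F" "F \<subseteq> L" "\<delta> > 0" for F \<delta>
    using that
  proof (induction F)
    case empty
    then show ?case using I.avg.id by blast
  next
    case (insert l F)
    then obtain A where A: "A \<in> I.avg" "\<forall>l\<in>F. N (A (aff l x0 - x0)) \<le> \<delta>" by auto
    let ?w = "aff l x0 - x0"
    have w: "?w \<in> V" using insert.prems x0 by simp
    have "I.proj (A ?w) = 0" using I.proj_avg[OF A(1) w] kill[of l x0] insert.prems x0 by simp
    then obtain B where B: "B \<in> I.avg" "N (B (A ?w)) < \<delta>"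
      using I.proj_approx[of "A ?w" \<delta>] A(1) w insert.prems by auto
    have "N (B (A (aff k x0 - x0))) \<le> \<delta>" if "k \<in> insert l F" for k
    proof (cases "k = l")
      case False
      then have k: "k \<in> F" "k \<in> L" using that insert.prems by auto
      then have "N (B (A (aff k x0 - x0))) \<le> N (A (aff k x0 - x0))"
        using I.avg_contract[OF B(1)] I.avg_in[OF A(1)] x0 by simp
      also have "\<dots> \<le> \<delta>" using A(2) k by blast
      finally show ?thesis .
    qed (use B in simp)
    then show ?case by (intro bexI[OF _ I.avg.comp[OF B(1) A(1)]] ballI)
  qed
  define D where "D = 2 * N x0 + M"
  \<comment> \<open>\<open>D\<close> bounds the displacement of \<open>x0\<close> by every
    \<open>l\<close> with \<open>N (c l) \<le> M\<close>, and averaging does not increase it.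
    Imposing it on all these \<open>l\<close>, and not on \<open>F\<close> alone, controls the
    \<open>L\<close>-components of the elements of \<open>K\<close>.\<close>
  define C where "C F \<delta> = displaced Z ({l \<in> L. N (c l) \<le> M} \<times> {D} \<union> F \<times> {\<delta>})" for F \<delta>
  have C_iff: "y \<in> C F \<delta> \<longleftrightarrow> y \<in> Z \<and> (\<forall>l\<in>L. N (c l) \<le> M \<longrightarrow> N (aff l y - y) \<le> D) \<and>
      (\<forall>l\<in>F. N (aff l y - y) \<le> \<delta>)" for y F \<delta>
    by (auto simp: C_def displaced_def)
  have C_sub: "C F \<delta> \<subseteq> Z" for F \<delta> by (auto simp: C_iff)
  have C_closed: "norm_closed (C F \<delta>)" and C_convex: "convex (C F \<delta>)" if "F \<subseteq> L" for F \<delta>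
  proof -
    have F: "fst ` ({l \<in> L. N (c l) \<le> M} \<times> {D} \<union> F \<times> {\<delta>}) \<subseteq> carrier \<G>" using that L by auto
    have "Z \<subseteq> V" using ZV by blast
    then show "norm_closed (C F \<delta>)" "convex (C F \<delta>)"
      unfolding C_def using displaced_closed[OF F Z(1)] displaced_convex[OF F Z(2)] by simp_all
  qed
  have C_ne: "C F \<delta> \<noteq> {}" if F: "finite F" "F \<subseteq> L" "\<delta> > 0" for F \<delta>
  proof -
    obtain A where A: "A \<in> I.avg" "\<forall>l\<in>F. N (A (aff l x0 - x0)) \<le> \<delta>" using simultaneous[OF F] by blast
    obtain y where y: "y \<in> Z" "\<forall>l\<in>L. aff l y - y = A (aff l x0 - x0)" using average[OF A(1) x0] by blast
    have "N (aff l y - y) \<le> D" if l: "l \<in> L" "N (c l) \<le> M" for l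
    proof -
      have "N (aff l y - y) \<le> N (aff l x0 - x0)" using y(2) l I.avg_contract[OF A(1), of "aff l x0 - x0"] x0 by simp
      also have "aff l x0 - x0 = (\<rho> l x0 - x0) + c l" by (simp add: aff_def)
      also have "N \<dots> \<le> N (\<rho> l x0 - x0) + N (c l)" using l x0 by (intro N_add) auto
      also have "\<dots> \<le> 2 * N x0 + M" using N_diff[of "\<rho> l x0" x0] l x0 by (simp add: \<rho>_iso)
      finally show ?thesis by (simp add: D_def)
    qed
    then have "y \<in> C F \<delta>" using y A(2) F(2) by (auto simp: C_iff)
    then show ?thesis by blast
  qed
  have C_inv: "aff h y \<in> C F \<delta>" if "h \<in> H" "y \<in> C F \<delta>" "F \<subseteq> L" for h y F \<delta>
  proof -
    have yZ: "y \<in> Z" using that C_sub by blast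
    have "N (aff l (aff h y) - aff h y) = N (aff l y - y)" if l: "l \<in> L" for l
      using aff_commute[OF Lc[OF l] Hc[OF \<open>h \<in> H\<close>] comm[OF l \<open>h \<in> H\<close>] ZV[OF yZ]] l \<open>h \<in> H\<close> yZ
      by (simp add: \<rho>_iso)
    then show ?thesis using that Z(4)[of h y] yZ by (auto simp: C_iff)
  qed
  have "e/2 > 0" using gap(1) by simp
  then obtain \<tau> where \<tau>: "\<tau> > 0" "\<And>d a b. \<lbrakk>d > 0; a \<in> V; b \<in> V; N a \<le> d * (1 + \<tau>); N b \<le> d * (1 + \<tau>);
     d * (1 - \<tau>) \<le> N ((1/2) *\<^sub>R (a + b))\<rbrakk> \<Longrightarrow> N (a - b) \<le> e/2 * d"
    using uc_scaled[of "e/2"] by blast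
  \<comment> \<open>Beyond this norm, a translation by at most \<open>M\<close> changes the norm by
    a factor of at most 1 + \<tau>, and \<open>D + 2 * M\<close> is less than half of the gap
    \<open>e * N y\<close>. The 1 makes \<open>N y\<close> positive.\<close>
  define B where "B = \<bar>M\<bar> / \<tau> + 2 * \<bar>D + 2 * M\<bar> / e + 1"
  have bounded: "\<exists>y\<in>C F \<delta>. N y \<le> B" if F: "finite F" "F \<subseteq> L" "\<delta> > 0" for F \<delta>
  proof -
    obtain y where y: "y \<in> C F \<delta>" "\<And>z. z \<in> C F \<delta> \<Longrightarrow> N y \<le> N z"
      using exists_min_norm[OF C_closed[OF F(2)] C_convex[OF F(2)] C_ne[OF F]] by metis
    have yV: "y \<in> V" using y C_sub ZV by blast
    have "N y \<le> B"
    proof (rule ccontr)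
      assume "\<not> N y \<le> B"
      then have big: "\<bar>M\<bar> / \<tau> < N y" "2 * \<bar>D + 2 * M\<bar> / e < N y" "N y > 0"
        using \<tau>(1) gap(1) unfolding B_def by (smt (verit) divide_nonneg_pos)+
      obtain k where k: "k \<in> K" "e * N y \<le> N (\<rho> k y - y)" using gap(2)[OF yV] by blast
      obtain l h where lh: "l \<in> L" "h \<in> H" "k = l \<otimes> h" "N (c l) \<le> M" "N (c h) \<le> M"
        using K[OF k(1)] by blast
      have hy: "aff h y \<in> C F \<delta>" "aff h y \<in> V" using C_inv[OF lh(2) y(1) F(2)] lh(2) yV by auto
      \<comment> \<open>For k = l h, the linear displacement of \<open>y\<close> splits into a
        displacement by \<open>l\<close> at \<open>aff h y\<close>, bounded by \<open>D\<close>, the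
        displacement of \<open>y\<close> by \<open>h\<close>, small relative to \<open>N y\<close>
        since \<open>y\<close> has least norm, and the cocycle.\<close>
      have eq: "\<rho> k y - y = (aff l (aff h y) - aff h y) + ((aff h y - y) - c k)"
      proof -
        have "\<rho> k y = aff l (aff h y) - c k"
          using aff_mult[of l h y, symmetric] lh yV by (simp add: aff_def[of "l \<otimes> h"])
        then show ?thesis by simp
      qed
      have "N (aff h y - y) \<le> e/2 * N y"
      proof (rule \<tau>(2))
        have "N (aff h y) \<le> N y + M"
          using N_add[of "\<rho> h y" "c h"] lh yV by (simp add: aff_def \<rho>_iso)
        also have "M \<le> N y * \<tau>" using big(1) \<tau>(1) by (simp add: divide_less_eq)
        finally show "N (aff h y) \<le> N y * (1 + \<tau>)" by (simp add: algebra_simps)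
        show "N y \<le> N y * (1 + \<tau>)" using \<tau>(1) big(3) by (simp add: algebra_simps)
        have "N y * (1 - \<tau>) \<le> N y" using \<tau>(1) big(3) by (simp add: algebra_simps)
        also have "\<dots> \<le> N ((1/2) *\<^sub>R (aff h y + y))"
          by (intro y(2) convex_midpoint[OF C_convex[OF F(2)] hy(1) y(1)])
        finally show "N y * (1 - \<tau>) \<le> N ((1/2) *\<^sub>R (aff h y + y))" .
      qed (use big yV hy in auto)
      moreover have "N (aff l (aff h y) - aff h y) \<le> D" using hy(1) lh by (simp add: C_iff)
      moreover have "N (c k) \<le> 2 * M"
        using N_add[of "\<rho> l (c h)" "c l"] lh by (simp add: c_mult \<rho>_iso)
      moreover have "N ((aff l (aff h y) - aff h y) + ((aff h y - y) - c k))
         \<le> N (aff l (aff h y) - aff h y) + (N (aff h y - y) + N (c k))"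
      proof -
        have "c k \<in> V" using lh by simp
        then show ?thesis
          using N_add[of "aff l (aff h y) - aff h y" "(aff h y - y) - c k"] N_diff[of "aff h y - y" "c k"] lh hy yV
          by fastforce
      qed
      ultimately have "e * N y \<le> D + e/2 * N y + 2 * M"
        using k(2) unfolding eq by linarith
      moreover have "\<bar>D + 2 * M\<bar> < e/2 * N y" using big(2) gap(1) by (simp add: divide_less_eq mult.commute)
      moreover have "D + 2 * M \<le> \<bar>D + 2 * M\<bar>" by simp
      ultimately show False by linarith
    qed
    then show ?thesis using y(1) by blast
  qed
  \<comment> \<open>Finite sets \<open>F\<close> and bounds \<open>\<delta>\<close> form a directed
    family meeting one common ball; a common point is moved by no element of
    \<open>L\<close>.\<close>
  define \<C> where "\<C> = {C F \<delta> |F \<delta>. finite F \<and> F \<subseteq> L \<and> \<delta> > 0}"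
  have \<C>I: "C F \<delta> \<in> \<C>" if "finite F" "F \<subseteq> L" "\<delta> > 0" for F \<delta> using that by (auto simp: \<C>_def)
  obtain x where x: "\<And>S. S \<in> \<C> \<Longrightarrow> x \<in> S"
  proof (rule directed_Inter_nonempty[of \<C> B])
    show "\<C> \<noteq> {}" using \<C>I[of "{}" 1] by auto
    show "\<And>S. S \<in> \<C> \<Longrightarrow> norm_closed S" "\<And>S. S \<in> \<C> \<Longrightarrow> convex S" "\<And>S. S \<in> \<C> \<Longrightarrow> \<exists>x\<in>S. N x \<le> B"
      using C_closed C_convex bounded by (auto simp: \<C>_def)
    fix S S' assume "S \<in> \<C>" "S' \<in> \<C>"
    then obtain F \<delta> F' \<delta>' where *: "S = C F \<delta>" "S' = C F' \<delta>'" "finite F" "F \<subseteq> L" "\<delta> > 0" "finite F'" "F' \<subseteq> L" "\<delta>' > 0"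
      by (auto simp: \<C>_def)
    have "C (F \<union> F') (min \<delta> \<delta>') \<in> \<C>" using * by (intro \<C>I) auto
    moreover have "C (F \<union> F') (min \<delta> \<delta>') \<subseteq> S \<inter> S'" unfolding *(1,2) by (auto simp: C_iff)
    ultimately show "\<exists>S''\<in>\<C>. S'' \<subseteq> S \<inter> S'" by blast
  qed blast
  have "aff l x = x" if l: "l \<in> L" for l
  proof -
    have "N (aff l x - x) \<le> 0 + \<delta>" if "\<delta> > 0" for \<delta>
      using x[OF \<C>I[of "{l}" \<delta>]] that l by (simp add: C_iff)
    then have "N (aff l x - x) \<le> 0" by (rule field_le_epsilon)
    moreover have xV: "x \<in> V" using x[OF \<C>I[of "{}" 1]] C_sub[of "{}" 1] ZV by auto
    ultimately have "N (aff l x - x) = 0" using l N_nonneg[of "aff l x - x"] by (simp add: order_class.order_eq_iff)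
    then show ?thesis using N_eq_0[of "aff l x - x"] l xV by simp
  qed
  moreover have "x \<in> Z" using x[OF \<C>I[of "{}" 1]] C_sub[of "{}" 1] by auto
  ultimately show ?thesis by blast
qed

end

section \<open>Actions of products\<close>


lemma linear_between_sum:
  assumes "linear_between V W f" "subspace V" "\<And>i. i \<in> I \<Longrightarrow> x i \<in> V"
  shows "f (\<Sum>i\<in>I. x i) = (\<Sum>i\<in>I. f (x i))"
  using assms(3)
proof (induction I rule: infinite_finite_induct)
  case (insert i I)
  then have "(\<Sum>i\<in>I. x i) \<in> V" using assms(2) by (intro subspace_sum) auto
  then show ?case using insert linearD(2)[OF assms(1)] by simp
qed (use linear_more(1)[OF assms(1,2)] in auto)

section \<open>Fixed-point sets of normal subgroups\<close>

context affine_isometric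
begin

interpretation group \<G> by (rule group)

text \<open>Radius 0 makes fixed-point sets instances of \<open>displaced\<close>, hence closed and
  convex.\<close>

lemma fixed_set_eq_displaced:
  assumes "L \<subseteq> carrier \<G>" "Z \<subseteq> V"
  shows "{x \<in> Z. \<forall>l\<in>L. aff l x = x} = displaced Z (L \<times> {0})"
proof -
  have "N (aff l x - x) \<le> 0 \<longleftrightarrow> aff l x = x" if "l \<in> L" "x \<in> Z" for l x
  proof -
    have "aff l x - x \<in> V" using that assms by (intro in_V aff_in) auto
    then have "N (aff l x - x) = 0 \<longleftrightarrow> aff l x = x" and "0 \<le> N (aff l x - x)" by (simp_all add: N_eq_0)
    then show ?thesis by (metis antisym order_refl)
  qed
  then show ?thesis by (auto simp: displaced_def)
qed

text \<open>Conjugation by \<open>g\<close> permutes the normal subgroup \<open>L\<close>. The whole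
  group thus keeps acting on the fixed-point set, so that the factors can be treated one after the
  other.\<close>

lemma fixed_set_invariant:
  assumes L: "L \<lhd> \<G>" and Z: "Z \<subseteq> V" "\<And>g x. g \<in> carrier \<G> \<Longrightarrow> x \<in> Z \<Longrightarrow> aff g x \<in> Z"
    and g: "g \<in> carrier \<G>" and x: "x \<in> {x \<in> Z. \<forall>l\<in>L. aff l x = x}"
  shows "aff g x \<in> {x \<in> Z. \<forall>l\<in>L. aff l x = x}"
proof -
  have xV: "x \<in> V" using x Z(1) by blast
  have "aff l (aff g x) = aff g x" if l: "l \<in> L" for l
  proof -
    have lc: "l \<in> carrier \<G>" using subgroup.mem_carrier[OF normal_imp_subgroup[OF L] l] .
    let ?k = "inv g \<otimes> l \<otimes> g"
    have k: "?k \<in> L" using normal.inv_op_closed1[OF L g l] .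
    have kc: "?k \<in> carrier \<G>" using g lc by simp
    have "l \<otimes> g = g \<otimes> ?k"
      using g lc by (simp add: m_assoc[symmetric])
    then have "aff l (aff g x) = aff g (aff ?k x)"
      using aff_mult[OF lc g xV] aff_mult[OF g kc xV] by simp
    also have "aff ?k x = x" using x k by blast
    finally show ?thesis .
  qed
  moreover have "aff g x \<in> Z" using x by (intro Z(2)[OF g]) simp
  ultimately show ?thesis by simp
qed

lemma stabilizer_subgroup:
  assumes x: "x \<in> V"
  shows "subgroup {g \<in> carrier \<G>. aff g x = x} \<G>"
proof (rule subgroupI)
  show "{g \<in> carrier \<G>. aff g x = x} \<noteq> {}" using aff_one[OF x] by blast
  show "inv g \<in> {g \<in> carrier \<G>. aff g x = x}" if "g \<in> {g \<in> carrier \<G>. aff g x = x}" for g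
    using aff_mult[of "inv g" g x] aff_one[OF x] that x by simp
  show "g \<otimes> h \<in> {g \<in> carrier \<G>. aff g x = x}"
    if "g \<in> {g \<in> carrier \<G>. aff g x = x}" "h \<in> {g \<in> carrier \<G>. aff g x = x}" for g h
    using aff_mult[of g h x] that x by simp
qed auto

end

text \<open>
  Below, \<open>L i\<close> plays the role of the factor \<open>G\<^sub>i\<close> and \<open>H i\<close> that of the product of the other factors.
\<close>

locale product_action = affine_isometric V N \<G> \<rho> c
  for V :: "'b::real_vector set" and N and \<G> :: "('g, 'm) monoid_scheme" (structure) and \<rho> c +
  fixes n :: nat and L H :: "nat \<Rightarrow> 'g set" and K :: "'g set" and e M :: real
  assumes L_normal: "i < n \<Longrightarrow> L i \<lhd> \<G>" and H_normal: "i < n \<Longrightarrow> H i \<lhd> \<G>"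
    and L_H_commute: "i < n \<Longrightarrow> l \<in> L i \<Longrightarrow> h \<in> H i \<Longrightarrow> l \<otimes> h = h \<otimes> l"
    and L_H_product: "i < n \<Longrightarrow> g \<in> carrier \<G> \<Longrightarrow> \<exists>l\<in>L i. \<exists>h\<in>H i. g = l \<otimes> h"
    and L_sub_H: "i < n \<Longrightarrow> j < n \<Longrightarrow> i \<noteq> j \<Longrightarrow> L i \<subseteq> H j"
    and L_generate: "subgroup S \<G> \<Longrightarrow> (\<And>i. i < n \<Longrightarrow> L i \<subseteq> S) \<Longrightarrow> carrier \<G> \<subseteq> S"
    and K_sub: "K \<subseteq> carrier \<G>" and e_pos: "e > 0"
    and gap: "v \<in> V \<Longrightarrow> \<exists>k\<in>K. e * N v \<le> N (\<rho> k v - v)"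
    and K_bound: "i < n \<Longrightarrow> k \<in> K \<Longrightarrow> \<exists>l\<in>L i. \<exists>h\<in>H i. k = l \<otimes> h \<and> N (c l) \<le> M \<and> N (c h) \<le> M"
begin

interpretation group \<G> by (rule group)

lemma H_sub: "i < n \<Longrightarrow> subgroup (H i) \<G>" and L_sub: "i < n \<Longrightarrow> subgroup (L i) \<G>"
  using H_normal L_normal by (auto intro: normal_imp_subgroup)

lemma H_carrier [simp]: "i < n \<Longrightarrow> h \<in> H i \<Longrightarrow> h \<in> carrier \<G>"
  using subgroup.mem_carrier[OF H_sub] .

lemma L_carrier [simp]: "i < n \<Longrightarrow> l \<in> L i \<Longrightarrow> l \<in> carrier \<G>"
  using subgroup.mem_carrier[OF L_sub] .

lemma isometries_H: "i < n \<Longrightarrow> isometries V N (\<rho> ` H i)"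
  using isometries_subgroup[OF H_sub] .

definition p :: "nat \<Rightarrow> 'b \<Rightarrow> 'b" where
  "p i = isometries.proj V N (\<rho> ` H i)"

definition B :: "nat \<Rightarrow> 'b set" where
  "B i = isometries.fixed V (\<rho> ` H i)"

lemma B_sub: "i < n \<Longrightarrow> v \<in> B i \<Longrightarrow> v \<in> V"
  using isometries.fixed_in[OF isometries_H] unfolding B_def .

lemma B_fixed: "i < n \<Longrightarrow> v \<in> B i \<Longrightarrow> h \<in> H i \<Longrightarrow> \<rho> h v = v"
  by (rule isometries.fixedD[OF isometries_H, of i v "\<rho> h"]) (simp_all add: B_def)

lemma p_in_B: "i < n \<Longrightarrow> v \<in> V \<Longrightarrow> p i v \<in> B i"
  using isometries.proj_fixed[OF isometries_H] unfolding B_def p_def .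

lemma p_of_B: "i < n \<Longrightarrow> v \<in> B i \<Longrightarrow> p i v = v"
  using isometries.proj_of_fixed[OF isometries_H] unfolding B_def p_def .

lemma p_contract: "i < n \<Longrightarrow> v \<in> V \<Longrightarrow> N (p i v) \<le> N v"
  using isometries.proj_contract[OF isometries_H] unfolding p_def .

lemma p_linear: "i < n \<Longrightarrow> linear_between V V (p i)"
  using isometries.proj_linear[OF isometries_H] unfolding p_def .

lemma p_in [simp]: "i < n \<Longrightarrow> v \<in> V \<Longrightarrow> p i v \<in> V"
  using p_in_B B_sub by blast

lemmas p_add = linearD(2)[OF p_linear]
  and p_scale = linearD(3)[OF p_linear]
  and p_diff = linear_more(3)[OF p_linear sub]
  and p_sum = linear_between_sum[OF p_linear sub]

lemma p_equivariant:
  assumes i: "i < n" and g: "g \<in> carrier \<G>" and v: "v \<in> V"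
  shows "p i (\<rho> g v) = \<rho> g (p i v)"
  unfolding p_def
proof (rule isometries.proj_equivariant[OF isometries_H[OF i]])
  fix h' assume "h' \<in> \<rho> ` H i"
  then obtain h where h: "h \<in> H i" "h' = \<rho> h" by blast
  have hc: "h \<in> carrier \<G>" using h i by simp
  let ?k = "inv g \<otimes> h \<otimes> g" and ?k' = "g \<otimes> h \<otimes> inv g"
  have "?k \<in> H i" "?k' \<in> H i"
    using normal.inv_op_closed1[OF H_normal[OF i] g h(1)] normal.inv_op_closed2[OF H_normal[OF i] g h(1)] .
  moreover have "h \<otimes> g = g \<otimes> ?k" "g \<otimes> h = ?k' \<otimes> g"
    using g hc by (simp add: m_assoc[symmetric], simp add: m_assoc)
  then have "\<rho> h (\<rho> g v) = \<rho> g (\<rho> ?k v)" "\<rho> g (\<rho> h v) = \<rho> ?k' (\<rho> g v)" if "v \<in> V" for v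
    using \<rho>_mult[OF hc g that] \<rho>_mult[OF g hc that] \<rho>_mult[OF g _ that, of ?k] \<rho>_mult[OF _ g that, of ?k'] g hc
    by simp_all
  ultimately show "\<exists>k\<in>\<rho> ` H i. \<forall>v\<in>V. h' (\<rho> g v) = \<rho> g (k v)" "\<exists>k\<in>\<rho> ` H i. \<forall>v\<in>V. \<rho> g (h' v) = k (\<rho> g v)"
    unfolding h(2) by blast+
qed (use \<rho>_lin \<rho>_iso g v in auto)

lemma invariant_eq_0:
  assumes "v \<in> V" "\<And>g. g \<in> carrier \<G> \<Longrightarrow> \<rho> g v = v"
  shows "v = 0"
proof -
  obtain k where "k \<in> K" "e * N v \<le> N (\<rho> k v - v)" using gap[OF assms(1)] by blast
  then have "e * N v \<le> 0" using assms(2)[of k] K_sub by auto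
  then have "N v \<le> 0" using e_pos by (simp add: mult_le_0_iff)
  then have "N v = 0" using assms(1) by (simp add: order_class.order_eq_iff)
  then show ?thesis using N_eq_0 assms(1) by simp
qed

lemma L_invariant_eq_0:
  assumes "i < n" "v \<in> B i" "\<And>l. l \<in> L i \<Longrightarrow> \<rho> l v = v"
  shows "v = 0"
proof (rule invariant_eq_0)
  show v: "v \<in> V" using assms B_sub by blast
  fix g assume "g \<in> carrier \<G>"
  then obtain l h where "l \<in> L i" "h \<in> H i" "g = l \<otimes> h" using L_H_product assms(1) by blast
  then show "\<rho> g v = v" using \<rho>_mult[of l h v] B_fixed[OF assms(1,2)] assms(3) v assms(1) by simp
qed

text \<open>\<open>L i\<close> lies in \<open>H j\<close> and fixes \<open>p j v\<close>;
  \<open>p i\<close> commutes with the group and adds invariance under \<open>H i\<close>. Together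
  these two subgroups give the whole group, whose only fixed vector is 0.\<close>

lemma p_p_0:
  assumes "i < n" "j < n" "i \<noteq> j" "v \<in> V"
  shows "p i (p j v) = 0"
proof (rule L_invariant_eq_0[OF assms(1)])
  show "p i (p j v) \<in> B i" using p_in_B assms by simp
  fix l assume l: "l \<in> L i"
  then have "l \<in> H j" using L_sub_H[OF assms(1-3)] by blast
  then have "\<rho> l (p j v) = p j v" using B_fixed p_in_B assms by blast
  then show "\<rho> l (p i (p j v)) = p i (p j v)" using p_equivariant[of i l "p j v"] assms l by simp
qed

section \<open>The sum of the projections and its complement\<close>

definition Q :: "'b \<Rightarrow> 'b" where "Q v = (\<Sum>i<n. p i v)"
definition R :: "'b \<Rightarrow> 'b" where "R v = v - Q v"

lemma Q_in [simp]: "v \<in> V \<Longrightarrow> Q v \<in> V"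
  unfolding Q_def using sub by (intro subspace_sum) auto

lemma R_in [simp]: "v \<in> V \<Longrightarrow> R v \<in> V"
  by (simp add: R_def)

text \<open>The sum of the spaces \<open>B j\<close> is direct, with coordinates \<open>p i\<close>;
  this makes \<open>Q\<close> idempotent.\<close>

lemma p_sum_B:
  assumes "i < n" "\<And>j. j < n \<Longrightarrow> b j \<in> B j"
  shows "p i (\<Sum>j<n. b j) = b i"
proof -
  have b: "p j (b j) = b j" "b j \<in> V" if "j < n" for j using p_of_B B_sub assms(2) that by auto
  have "p i (\<Sum>j<n. b j) = (\<Sum>j<n. p i (b j))" using b by (intro p_sum[OF assms(1)]) auto
  also have "\<dots> = (\<Sum>j<n. if j = i then b i else 0)"
  proof (rule sum.cong[OF refl])
    fix j assume "j \<in> {..<n}"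
    then show "p i (b j) = (if j = i then b i else 0)"
      using p_p_0[of i j "b j"] b[of j] assms(1) by (cases "j = i") auto
  qed
  finally show ?thesis using assms(1) by simp
qed

lemma p_Q: "i < n \<Longrightarrow> v \<in> V \<Longrightarrow> p i (Q v) = p i v"
  unfolding Q_def by (rule p_sum_B) (auto intro: p_in_B)

lemma p_R: "i < n \<Longrightarrow> v \<in> V \<Longrightarrow> p i (R v) = 0"
  by (simp add: R_def p_diff p_Q)

lemma Q_Q: "v \<in> V \<Longrightarrow> Q (Q v) = Q v"
  using p_Q by (auto simp: Q_def[of "Q v"] Q_def[of v, symmetric] intro: trans[OF sum.cong[OF refl] Q_def[symmetric]])

lemma Q_R: "v \<in> V \<Longrightarrow> Q (R v) = 0"
  using p_R by (simp add: Q_def[of "R v"])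

lemma Q_linear: "linear_between V V Q"
  unfolding linear_between_def by (auto simp: Q_def[of "_ + _"] Q_def[of "_ *\<^sub>R _"] p_add p_scale)
    (simp_all add: Q_def sum.distrib scaleR_right.sum)

lemma R_linear: "linear_between V V R"
  using Q_linear unfolding linear_between_def R_def by (auto simp: algebra_simps)

lemma Q_equivariant: "g \<in> carrier \<G> \<Longrightarrow> v \<in> V \<Longrightarrow> Q (\<rho> g v) = \<rho> g (Q v)"
  unfolding Q_def by (subst linear_between_sum[OF \<rho>_lin sub]) (auto simp: p_equivariant)

lemma R_equivariant: "g \<in> carrier \<G> \<Longrightarrow> v \<in> V \<Longrightarrow> R (\<rho> g v) = \<rho> g (R v)"
  by (simp add: R_def Q_equivariant \<rho>_diff)

lemma N_sum_le: "finite I \<Longrightarrow> (\<And>i. i \<in> I \<Longrightarrow> x i \<in> V) \<Longrightarrow> N (\<Sum>i\<in>I. x i) \<le> (\<Sum>i\<in>I. N (x i))"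
proof (induction I rule: finite_induct)
  case (insert i I)
  then have "(\<Sum>i\<in>I. x i) \<in> V" using sub by (intro subspace_sum) auto
  then show ?case using insert N_add[of "x i" "\<Sum>i\<in>I. x i"] by force
qed simp

lemma Q_bound: "v \<in> V \<Longrightarrow> N (Q v) \<le> real n * N v"
proof -
  assume v: "v \<in> V"
  have "N (Q v) \<le> (\<Sum>i<n. N (p i v))" unfolding Q_def using v by (intro N_sum_le) auto
  also have "\<dots> \<le> (\<Sum>i<n. N v)" using v p_contract by (intro sum_mono) auto
  finally show ?thesis by simp
qed

lemma R_bound: "v \<in> V \<Longrightarrow> N (R v) \<le> (1 + real n) * N v"
  using N_diff[of v "Q v"] Q_bound[of v] by (simp add: R_def algebra_simps)

section \<open>Fixed points in the kernel of \<open>Q\<close>\<close>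

lemma ker_Q_closed: "norm_closed {v \<in> V. Q v = 0}"
  unfolding norm_closed_def
proof (intro conjI allI impI)
  fix y :: "nat \<Rightarrow> 'b" and z assume y: "\<forall>k. y k \<in> {v \<in> V. Q v = 0}" and z: "z \<in> V"
    and lim: "(\<lambda>k. N (y k - z)) \<longlonglongrightarrow> 0"
  have "N (Q z) \<le> real n * N (y k - z)" for k
    using Q_bound[of "y k - z"] linear_more(3)[OF Q_linear sub, of "y k" z] y z by (simp add: N_minus)
  moreover have "(\<lambda>k. real n * N (y k - z)) \<longlonglongrightarrow> real n * 0" by (intro tendsto_intros lim)
  ultimately have "N (Q z) \<le> 0" using LIMSEQ_le_const by fastforce
  then have "N (Q z) = 0" using z by (simp add: order_class.order_eq_iff)
  then show "z \<in> {v \<in> V. Q v = 0}" using N_eq_0[of "Q z"] z by simp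
qed auto

lemma ker_Q_convex: "convex {v \<in> V. Q v = 0}"
  unfolding convex_alt by (auto simp: linearD(2,3)[OF Q_linear])

text \<open>Induction over the factors. The fixed points of \<open>L m\<close> in the set reached so
  far are closed, convex and, by normality, invariant, so \<open>fixed_point_step\<close> applies to
  the next factor; \<open>kill\<close> passes to subsets. A point fixed by all \<open>L i\<close>
  has a stabilizer that is everything.\<close>

lemma common_fixed_point:
  assumes Z: "norm_closed Z" "convex Z" "Z \<noteq> {}" "\<And>g x. g \<in> carrier \<G> \<Longrightarrow> x \<in> Z \<Longrightarrow> aff g x \<in> Z"
    and kill: "\<And>i l x. i < n \<Longrightarrow> l \<in> L i \<Longrightarrow> x \<in> Z \<Longrightarrow> p i (aff l x - x) = 0"
  shows "\<exists>x\<in>Z. \<forall>g\<in>carrier \<G>. aff g x = x"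
proof -
  have "m \<le> n \<Longrightarrow> \<exists>Z'. Z' \<subseteq> Z \<and> norm_closed Z' \<and> convex Z' \<and> Z' \<noteq> {} \<and>
      (\<forall>g\<in>carrier \<G>. \<forall>x\<in>Z'. aff g x \<in> Z') \<and> (\<forall>x\<in>Z'. \<forall>i<m. \<forall>l\<in>L i. aff l x = x)" for m
  proof (induction m)
    case 0
    then show ?case using Z by blast
  next
    case (Suc m)
    then obtain Z' where Z': "Z' \<subseteq> Z" "norm_closed Z'" "convex Z'" "Z' \<noteq> {}"
      "\<And>g x. g \<in> carrier \<G> \<Longrightarrow> x \<in> Z' \<Longrightarrow> aff g x \<in> Z'" "\<forall>x\<in>Z'. \<forall>i<m. \<forall>l\<in>L i. aff l x = x"
      by (metis Suc_leD)
    have m: "m < n" using Suc.prems by simp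
    have Lm: "L m \<subseteq> carrier \<G>" using m by auto
    have ZV: "Z' \<subseteq> V" using Z'(2) by (simp add: norm_closed_def)
    let ?Z = "{x \<in> Z'. \<forall>l\<in>L m. aff l x = x}"
    have "\<exists>x\<in>Z'. \<forall>l\<in>L m. aff l x = x"
    proof (rule fixed_point_step[OF H_sub[OF m] Lm _ Z'(2-5) _ e_pos gap K_bound[OF m]])
      show "\<And>l x. l \<in> L m \<Longrightarrow> x \<in> Z' \<Longrightarrow> isometries.proj V N (\<rho> ` H m) (aff l x - x) = 0"
        using kill[OF m] Z'(1) by (auto simp: p_def)
    qed (use L_H_commute[OF m] in auto)
    then have "?Z \<noteq> {}" by blast
    moreover have "norm_closed ?Z" "convex ?Z"
      unfolding fixed_set_eq_displaced[OF Lm ZV] using Lm Z'(2,3) ZV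
      by (auto intro!: displaced_closed displaced_convex)
    moreover have "\<forall>g\<in>carrier \<G>. \<forall>x\<in>?Z. aff g x \<in> ?Z"
      using fixed_set_invariant[OF L_normal[OF m] ZV Z'(5)] by blast
    moreover have "\<forall>x\<in>?Z. \<forall>i<Suc m. \<forall>l\<in>L i. aff l x = x" using Z'(6) by (auto simp: less_Suc_eq)
    moreover have "?Z \<subseteq> Z" using Z'(1) by blast
    ultimately show ?case by blast
  qed
  from this[OF order_refl] obtain Z' where Z': "Z' \<subseteq> Z" "Z' \<noteq> {}" "\<forall>x\<in>Z'. \<forall>i<n. \<forall>l\<in>L i. aff l x = x"
    by (elim exE conjE)
  obtain x where "x \<in> Z'" using Z'(2) by blast
  then have x: "x \<in> Z" "\<And>i l. i < n \<Longrightarrow> l \<in> L i \<Longrightarrow> aff l x = x" using Z'(1,3) by auto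
  have xV: "x \<in> V" using x Z(1) by (auto simp: norm_closed_def)
  have "carrier \<G> \<subseteq> {g \<in> carrier \<G>. aff g x = x}"
    by (rule L_generate[OF stabilizer_subgroup[OF xV]]) (use x in auto)
  then show ?thesis using x by blast
qed

text \<open>Applying the equivariant map \<open>R\<close> to the cocycle gives a cocycle again. The
  bound on \<open>K\<close> is multiplied by the bound 1 + n for the norm of
  \<open>R\<close>.\<close>

lemma product_action_R: "product_action V N \<G> \<rho> (\<lambda>g. R (c g)) n L H K e ((1 + real n) * M)"
proof (intro product_action.intro affine_isometric.intro affine_isometric_axioms.intro product_action_axioms.intro)
  show "\<And>i k. i < n \<Longrightarrow> k \<in> K \<Longrightarrow> \<exists>l\<in>L i. \<exists>h\<in>H i. k = l \<otimes> h \<and>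
       N (R (c l)) \<le> (1 + real n) * M \<and> N (R (c h)) \<le> (1 + real n) * M"
  proof -
    fix i k assume i: "i < n" "k \<in> K"
    from K_bound[OF this] obtain l h where lh: "l \<in> L i" "h \<in> H i" "k = l \<otimes> h" "N (c l) \<le> M" "N (c h) \<le> M" by blast
    have b: "N (R (c g)) \<le> (1 + real n) * M" if "g \<in> carrier \<G>" "N (c g) \<le> M" for g
      using R_bound[of "c g"] mult_left_mono[OF that(2), of "1 + real n"] c_in[OF that(1)] by linarith
    then show "\<exists>l\<in>L i. \<exists>h\<in>H i. k = l \<otimes> h \<and> N (R (c l)) \<le> (1 + real n) * M \<and> N (R (c h)) \<le> (1 + real n) * M"
      using lh i b[of l] b[of h] by (intro bexI[of _ l] bexI[of _ h] conjI) simp_all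
  qed
  show "\<And>g h. g \<in> carrier \<G> \<Longrightarrow> h \<in> carrier \<G> \<Longrightarrow> R (c (g \<otimes> h)) = \<rho> g (R (c h)) + R (c g)"
    by (simp add: c_mult linearD(2)[OF R_linear] R_equivariant)
qed (fact uc_banach_axioms group \<rho>_lin \<rho>_iso \<rho>_mult \<rho>_one L_normal H_normal L_H_commute L_H_product
    L_sub_H L_generate K_sub e_pos gap R_in[OF c_in])+

text \<open>The projected action preserves the kernel of \<open>Q\<close>. Displacements inside this
  kernel are annihilated by every \<open>p i\<close>, which is the \<open>kill\<close> hypothesis of
  \<open>common_fixed_point\<close>.\<close>

lemma transversal_fixed_point:
  obtains y where "y \<in> V" "Q y = 0" "\<And>g. g \<in> carrier \<G> \<Longrightarrow> \<rho> g y + R (c g) = y"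
proof -
  interpret A: product_action V N \<G> \<rho> "\<lambda>g. R (c g)" n L H K e "(1 + real n) * M"
    by (rule product_action_R)
  have QA: "Q (A.aff g x) = 0" if "g \<in> carrier \<G>" "x \<in> V" "Q x = 0" for g x
    using that by (simp add: A.aff_def linearD(2)[OF Q_linear] Q_equivariant Q_R
        linear_more(1)[OF \<rho>_lin sub])
  have "\<exists>x\<in>{v \<in> V. Q v = 0}. \<forall>g\<in>carrier \<G>. A.aff g x = x"
  proof (rule A.common_fixed_point[OF ker_Q_closed ker_Q_convex])
    show "{v \<in> V. Q v = 0} \<noteq> {}" using linear_more(1)[OF Q_linear sub] in_V(1) by blast
    show "\<And>g x. g \<in> carrier \<G> \<Longrightarrow> x \<in> {v \<in> V. Q v = 0} \<Longrightarrow> A.aff g x \<in> {v \<in> V. Q v = 0}"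
      using QA by simp
    fix i l x assume il: "i < n" "l \<in> L i" and x: "x \<in> {v \<in> V. Q v = 0}"
    have "Q (A.aff l x - x) = 0"
      using QA[of l x] linear_more(3)[OF Q_linear sub, of "A.aff l x" x] il x by simp
    then have "p i (A.aff l x - x) = p i 0" using p_Q[OF il(1), of "A.aff l x - x"] il x by simp
    then show "p i (A.aff l x - x) = 0" using linear_more(1)[OF p_linear[OF il(1)] sub] by simp
  qed
  then show ?thesis using that by (auto simp: A.aff_def)
qed

text \<open>Expanding the cocycle at l h = h l and applying \<open>p i\<close> shows that
  \<open>p i (c h)\<close> is fixed by \<open>L i\<close>. It is the reason why the action on
  \<open>B i\<close> sees only the coordinate \<open>i\<close>.\<close>

lemma p_cocycle_H:
  assumes i: "i < n" and h: "h \<in> H i"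
  shows "p i (c h) = 0"
proof (rule L_invariant_eq_0[OF i])
  show "p i (c h) \<in> B i" using p_in_B i h by simp
  fix l assume l: "l \<in> L i"
  have "\<rho> l (c h) + c l = \<rho> h (c l) + c h"
    using c_mult[of l h] c_mult[of h l] L_H_commute[OF i l h] i l h by simp
  then have "p i (\<rho> l (c h) + c l) = p i (\<rho> h (c l) + c h)" by simp
  then have "\<rho> l (p i (c h)) + p i (c l) = \<rho> h (p i (c l)) + p i (c h)"
    using i l h by (simp add: p_add p_equivariant)
  moreover have "\<rho> h (p i (c l)) = p i (c l)" using B_fixed p_in_B i l h by simp
  ultimately show "\<rho> l (p i (c h)) = p i (c h)" by simp
qed

end

section \<open>Norm topologies and invariant norms\<close>


context normed_set
begin

lemma topspace_norm_topology [simp]: "topspace (norm_topology V N) = V"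
proof -
  interpret M: Metric_space V "norm_dist V N" by (rule Metric)
  show ?thesis by (simp add: norm_topology_def)
qed

lemma openin_norm_topology:
  "openin (norm_topology V N) U \<longleftrightarrow> U \<subseteq> V \<and> (\<forall>x\<in>U. \<exists>r>0. \<forall>y\<in>V. N (x - y) < r \<longrightarrow> y \<in> U)"
proof -
  interpret M: Metric_space V "norm_dist V N" by (rule Metric)
  have "M.mball x r \<subseteq> U \<longleftrightarrow> (\<forall>y\<in>V. N (x - y) < r \<longrightarrow> y \<in> U)" if "x \<in> V" for x r
    using that by (auto simp: M.mball_def norm_dist_def)
  then show ?thesis
    unfolding norm_topology_def M.openin_mtopology by (metis subsetD)
qed

lemma openin_ball: "x \<in> V \<Longrightarrow> openin (norm_topology V N) {y \<in> V. N (x - y) < r}"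
  unfolding openin_norm_topology
proof (intro conjI ballI)
  fix y assume x: "x \<in> V" and y: "y \<in> {y \<in> V. N (x - y) < r}"
  then have "z \<in> {y \<in> V. N (x - y) < r}" if "z \<in> V" "N (y - z) < r - N (x - y)" for z
    using N_triangle[of x y z] that by simp
  then show "\<exists>s>0. \<forall>z\<in>V. N (y - z) < s \<longrightarrow> z \<in> {y \<in> V. N (x - y) < r}"
    using y by (intro exI[of _ "r - N (x - y)"]) auto
qed auto

lemma nhd_0:
  assumes "openin (norm_topology V N) U" "0 \<in> U"
  shows "\<exists>r>0. \<forall>y\<in>V. N y < r \<longrightarrow> y \<in> U"
proof -
  obtain r where r: "r > 0" "\<forall>y\<in>V. N (0 - y) < r \<longrightarrow> y \<in> U"
    using assms unfolding openin_norm_topology by blast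
  then have "\<forall>y\<in>V. N y < r \<longrightarrow> y \<in> U" by (simp add: N_minus)
  then show ?thesis using r(1) by blast
qed

lemma openin_ball_0: "openin (norm_topology V N) {y \<in> V. N y < r}"
proof -
  have "{y \<in> V. N (0 - y) < r} = {y \<in> V. N y < r}" by (auto simp: N_minus)
  then show ?thesis using openin_ball[of 0 r] by simp
qed

text \<open>Completeness in terms of \<open>N\<close> alone, the form that passes to an equivalent
  norm and to the fixed spaces.\<close>

lemma mcomplete_iff:
  "Metric_space.mcomplete V (norm_dist V N) \<longleftrightarrow>
     (\<forall>y. (\<forall>n::nat. y n \<in> V) \<longrightarrow> (\<forall>e>0. \<exists>M. \<forall>m\<ge>M. \<forall>n\<ge>M. N (y m - y n) < e) \<longrightarrow>
       (\<exists>l\<in>V. (\<lambda>n. N (y n - l)) \<longlonglongrightarrow> 0))"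
proof -
  interpret M: Metric_space V "norm_dist V N" by (rule Metric)
  have 1: "M.MCauchy y \<longleftrightarrow> (\<forall>n. y n \<in> V) \<and> (\<forall>e>0. \<exists>M. \<forall>m\<ge>M. \<forall>n\<ge>M. N (y m - y n) < e)" for y
    by (auto simp: M.MCauchy_def norm_dist_def image_subset_iff)
  have 2: "limitin M.mtopology y l sequentially \<longleftrightarrow> l \<in> V \<and> (\<lambda>n. N (y n - l)) \<longlonglongrightarrow> 0"
    if "\<And>n. y n \<in> V" for y l
  proof (cases "l \<in> V")
    case True
    then have "(\<lambda>n. norm_dist V N (y n) l) = (\<lambda>n. N (y n - l))" using that by (simp add: norm_dist_def)
    then show ?thesis using True that by (simp add: M.limitin_metric_dist_null)
  qed (use M.limitin_mspace in blast)
  have 3: "(\<exists>l. limitin M.mtopology y l sequentially) \<longleftrightarrow> (\<exists>l\<in>V. (\<lambda>n. N (y n - l)) \<longlonglongrightarrow> 0)"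
    if "\<forall>n. y n \<in> V" for y
    using 2[of y] that by blast
  show ?thesis unfolding M.mcomplete_def by (simp add: 1 3 imp_conjL cong: imp_cong)
qed

lemma compactin_bounded:
  assumes "compactin (norm_topology V N) C"
  shows "\<exists>M. \<forall>x\<in>C. N x \<le> M"
proof -
  interpret M: Metric_space V "norm_dist V N" by (rule Metric)
  obtain B where CV: "C \<subseteq> V" and B: "\<forall>x\<in>C. \<forall>y\<in>C. norm_dist V N x y \<le> B"
    using M.compactin_imp_mbounded assms unfolding norm_topology_def M.mbounded_alt by blast
  show ?thesis
  proof (cases "C = {}")
    case False
    then obtain y where y: "y \<in> C" by blast
    have "N x \<le> N y + B" if "x \<in> C" for x
    proof -
      have "x \<in> V" "y \<in> V" using that y CV by auto
      then show ?thesis using N_rev_triangle[of x y] B[rule_format, OF that y] by (simp add: norm_dist_def)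
    qed
    then show ?thesis by blast
  qed simp
qed

lemma closedin_singleton: "x \<in> V \<Longrightarrow> closedin (norm_topology V N) {x}"
proof -
  interpret M: Metric_space V "norm_dist V N" by (rule Metric)
  show "x \<in> V \<Longrightarrow> closedin (norm_topology V N) {x}"
    using M.Hausdorff_space_mtopology by (simp add: norm_topology_def closedin_Hausdorff_sing_eq)
qed

lemma normed_subset: "subspace W \<Longrightarrow> W \<subseteq> V \<Longrightarrow> normed_set W N"
  using norm_on by unfold_locales (auto simp: norm_on_def subset_iff)

lemma norm_topology_subspace:
  assumes W: "subspace W" "W \<subseteq> V"
  shows "norm_topology W N = subtopology (norm_topology V N) W"
proof -
  interpret W: normed_set W N using normed_subset[OF W] .
  have "openin (norm_topology W N) U \<longleftrightarrow> openin (subtopology (norm_topology V N) W) U" for U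
  proof
    assume U: "openin (norm_topology W N) U"
    \<comment> \<open>Extends an open set of \<open>W\<close> to one of \<open>V\<close>: the union
      of those balls of \<open>V\<close> whose trace on \<open>W\<close> stays inside
      \<open>U\<close>.\<close>
    define A where "A = \<Union>{{y \<in> V. N (x - y) < r} |x r. x \<in> U \<and> (\<forall>z\<in>W. N (x - z) < r \<longrightarrow> z \<in> U)}"
    have UW: "U \<subseteq> W" using U W.openin_norm_topology by blast
    have "openin (norm_topology V N) A"
      unfolding A_def using UW W(2) openin_ball by (intro openin_Union) blast
    moreover have "U = A \<inter> W"
    proof
      show "A \<inter> W \<subseteq> U" unfolding A_def by blast
      show "U \<subseteq> A \<inter> W"
      proof
        fix x assume x: "x \<in> U"
        then obtain r where "r > 0" "\<forall>z\<in>W. N (x - z) < r \<longrightarrow> z \<in> U"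
          using U W.openin_norm_topology by blast
        then have "x \<in> A" unfolding A_def using x UW W(2)
          by (intro UnionI[of "{y \<in> V. N (x - y) < r}"]) auto
        then show "x \<in> A \<inter> W" using x UW by blast
      qed
    qed
    ultimately show "openin (subtopology (norm_topology V N) W) U" by (auto simp: openin_subtopology)
  next
    assume "openin (subtopology (norm_topology V N) W) U"
    then obtain A where A: "openin (norm_topology V N) A" "U = A \<inter> W" by (auto simp: openin_subtopology)
    have "\<exists>r>0. \<forall>y\<in>W. N (x - y) < r \<longrightarrow> y \<in> U" if x: "x \<in> U" for x
    proof -
      obtain r where "r > 0" "\<forall>y\<in>V. N (x - y) < r \<longrightarrow> y \<in> A"
        using A x unfolding openin_norm_topology by blast
      then show ?thesis using A(2) W(2) by (intro exI[of _ r]) auto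
    qed
    then show "openin (norm_topology W N) U" unfolding W.openin_norm_topology using A(2) by blast
  qed
  then show ?thesis by (simp add: topology_eq)
qed

lemma continuous_map_Lipschitz:
  assumes W: "normed_set W N'" and f: "f ` V \<subseteq> W" "\<And>x y. x \<in> V \<Longrightarrow> y \<in> V \<Longrightarrow> N' (f x - f y) \<le> C * N (x - y)"
  shows "continuous_map (norm_topology V N) (norm_topology W N') f"
proof -
  interpret W: normed_set W N' by (rule W)
  show ?thesis unfolding continuous_map_def
  proof (intro conjI allI impI)
    show "f \<in> topspace (norm_topology V N) \<rightarrow> topspace (norm_topology W N')" using f(1) by auto
    fix U assume U: "openin (norm_topology W N') U"
    show "openin (norm_topology V N) {x \<in> topspace (norm_topology V N). f x \<in> U}"
      unfolding openin_norm_topology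
    proof (intro conjI ballI)
      fix x assume "x \<in> {x \<in> topspace (norm_topology V N). f x \<in> U}"
      then have x: "x \<in> V" "f x \<in> U" by auto
      obtain r where r: "r > 0" "\<forall>y\<in>W. N' (f x - y) < r \<longrightarrow> y \<in> U"
        using U x W.openin_norm_topology by blast
      \<comment> \<open>\<open>\<bar>C\<bar> + 1\<close> keeps the radius well defined and positive
        whatever the sign of \<open>C\<close>.\<close>
      have "f y \<in> U" if y: "y \<in> V" "N (x - y) < r / (\<bar>C\<bar> + 1)" for y
      proof -
        have "N' (f x - f y) \<le> C * N (x - y)" using f(2) x y by simp
        also have "\<dots> \<le> (\<bar>C\<bar> + 1) * N (x - y)" using x y by (intro mult_right_mono) auto
        also have "\<dots> < r"
        proof -
          have "0 < \<bar>C\<bar> + 1" by simp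
          then show ?thesis using y(2) by (simp add: pos_less_divide_eq mult.commute)
        qed
        finally show ?thesis using r(2) f(1) y(1) by blast
      qed
      then show "\<exists>r>0. \<forall>y\<in>V. N (x - y) < r \<longrightarrow> y \<in> {x \<in> topspace (norm_topology V N). f x \<in> U}"
        using r(1) by (intro exI[of _ "r / (\<bar>C\<bar> + 1)"]) auto
    qed auto
  qed
qed

end

lemma norm_topology_equivalent:
  assumes "normed_set V N" "normed_set V N'"
    and "\<And>x. x \<in> V \<Longrightarrow> N x \<le> C * N' x" "\<And>x. x \<in> V \<Longrightarrow> N' x \<le> C' * N x"
  shows "norm_topology V N = norm_topology V N'"
proof -
  interpret A: normed_set V N by fact
  interpret B: normed_set V N' by fact
  have "continuous_map (norm_topology V N) (norm_topology V N') id"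
    using assms A.in_V(3) by (intro A.continuous_map_Lipschitz[where C = C']) auto
  moreover have "continuous_map (norm_topology V N') (norm_topology V N) id"
    using assms A.in_V(3) by (intro B.continuous_map_Lipschitz[where C = C]) auto
  ultimately have "homeomorphic_maps (norm_topology V N) (norm_topology V N') id id"
    by (simp add: homeomorphic_maps_def)
  then show ?thesis by (simp add: homeomorphic_maps_id)
qed

section \<open>Subspaces, sums of maps and group actions\<close>

lemma topological_vector_space_subspace:
  assumes T: "topological_vector_space T" and W: "subspace W" "W \<subseteq> topspace T"
  shows "topological_vector_space (subtopology T W)"
proof -
  have top: "topspace (subtopology T W) = W" using W by auto
  have cont: "continuous_map (prod_topology (subtopology T W) (subtopology T W)) T (\<lambda>(x, y). x + y)"
    "continuous_map (prod_topology euclideanreal (subtopology T W)) T (\<lambda>(a, x). a *\<^sub>R x)"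
    using T unfolding topological_vector_space_def
    by (simp_all add: prod_topology_subtopology subtopology_subtopology continuous_map_from_subtopology)
  show ?thesis
    unfolding topological_vector_space_def top
  proof (intro conjI W(1))
    show "continuous_map (prod_topology (subtopology T W) (subtopology T W)) (subtopology T W) (\<lambda>(x, y). x + y)"
      by (rule continuous_map_into_subtopology[OF cont(1)]) (auto intro: subspace_add[OF W(1)])
    show "continuous_map (prod_topology euclideanreal (subtopology T W)) (subtopology T W) (\<lambda>(a, x). a *\<^sub>R x)"
      by (rule continuous_map_into_subtopology[OF cont(2)]) (auto intro: subspace_scale[OF W(1)])
  qed
qed

lemma continuous_map_sum:
  fixes T :: "'b::real_vector topology"
  assumes T: "topological_vector_space T" and f: "\<And>i. i \<in> I \<Longrightarrow> continuous_map X T (f i)"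
  shows "continuous_map X T (\<lambda>x. \<Sum>i\<in>I. f i x)"
  using f
proof (induction I rule: infinite_finite_induct)
  case (insert i I)
  then have "continuous_map X (prod_topology T T) (\<lambda>x. (f i x, \<Sum>i\<in>I. f i x))"
    by (intro continuous_map_pairedI) auto
  moreover have "continuous_map (prod_topology T T) T (\<lambda>(x, y). x + y)"
    using T by (simp add: topological_vector_space_def)
  ultimately have "continuous_map X T ((\<lambda>(x, y). x + y) \<circ> (\<lambda>x. (f i x, \<Sum>i\<in>I. f i x)))"
    by (rule continuous_map_compose)
  then show ?case using insert by (simp add: o_def)
qed (use T in \<open>auto simp: topological_vector_space_def subspace_0\<close>)

text \<open>A group action is a homomorphism into the extensional bijections of \<open>E\<close>, so
  products must agree outside \<open>E\<close> too; this is the purpose of \<open>ext\<close>.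
  Bijectivity comes from the inverse element.\<close>

lemma group_actionI:
  assumes G: "group G"
    and cl: "\<And>g x. g \<in> carrier G \<Longrightarrow> x \<in> E \<Longrightarrow> \<phi> g x \<in> E"
    and ext: "\<And>g. g \<in> carrier G \<Longrightarrow> \<phi> g \<in> extensional E"
    and mult: "\<And>g h x. g \<in> carrier G \<Longrightarrow> h \<in> carrier G \<Longrightarrow> x \<in> E \<Longrightarrow> \<phi> (g \<otimes>\<^bsub>G\<^esub> h) x = \<phi> g (\<phi> h x)"
    and one: "\<And>x. x \<in> E \<Longrightarrow> \<phi> \<one>\<^bsub>G\<^esub> x = x"
  shows "group_action G E \<phi>"
proof -
  interpret group G by (rule G)
  have inv1: "\<phi> (inv\<^bsub>G\<^esub> g) (\<phi> g x) = x" and inv2: "\<phi> g (\<phi> (inv\<^bsub>G\<^esub> g) x) = x"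
    if "g \<in> carrier G" "x \<in> E" for g x
    using mult[of "inv\<^bsub>G\<^esub> g" g x] mult[of g "inv\<^bsub>G\<^esub> g" x] one[of x] that by simp_all
  have bij: "\<phi> g \<in> Bij E" if g: "g \<in> carrier G" for g
  proof -
    have "bij_betw (\<phi> g) E E"
      by (rule bij_betw_byWitness[where f' = "\<phi> (inv\<^bsub>G\<^esub> g)"]) (use inv1 inv2 cl g in auto)
    then show ?thesis using ext[OF g] by (simp add: Bij_def)
  qed
  have "\<phi> (g \<otimes>\<^bsub>G\<^esub> h) = compose E (\<phi> g) (\<phi> h)" if gh: "g \<in> carrier G" "h \<in> carrier G" for g h
  proof (rule extensionalityI[of _ E])
    show "\<phi> (g \<otimes>\<^bsub>G\<^esub> h) \<in> extensional E" using ext gh by simp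
    show "\<phi> (g \<otimes>\<^bsub>G\<^esub> h) x = compose E (\<phi> g) (\<phi> h) x" if "x \<in> E" for x
      using mult[OF gh that] that by (simp add: compose_def)
  qed auto
  then have "\<phi> \<in> hom G (BijGroup E)" using bij by (auto simp: hom_def BijGroup_def)
  then show ?thesis
    unfolding group_action_def group_hom_def group_hom_axioms_def using G group_BijGroup by blast
qed

text \<open>
  The invariant norm is the supremum of the given uniformly convex norm over the group; its modulus
  of convexity is that of the given norm up to the equivalence constant.
\<close>

lemma invariant_renorming:
  fixes T :: "'b::real_vector topology"
  assumes G: "group \<G>" and T: "superreflexive T" and act: "affine_action \<G> T act \<rho> c"
    and ueq: "uniformly_equicontinuous T (act ` carrier \<G>)"
  obtains N where "norm_topology (topspace T) N = T" "affine_isometric (topspace T) N \<G> \<rho> c"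
proof -
  interpret group \<G> by (rule G)
  define V where "V = topspace T"
  obtain W :: "'b set" and N' f where tvs: "topological_vector_space T" and ban: "banach_space W N'"
    and ucW: "uniformly_convex W N'" and f: "linear_between V W f" and hom: "homeomorphic_map T (norm_topology W N') f"
    using T unfolding superreflexive_def V_def by blast
  interpret W: uc_banach W N'
    using ban ucW by unfold_locales (auto simp: banach_space_def)
  have subV: "subspace V" using tvs by (simp add: topological_vector_space_def V_def)
  have V [simp]: "0 \<in> V" "\<And>x y. x \<in> V \<Longrightarrow> y \<in> V \<Longrightarrow> x + y \<in> V" "\<And>x y. x \<in> V \<Longrightarrow> y \<in> V \<Longrightarrow> x - y \<in> V"
    "\<And>a x. x \<in> V \<Longrightarrow> a *\<^sub>R x \<in> V"
    using subV by (simp_all add: subspace_0 subspace_add subspace_diff subspace_scale)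
  note fl = linearD[OF f] linear_more[OF f subV]
  have fW [simp]: "f x \<in> W" if "x \<in> V" for x using fl(1) that .
  have inj: "inj_on f V" and surj: "f ` V = W"
    using homeomorphic_imp_injective_map[OF hom] homeomorphic_imp_surjective_map[OF hom] by (simp_all add: V_def)
  define N0 where "N0 x = N' (f x)" for x
  have f0: "f x = 0 \<longleftrightarrow> x = 0" if "x \<in> V" for x
    using inj_onD[OF inj, of x 0] that fl(4) by auto
  interpret N0: normed_set V N0
    using subV W.N_eq_0 by unfold_locales (auto simp: norm_on_def N0_def fl f0 W.N_scale W.N_add)
  have topN0: "norm_topology V N0 = T"
  proof -
    have "openin (norm_topology V N0) U \<longleftrightarrow> openin T U" for U
    proof (cases "U \<subseteq> V")
      case True
      have "openin T U \<longleftrightarrow> openin (norm_topology W N') (f ` U)"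
        using homeomorphic_map_openness[OF hom] True by (simp add: V_def)
      also have "\<dots> \<longleftrightarrow> (\<forall>x\<in>U. \<exists>r>0. \<forall>y\<in>f ` V. N' (f x - y) < r \<longrightarrow> y \<in> f ` U)"
        unfolding W.openin_norm_topology surj using True by auto
      also have "\<dots> \<longleftrightarrow> (\<forall>x\<in>U. \<exists>r>0. \<forall>y\<in>V. N0 (x - y) < r \<longrightarrow> y \<in> U)"
      proof (rule ball_cong[OF refl], rule ex_cong1, rule conj_cong[OF refl])
        fix x r assume "x \<in> U"
        then have "N' (f x - f y) = N0 (x - y)" if "y \<in> V" for y using that True by (auto simp: N0_def fl)
        moreover have "f y \<in> f ` U \<longleftrightarrow> y \<in> U" if "y \<in> V" for y
          using inj_on_image_mem_iff[OF inj that True] .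
        ultimately show "(\<forall>y\<in>f ` V. N' (f x - y) < r \<longrightarrow> y \<in> f ` U) \<longleftrightarrow> (\<forall>y\<in>V. N0 (x - y) < r \<longrightarrow> y \<in> U)"
          by simp
      qed
      also have "\<dots> \<longleftrightarrow> openin (norm_topology V N0) U" unfolding N0.openin_norm_topology using True by blast
      finally show ?thesis by blast
    next
      case False
      then show ?thesis using openin_subset[of T U] N0.openin_norm_topology by (auto simp: V_def)
    qed
    then show ?thesis by (simp add: topology_eq)
  qed
  interpret A: group_action \<G> V act using act by (simp add: affine_action_def V_def)
  have \<rho>_lin: "linear_between V V (\<rho> g)" and c_in: "c g \<in> V" and act_eq: "\<And>x. x \<in> V \<Longrightarrow> act g x = \<rho> g x + c g"
    if "g \<in> carrier \<G>" for g
    using act that by (auto simp: affine_action_def V_def)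
  note \<rho>l = linearD[OF \<rho>_lin] linear_more[OF \<rho>_lin subV]
  have act_in: "act g x \<in> V" if "g \<in> carrier \<G>" "x \<in> V" for g x
    using that \<rho>l(1) c_in by (simp add: act_eq)
  have act_0: "act g 0 = c g" if "g \<in> carrier \<G>" for g using that by (simp add: act_eq \<rho>l(4))
  have \<rho>_eq: "\<rho> g (x - y) = act g x - act g y" if "g \<in> carrier \<G>" "x \<in> V" "y \<in> V" for g x y
    using that by (simp add: act_eq \<rho>l(6))
  have c_mult: "c (g \<otimes>\<^bsub>\<G>\<^esub> h) = \<rho> g (c h) + c g" if "g \<in> carrier \<G>" "h \<in> carrier \<G>" for g h
    using A.composition_rule[OF V(1) that] act_eq[OF that(1) c_in[OF that(2)]] act_0[OF that(2)]
      act_0[of "g \<otimes>\<^bsub>\<G>\<^esub> h"] that by simp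
  \<comment> \<open>\<open>affine_action\<close> states the homomorphism property for
    \<open>act\<close> only. For the linear parts it follows because \<open>\<rho> g\<close> maps
    differences to differences of values of \<open>act g\<close>.\<close>
  have \<rho>_mult: "\<rho> (g \<otimes>\<^bsub>\<G>\<^esub> h) x = \<rho> g (\<rho> h x)" if "g \<in> carrier \<G>" "h \<in> carrier \<G>" "x \<in> V" for g h x
  proof -
    have "\<rho> (g \<otimes>\<^bsub>\<G>\<^esub> h) (x - 0) = act g (act h x) - act g (act h 0)"
      using that A.composition_rule by (subst \<rho>_eq) auto
    also have "\<dots> = \<rho> g (act h x - act h 0)" using that act_in by (simp add: \<rho>_eq)
    also have "\<dots> = \<rho> g (\<rho> h (x - 0))" using that by (subst \<rho>_eq) auto
    finally show ?thesis by simp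
  qed
  have \<rho>_one: "\<rho> \<one>\<^bsub>\<G>\<^esub> x = x" if "x \<in> V" for x
  proof -
    have "act \<one>\<^bsub>\<G>\<^esub> y = y" if "y \<in> V" for y using A.id_eq_one that by (metis restrict_apply')
    then show ?thesis using \<rho>_eq[of "\<one>\<^bsub>\<G>\<^esub>" x 0] that by simp
  qed
  \<comment> \<open>For affine maps, equicontinuity at the unit ball is a uniform bound on the
    linear parts. Scaling \<open>x\<close> to norm \<open>r / 2\<close>, inside the ball of radius
    \<open>r\<close>, gives the constant 2 / r.\<close>
  obtain C where C: "C > 0" "\<And>g x. g \<in> carrier \<G> \<Longrightarrow> x \<in> V \<Longrightarrow> N0 (\<rho> g x) \<le> C * N0 x"
  proof -
    let ?U = "{y \<in> V. N0 y < 1}"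
    have U: "openin T ?U \<and> 0 \<in> ?U" using N0.openin_ball_0 topN0 by simp
    obtain S where S: "openin T S" "0 \<in> S"
      "\<forall>x\<in>V. \<forall>y\<in>V. x - y \<in> S \<longrightarrow> (\<forall>h\<in>act ` carrier \<G>. h x - h y \<in> ?U)"
      using ueq[unfolded uniformly_equicontinuous_def, folded V_def, THEN spec, THEN mp, OF U] by (elim exE conjE)
    obtain r where r: "r > 0" "\<forall>y\<in>V. N0 y < r \<longrightarrow> y \<in> S"
      using N0.nhd_0[of S] topN0 S(1,2) by auto
    have "N0 (\<rho> g x) \<le> 2 / r * N0 x" if g: "g \<in> carrier \<G>" and x: "x \<in> V" for g x
    proof (cases "x = 0")
      case True
      then show ?thesis using g by (simp add: \<rho>l(4))
    next
      case False
      then have Nx: "N0 x > 0" using x N0.N_eq_0[of x] N0.N_nonneg[of x] by linarith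
      define t where "t = r / (2 * N0 x)"
      have t: "t > 0" using r(1) Nx by (simp add: t_def)
      have "N0 (t *\<^sub>R x) < r" using t Nx r(1) x by (simp add: N0.N_scale) (simp add: t_def)
      then have "t *\<^sub>R x - 0 \<in> S" using r(2) x by simp
      moreover have "t *\<^sub>R x \<in> V" using x by simp
      ultimately have "act g (t *\<^sub>R x) - act g 0 \<in> ?U" using S(3) g V(1) by blast
      then have "N0 (\<rho> g (t *\<^sub>R x)) < 1" using \<rho>_eq[of g "t *\<^sub>R x" 0] g x by simp
      then have "t * N0 (\<rho> g x) < 1" using t g x by (simp add: \<rho>l N0.N_scale)
      then show ?thesis using Nx r(1) by (simp add: t_def field_simps)
    qed
    then show thesis using that[of "2 / r"] r(1) by simp
  qed
  define N1 where "N1 x = (SUP g\<in>carrier \<G>. N0 (\<rho> g x))" for x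
  have bdd: "bdd_above ((\<lambda>g. N0 (\<rho> g x)) ` carrier \<G>)" if "x \<in> V" for x
    using C(2)[OF _ that] by (intro bdd_aboveI[of _ "C * N0 x"]) auto
  have ne: "carrier \<G> \<noteq> {}" by blast
  have up: "N0 (\<rho> g x) \<le> N1 x" if "g \<in> carrier \<G>" "x \<in> V" for g x
    unfolding N1_def using that bdd by (intro cSUP_upper) auto
  have least: "N1 x \<le> b" if "\<And>g. g \<in> carrier \<G> \<Longrightarrow> N0 (\<rho> g x) \<le> b" for x b
    unfolding N1_def using that ne by (intro cSUP_least) auto
  have N01: "N0 x \<le> N1 x" if "x \<in> V" for x using up[of "\<one>\<^bsub>\<G>\<^esub>" x] that by (simp add: \<rho>_one)
  have N10: "N1 x \<le> C * N0 x" if "x \<in> V" for x using least C(2) that by blast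
  have inv_le: "N1 (\<rho> h x) \<le> N1 x" if "h \<in> carrier \<G>" "x \<in> V" for h x
    using up[OF _ that(2)] that by (intro least) (simp flip: \<rho>_mult)
  have inv_eq: "N1 (\<rho> h x) = N1 x" if "h \<in> carrier \<G>" "x \<in> V" for h x
  proof (rule antisym[OF inv_le[OF that]])
    have "N1 (\<rho> (inv\<^bsub>\<G>\<^esub> h) (\<rho> h x)) \<le> N1 (\<rho> h x)" using that \<rho>l(1) by (intro inv_le) auto
    then show "N1 x \<le> N1 (\<rho> h x)" using that by (simp flip: \<rho>_mult add: \<rho>_one)
  qed
  have N1_scale_le: "N1 (a *\<^sub>R x) \<le> \<bar>a\<bar> * N1 x" if "x \<in> V" for a x
    using that up \<rho>l(1) by (intro least) (simp add: \<rho>l(3) N0.N_scale mult_left_mono)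
  interpret N1: normed_set V N1
  proof (unfold_locales, unfold norm_on_def, intro conjI ballI allI)
    fix x assume x: "x \<in> V"
    show "0 \<le> N1 x" using N01[OF x] N0.N_nonneg[OF x] by linarith
    have "N1 x = 0" if "x = 0" using N10[OF x] N01[OF x] that by simp
    moreover have "x = 0" if "N1 x = 0" using N01[OF x] N0.N_nonneg[OF x] N0.N_eq_0[OF x] that by linarith
    ultimately show "N1 x = 0 \<longleftrightarrow> x = 0" by blast
    fix a
    show "N1 (a *\<^sub>R x) = \<bar>a\<bar> * N1 x"
    proof (cases "a = 0")
      case True
      then show ?thesis using \<open>x = 0 \<Longrightarrow> N1 x = 0\<close> N10[of 0] N01[of 0] by simp
    next
      case False
      have "N1 (inverse a *\<^sub>R (a *\<^sub>R x)) \<le> \<bar>inverse a\<bar> * N1 (a *\<^sub>R x)" using x by (intro N1_scale_le) auto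
      then have "\<bar>a\<bar> * N1 x \<le> N1 (a *\<^sub>R x)" using False by (simp add: field_simps)
      then show ?thesis using N1_scale_le[OF x, of a] by simp
    qed
  next
    fix x y assume xy: "x \<in> V" "y \<in> V"
    show "N1 (x + y) \<le> N1 x + N1 y"
    proof (rule least)
      fix g assume g: "g \<in> carrier \<G>"
      have "N0 (\<rho> g (x + y)) \<le> N0 (\<rho> g x) + N0 (\<rho> g y)" using xy g \<rho>l(1) by (simp add: \<rho>l(2) N0.N_add)
      then show "N0 (\<rho> g (x + y)) \<le> N1 x + N1 y" using up[OF g xy(1)] up[OF g xy(2)] by linarith
    qed
  qed (rule subV)
  have "uniformly_convex V N1" unfolding uniformly_convex_def
  proof (intro allI impI)
    fix e :: real assume "e > 0"
    \<comment> \<open>As \<open>N1\<close> is invariant and at most \<open>C * N0\<close>, each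
      \<open>g\<close> keeps the images of \<open>x\<close> and \<open>y\<close> at least e / C
      apart in the original norm. One \<open>d\<close> thus serves all \<open>g\<close> and survives
      the supremum.\<close>
    then have "e / C > 0" using C(1) by simp
    then obtain d where d: "d > 0" "\<And>x y. \<lbrakk>x \<in> W; y \<in> W; N' x \<le> 1; N' y \<le> 1; e / C \<le> N' (x - y)\<rbrakk>
        \<Longrightarrow> N' ((1/2) *\<^sub>R (x + y)) \<le> 1 - d"
      using ucW unfolding uniformly_convex_def by metis
    have "N1 ((1/2) *\<^sub>R (x + y)) \<le> 1 - d"
      if xy: "x \<in> V" "y \<in> V" "N1 x \<le> 1" "N1 y \<le> 1" "e \<le> N1 (x - y)" for x y
    proof (rule least)
      fix g assume g: "g \<in> carrier \<G>"
      have gV: "\<rho> g x \<in> V" "\<rho> g y \<in> V" using g xy \<rho>l(1) by auto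
      have "N' (f (\<rho> g x)) \<le> 1" "N' (f (\<rho> g y)) \<le> 1"
        using up[OF g xy(1)] up[OF g xy(2)] xy by (auto simp: N0_def)
      moreover have "e / C \<le> N' (f (\<rho> g x) - f (\<rho> g y))"
      proof -
        have "e \<le> N1 (\<rho> g (x - y))" using inv_eq g xy by simp
        also have "\<dots> \<le> C * N0 (\<rho> g (x - y))" using g xy \<rho>l(1) by (intro N10) auto
        finally show ?thesis using C(1) g xy gV by (simp add: N0_def \<rho>l fl divide_le_eq mult.commute)
      qed
      ultimately have "N' ((1/2) *\<^sub>R (f (\<rho> g x) + f (\<rho> g y))) \<le> 1 - d" using gV by (intro d(2)) auto
      moreover have "f (\<rho> g ((1/2) *\<^sub>R (x + y))) = (1/2) *\<^sub>R (f (\<rho> g x) + f (\<rho> g y))"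
        using g xy gV by (simp add: \<rho>l(2,3) fl(2,3))
      ultimately show "N0 (\<rho> g ((1/2) *\<^sub>R (x + y))) \<le> 1 - d" by (simp add: N0_def)
    qed
    then show "\<exists>d>0. \<forall>x\<in>V. \<forall>y\<in>V. N1 x \<le> 1 \<and> N1 y \<le> 1 \<and> e \<le> N1 (x - y) \<longrightarrow> N1 ((1/2) *\<^sub>R (x + y)) \<le> 1 - d"
      using d(1) by blast
  qed
  moreover have "Metric_space.mcomplete V (norm_dist V N1)"
    unfolding N1.mcomplete_iff
  proof (intro allI impI)
    fix y :: "nat \<Rightarrow> 'b" assume y: "\<forall>n. y n \<in> V" and cau: "\<forall>e>0. \<exists>M. \<forall>m\<ge>M. \<forall>n\<ge>M. N1 (y m - y n) < e"
    have yV: "y n \<in> V" for n using y by simp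
    have le: "N' (f (y m) - f (y n)) \<le> N1 (y m - y n)" for m n
      using N01[of "y m - y n"] yV by (simp add: N0_def fl)
    have fcau: "\<exists>M. \<forall>m\<ge>M. \<forall>n\<ge>M. N' (f (y m) - f (y n)) < e" if "e > 0" for e
      using cau[rule_format, OF that] le by (meson le_less_trans)
    obtain k where k: "k \<in> W" "(\<lambda>n. N' (f (y n) - k)) \<longlonglongrightarrow> 0"
      by (rule W.Cauchy_limit[of "\<lambda>n. f (y n)", OF fW[OF yV] fcau])
    obtain l where l: "l \<in> V" "k = f l" using k(1) surj by blast
    have "(\<lambda>n. N1 (y n - l)) \<longlonglongrightarrow> 0"
    proof (rule tendsto_sandwich[OF _ _ tendsto_const])
      show "\<forall>\<^sub>F n in sequentially. 0 \<le> N1 (y n - l)" using yV l by simp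
      show "\<forall>\<^sub>F n in sequentially. N1 (y n - l) \<le> C * N' (f (y n) - k)"
        using N10[of "y _ - l"] yV l by (auto simp: N0_def fl)
      show "(\<lambda>n. C * N' (f (y n) - k)) \<longlonglongrightarrow> 0" using tendsto_mult_right_zero[OF k(2)] .
    qed
    then show "\<exists>l\<in>V. (\<lambda>n. N1 (y n - l)) \<longlonglongrightarrow> 0" using l(1) by blast
  qed
  ultimately have "affine_isometric V N1 \<G> \<rho> c"
    by (intro affine_isometric.intro uc_banach.intro uc_banach_axioms.intro affine_isometric_axioms.intro
        N1.normed_set_axioms G \<rho>_lin inv_eq \<rho>_mult \<rho>_one c_in c_mult)
  moreover have "norm_topology V N1 = T"
    using norm_topology_equivalent[OF N1.normed_set_axioms N0.normed_set_axioms, of C 1] N01 N10 topN0 by simp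
  ultimately show thesis using that by (simp add: V_def)
qed

section \<open>The splitting of the affine action\<close>


context product_action
begin

interpretation group \<G> by (rule group)

abbreviation "TV \<equiv> norm_topology V N"
abbreviation "TB i \<equiv> norm_topology (B i) N"

lemma B_subspace: "i < n \<Longrightarrow> subspace (B i)"
proof (rule subspaceI)
  assume i: "i < n"
  interpret I: isometries V N "\<rho> ` H i" by (rule isometries_H[OF i])
  show "0 \<in> B i" "\<And>x y. x \<in> B i \<Longrightarrow> y \<in> B i \<Longrightarrow> x + y \<in> B i" "\<And>a x. x \<in> B i \<Longrightarrow> a *\<^sub>R x \<in> B i"
    unfolding B_def by (rule I.fixed_linear; assumption)+
qed

lemma B_normed: "i < n \<Longrightarrow> normed_set (B i) N"
  using normed_subset[OF B_subspace] B_sub by blast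

lemma B_topology: "i < n \<Longrightarrow> TB i = subtopology TV (B i)"
  using norm_topology_subspace[OF B_subspace] B_sub by blast

lemma \<rho>_B: "i < n \<Longrightarrow> g \<in> carrier \<G> \<Longrightarrow> x \<in> B i \<Longrightarrow> \<rho> g x \<in> B i"
  using p_in_B[of i "\<rho> g x"] p_equivariant[of i g x] p_of_B[of i x] B_sub[of i x] by simp

text \<open>\<open>B i\<close> is the fixed-point set of the contraction \<open>p i\<close>, so
  limits taken in \<open>V\<close> stay in it.\<close>

lemma B_banach: "i < n \<Longrightarrow> banach_space (B i) N"
proof -
  assume i: "i < n"
  interpret B: normed_set "B i" N by (rule B_normed[OF i])
  have "Metric_space.mcomplete (B i) (norm_dist (B i) N)"
    unfolding B.mcomplete_iff
  proof (intro allI impI)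
    fix y :: "nat \<Rightarrow> 'b" assume y: "\<forall>n. y n \<in> B i" and cau: "\<forall>\<epsilon>>0. \<exists>M. \<forall>m\<ge>M. \<forall>n\<ge>M. N (y m - y n) < \<epsilon>"
    have yV: "y n \<in> V" for n using y B_sub[OF i] by blast
    obtain l where l: "l \<in> V" "(\<lambda>n. N (y n - l)) \<longlonglongrightarrow> 0" using Cauchy_limit[of y] yV cau by blast
    have "p i l = l"
    proof (rule limit_unique[OF yV _ l(1) _ l(2)])
      show "p i l \<in> V" using i l by simp
      have eq: "y n - p i l = p i (y n - l)" for n
        using p_diff[OF i yV l(1)] p_of_B[OF i y[rule_format]] by simp
      show "(\<lambda>n. N (y n - p i l)) \<longlonglongrightarrow> 0"
      proof (rule tendsto_sandwich[OF _ _ tendsto_const l(2)])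
        show "\<forall>\<^sub>F n in sequentially. 0 \<le> N (y n - p i l)" using yV l i by simp
        show "\<forall>\<^sub>F n in sequentially. N (y n - p i l) \<le> N (y n - l)" unfolding eq using yV l p_contract[OF i] by simp
      qed
    qed
    then have "l \<in> B i" using p_in_B[OF i l(1)] by simp
    then show "\<exists>l\<in>B i. (\<lambda>n. N (y n - l)) \<longlonglongrightarrow> 0" using l(2) by blast
  qed
  then show ?thesis using B.norm_on by (simp add: banach_space_def)
qed

lemma B_superreflexive:
  assumes i: "i < n" and tvs: "topological_vector_space TV"
  shows "superreflexive (TB i)"
proof -
  interpret B: normed_set "B i" N by (rule B_normed[OF i])
  have BV: "B i \<subseteq> V" using B_sub[OF i] by blast
  have "topological_vector_space (TB i)"
    unfolding B_topology[OF i] using topological_vector_space_subspace[OF tvs B_subspace[OF i]] BV by simp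
  moreover have "uniformly_convex (B i) N"
    using uc BV unfolding uniformly_convex_def by (meson subsetD)
  moreover have "linear_between (B i) (B i) id" by (simp add: linear_between_def)
  moreover have "homeomorphic_map (TB i) (TB i) id" by simp
  ultimately show ?thesis unfolding superreflexive_def using B_banach[OF i] by (metis B.topspace_norm_topology)
qed

section \<open>The induced affine actions on the fixed spaces\<close>

definition \<beta> :: "nat \<Rightarrow> 'g \<Rightarrow> 'b \<Rightarrow> 'b" where
  "\<beta> i g = (\<lambda>x\<in>B i. \<rho> g x + p i (c g))"

lemma \<beta>_in: "i < n \<Longrightarrow> g \<in> carrier \<G> \<Longrightarrow> x \<in> B i \<Longrightarrow> \<beta> i g x \<in> B i"
  by (simp add: \<beta>_def subspace_add B_subspace \<rho>_B p_in_B)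

text \<open>\<open>p i\<close> intertwines the action on \<open>V\<close> with
  \<open>\<beta> i\<close>; the action laws and the continuity of \<open>\<beta> i\<close> are
  inherited through this identity.\<close>

lemma p_aff: "i < n \<Longrightarrow> g \<in> carrier \<G> \<Longrightarrow> x \<in> V \<Longrightarrow> p i (aff g x) = \<beta> i g (p i x)"
  by (simp add: \<beta>_def aff_def p_add p_equivariant p_in_B)

lemma \<beta>_eq: "i < n \<Longrightarrow> g \<in> carrier \<G> \<Longrightarrow> x \<in> B i \<Longrightarrow> \<beta> i g x = p i (aff g x)"
  using p_aff[of i g x] B_sub[of i x] p_of_B[of i x] by simp

lemma \<beta>_mult:
  assumes "i < n" "g \<in> carrier \<G>" "h \<in> carrier \<G>" "x \<in> B i"
  shows "\<beta> i (g \<otimes> h) x = \<beta> i g (\<beta> i h x)"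
  using assms B_sub[of i x] by (simp add: \<beta>_eq[of i _ x] aff_mult p_aff)

lemma \<beta>_one: "i < n \<Longrightarrow> x \<in> B i \<Longrightarrow> \<beta> i \<one> x = x"
  using B_sub[of i x] by (simp add: \<beta>_eq aff_one p_of_B)

lemma \<beta>_extensional: "\<beta> i g \<in> extensional (B i)"
  by (simp add: \<beta>_def)

lemma \<beta>_affine_action:
  assumes i: "i < n"
  shows "affine_action \<G> (TB i) (\<beta> i) \<rho> (\<lambda>g. p i (c g))"
proof -
  interpret B: normed_set "B i" N by (rule B_normed[OF i])
  have "linear_between (B i) (B i) (\<rho> g)" if "g \<in> carrier \<G>" for g
    unfolding linear_between_def using \<rho>_B[OF i that] \<rho>_add[OF that] \<rho>_scale[OF that] B_sub[OF i] by auto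
  moreover have "group_action \<G> (B i) (\<beta> i)"
    using i group by (intro group_actionI) (auto simp: \<beta>_in \<beta>_extensional \<beta>_mult \<beta>_one)
  ultimately show ?thesis
    unfolding affine_action_def B.topspace_norm_topology using i by (auto simp: p_in_B) (simp add: \<beta>_def)
qed

lemma \<beta>_equicontinuous:
  assumes i: "i < n"
  shows "uniformly_equicontinuous (TB i) (\<beta> i ` carrier \<G>)"
proof -
  interpret B: normed_set "B i" N by (rule B_normed[OF i])
  show ?thesis unfolding uniformly_equicontinuous_def
  proof (intro allI impI)
    fix U assume U: "openin (TB i) U \<and> 0 \<in> U"
    obtain r where r: "r > 0" "\<forall>y\<in>B i. N y < r \<longrightarrow> y \<in> U"
      using B.nhd_0[OF conjunct1[OF U] conjunct2[OF U]] by blast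
    have "\<beta> i g x - \<beta> i g y \<in> U" if "x \<in> B i" "y \<in> B i" "x - y \<in> {y \<in> B i. N y < r}" "g \<in> carrier \<G>" for x y g
    proof -
      have eq: "\<beta> i g x - \<beta> i g y = \<rho> g (x - y)" using that B_sub[OF i] by (simp add: \<beta>_def \<rho>_diff)
      show ?thesis unfolding eq using that \<rho>_B[OF i] \<rho>_iso[of g "x - y"] B_sub[OF i, of "x - y"] r(2) by auto
    qed
    then show "\<exists>W. openin (TB i) W \<and> 0 \<in> W \<and>
        (\<forall>x\<in>topspace (TB i). \<forall>y\<in>topspace (TB i).
            x - y \<in> W \<longrightarrow> (\<forall>f\<in>\<beta> i ` carrier \<G>. f x - f y \<in> U))"
      using r(1) B.openin_ball_0 by (intro exI[of _ "{y \<in> B i. N y < r}"]) auto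
  qed
qed

lemma p_continuous: "i < n \<Longrightarrow> continuous_map TV (TB i) (p i)"
  using p_contract[of i] p_in_B B_normed
  by (intro continuous_map_Lipschitz[where C = 1]) (auto simp flip: p_diff)

lemma \<beta>_continuous:
  assumes i: "i < n" and cont: "continuous_action T\<G> TV act" and top: "topspace T\<G> = carrier \<G>"
    and act: "\<And>g x. g \<in> carrier \<G> \<Longrightarrow> x \<in> V \<Longrightarrow> act g x = aff g x"
  shows "continuous_action T\<G> (TB i) (\<beta> i)"
proof -
  have BV: "B i \<subseteq> V" using B_sub[OF i] by blast
  have "continuous_map (prod_topology T\<G> (TB i)) TV (\<lambda>(g, x). act g x)"
    using cont unfolding continuous_action_def B_topology[OF i] prod_topology_subtopology
    by (rule continuous_map_from_subtopology)
  from continuous_map_compose[OF this p_continuous[OF i]]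
  have "continuous_map (prod_topology T\<G> (TB i)) (TB i) (p i \<circ> (\<lambda>(g, x). act g x))" .
  then show ?thesis unfolding continuous_action_def
  proof (rule continuous_map_eq)
    fix z assume "z \<in> topspace (prod_topology T\<G> (TB i))"
    then show "(p i \<circ> (\<lambda>(g, x). act g x)) z = (case z of (g, x) \<Rightarrow> \<beta> i g x)"
      using i BV by (auto simp: top act \<beta>_eq normed_set.topspace_norm_topology[OF B_normed])
  qed
qed

text \<open>\<open>H i\<close> acts trivially on \<open>B i\<close>: its linear part does so by the
  definition of \<open>B i\<close>, and its translations vanish by
  \<open>p_cocycle_H\<close>.\<close>

lemma \<beta>_H:
  assumes "i < n" "l \<in> carrier \<G>" "h \<in> H i"
  shows "\<beta> i (l \<otimes> h) = \<beta> i l"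
proof (rule extensionalityI[OF \<beta>_extensional \<beta>_extensional])
  fix x assume x: "x \<in> B i"
  have "\<beta> i h x = x" using assms x B_fixed p_cocycle_H by (simp add: \<beta>_def)
  then show "\<beta> i (l \<otimes> h) x = \<beta> i l x" using \<beta>_mult[of i l h x] assms x by simp
qed

section \<open>The invariant affine subspace\<close>

lemma Q_continuous: "continuous_map TV TV Q"
  by (rule continuous_map_Lipschitz[OF normed_set_axioms, where C = "real n"])
    (use Q_bound in \<open>auto simp flip: linear_more(3)[OF Q_linear sub]\<close>)

lemma R_continuous: "continuous_map TV TV R"
  by (rule continuous_map_Lipschitz[OF normed_set_axioms, where C = "1 + real n"])
    (use R_bound in \<open>auto simp flip: linear_more(3)[OF R_linear sub]\<close>)

text \<open>\<open>R x\<close> is the component of \<open>x\<close> in the kernel of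
  \<open>Q\<close>; for \<open>y\<close> in that kernel, the slice is \<open>y\<close> plus the
  image of \<open>Q\<close>.\<close>

definition slice :: "'b \<Rightarrow> 'b set" where
  "slice y = {x \<in> V. R x = y}"

lemma slice_closed_affine:
  assumes y: "y \<in> V" "Q y = 0"
  shows "closed_affine_subspace TV (slice y)"
  unfolding closed_affine_subspace_def
proof (intro conjI)
  show "slice y \<noteq> {}" using y by (auto simp: slice_def R_def)
  show "affine (slice y)"
    unfolding affine_def slice_def
    by (auto simp: linearD(2,3)[OF R_linear] simp flip: scaleR_left_distrib)
  have "slice y = {x \<in> topspace TV. R x \<in> {y}}" by (auto simp: slice_def)
  then show "closedin TV (slice y)"
    using closedin_continuous_map_preimage[OF R_continuous closedin_singleton[OF y(1)]] by simp
qed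

lemma slice_direction:
  assumes y: "y \<in> V" "Q y = 0"
  shows "{a - b |a b. a \<in> slice y \<and> b \<in> slice y} = {v \<in> V. R v = 0}"
proof (intro equalityI subsetI)
  fix v assume "v \<in> {a - b |a b. a \<in> slice y \<and> b \<in> slice y}"
  then show "v \<in> {v \<in> V. R v = 0}" by (auto simp: slice_def linear_more(3)[OF R_linear sub])
next
  fix v assume v: "v \<in> {v \<in> V. R v = 0}"
  then have "y + v \<in> slice y" "y \<in> slice y"
    using y linearD(2)[OF R_linear, of y v] by (auto simp: slice_def R_def)
  then show "v \<in> {a - b |a b. a \<in> slice y \<and> b \<in> slice y}" by (intro CollectI exI[of _ "y + v"] exI[of _ y]) auto
qed

text \<open>The direction of the slice is the image of \<open>Q\<close> and its complement is the
  kernel of \<open>Q\<close>; the continuous maps \<open>Q\<close> and \<open>R\<close> give the two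
  coordinates.\<close>

lemma slice_complemented:
  assumes y: "y \<in> V" "Q y = 0" and tvs: "topological_vector_space TV"
  shows "complemented TV (slice y)"
proof -
  define X where "X = {v \<in> V. R v = 0}"
  define Y where "Y = {v \<in> V. Q v = 0}"
  have RQ: "R (Q z) = 0" if "z \<in> V" for z using that by (simp add: R_def Q_Q)
  have QX: "Q x = x" if "x \<in> X" for x using that by (simp add: X_def R_def)
  have "subspace Y" unfolding Y_def
    by (rule subspaceI) (auto simp: linear_more(1)[OF Q_linear sub] linearD(2,3)[OF Q_linear])
  moreover have "closedin TV Y"
  proof -
    have "Y = {x \<in> topspace TV. Q x \<in> {0}}" by (auto simp: Y_def)
    then show ?thesis using closedin_continuous_map_preimage[OF Q_continuous closedin_singleton[OF in_V(1)]] by simp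
  qed
  moreover have "X \<inter> Y = {0}"
    using QX linear_more(1)[OF Q_linear sub] by (auto simp: X_def Y_def R_def)
  moreover have "{x + z |x z. x \<in> X \<and> z \<in> Y} = topspace TV"
  proof (intro equalityI subsetI)
    fix z assume "z \<in> topspace TV"
    then have "Q z \<in> X" "R z \<in> Y" "z = Q z + R z" using RQ Q_R by (auto simp: X_def Y_def) (simp add: R_def)
    then show "z \<in> {x + z |x z. x \<in> X \<and> z \<in> Y}" by blast
  qed (auto simp: X_def Y_def)
  moreover have "homeomorphic_map (prod_topology (subtopology TV X) (subtopology TV Y)) TV (\<lambda>(x, z). x + z)"
  proof -
    have "homeomorphic_maps (prod_topology (subtopology TV X) (subtopology TV Y)) TV (\<lambda>(x, z). x + z) (\<lambda>z. (Q z, R z))"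
      unfolding homeomorphic_maps_def
    proof (intro conjI ballI)
      show "continuous_map (prod_topology (subtopology TV X) (subtopology TV Y)) TV (\<lambda>(x, z). x + z)"
        using tvs unfolding topological_vector_space_def subtopology_Times[symmetric]
        by (intro continuous_map_from_subtopology) blast
      show "continuous_map TV (prod_topology (subtopology TV X) (subtopology TV Y)) (\<lambda>z. (Q z, R z))"
        using Q_continuous R_continuous RQ Q_R
        by (intro continuous_map_pairedI continuous_map_into_subtopology) (auto simp: X_def Y_def)
      show "(case (Q z, R z) of (x, z) \<Rightarrow> x + z) = z" for z by (simp add: R_def)
      fix w assume "w \<in> topspace (prod_topology (subtopology TV X) (subtopology TV Y))"
      then obtain x z where w: "w = (x, z)" "x \<in> X" "z \<in> Y" by auto
      have "Q (x + z) = x" using w QX by (simp add: X_def Y_def linearD(2)[OF Q_linear])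
      then show "(Q (case w of (x, z) \<Rightarrow> x + z), R (case w of (x, z) \<Rightarrow> x + z)) = w"
        using w(1) by (simp add: R_def)
    qed
    then show ?thesis unfolding homeomorphic_map_maps by blast
  qed
  ultimately show ?thesis
    unfolding complemented_def Let_def slice_direction[OF y] X_def[symmetric] by blast
qed

text \<open>\<open>R\<close> intertwines \<open>aff g\<close> with the projected action, whose fixed
  point is \<open>y\<close>.\<close>

lemma slice_invariant:
  assumes "\<And>g. g \<in> carrier \<G> \<Longrightarrow> \<rho> g y + R (c g) = y" "g \<in> carrier \<G>" "x \<in> slice y"
  shows "aff g x \<in> slice y"
  using assms by (auto simp: slice_def aff_def linearD(2)[OF R_linear] R_equivariant)

definition \<Phi> :: "'b \<Rightarrow> nat \<Rightarrow> 'b" where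
  "\<Phi> x = (\<lambda>i\<in>{..<n}. p i x)"

lemma slice_diff:
  assumes "x \<in> slice y" "z \<in> slice y"
  shows "x - z = (\<Sum>i<n. p i x - p i z)"
proof -
  have "x - Q x = z - Q z" using assms by (simp add: slice_def R_def)
  then show ?thesis by (simp add: Q_def sum_subtractf algebra_simps)
qed

lemma slice_homeomorphic:
  assumes y: "y \<in> V" "Q y = 0" and tvs: "topological_vector_space TV"
  shows "homeomorphic_map (subtopology TV (slice y))
    (product_topology TB {..<n}) \<Phi>"
proof -
  let ?P = "product_topology TB {..<n}"
  \<comment> \<open>The inverse of \<open>\<Phi>\<close>: the components are added and the constant
    transversal part \<open>y\<close> is restored.\<close>
  define \<Psi> where "\<Psi> b = y + (\<Sum>i<n. b i)" for b :: "nat \<Rightarrow> 'b"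
  have topP: "topspace ?P = (\<Pi>\<^sub>E i\<in>{..<n}. B i)"
    using normed_set.topspace_norm_topology[OF B_normed] by (auto simp: PiE_def Pi_def)
  have topS: "topspace (subtopology TV (slice y)) = slice y" by (auto simp: slice_def)
  have p\<Psi>: "p i (\<Psi> b) = b i" "\<Psi> b \<in> V" if "\<And>j. j < n \<Longrightarrow> b j \<in> B j" "i < n" for b i
  proof -
    have sum: "(\<Sum>i<n. b i) \<in> V" using that(1) B_sub sub by (intro subspace_sum) auto
    then show "\<Psi> b \<in> V" using y by (simp add: \<Psi>_def)
    have "p i y = 0" using p_Q[OF \<open>i < n\<close> y(1)] y(2) linear_more(1)[OF p_linear[OF \<open>i < n\<close>] sub] by simp
    then show "p i (\<Psi> b) = b i" using sum y that p_sum_B by (simp add: \<Psi>_def p_add)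
  qed
  have \<Psi>S: "\<Psi> b \<in> slice y" if "b \<in> (\<Pi>\<^sub>E i\<in>{..<n}. B i)" for b
  proof -
    have b: "\<And>j. j < n \<Longrightarrow> b j \<in> B j" using that by auto
    have "Q (\<Psi> b) = (\<Sum>i<n. b i)" unfolding Q_def using p\<Psi>(1)[OF b] by (intro sum.cong) auto
    moreover have "\<Psi> b \<in> V"
      unfolding \<Psi>_def using y sub B_sub[OF _ b] by (intro in_V subspace_sum) auto
    ultimately show ?thesis by (simp add: slice_def R_def \<Psi>_def)
  qed
  have "homeomorphic_maps (subtopology TV (slice y)) ?P \<Phi> \<Psi>"
    unfolding homeomorphic_maps_def
  proof (intro conjI ballI)
    show "continuous_map (subtopology TV (slice y)) ?P \<Phi>"
      unfolding continuous_map_componentwise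
    proof (intro conjI ballI)
      fix i assume "i \<in> {..<n}"
      then show "continuous_map (subtopology TV (slice y)) (TB i) (\<lambda>x. \<Phi> x i)"
        using continuous_map_from_subtopology[OF p_continuous] by (simp add: \<Phi>_def)
    qed (auto simp: \<Phi>_def)
    have "continuous_map ?P TV (\<lambda>b. b i)" if "i \<in> {..<n}" for i
    proof -
      have "continuous_map ?P (TB i) (\<lambda>b. b i)"
        using continuous_map_product_projection[OF that, of TB] .
      then show ?thesis using B_topology[of i] that by (simp add: continuous_map_in_subtopology)
    qed
    then have "continuous_map ?P TV (\<lambda>b. \<Sum>i<n. b i)" by (rule continuous_map_sum[OF tvs])
    then have "continuous_map ?P (prod_topology TV TV) (\<lambda>b. (y, \<Sum>i<n. b i))"
      using y by (intro continuous_map_pairedI) auto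
    moreover have "continuous_map (prod_topology TV TV) TV (\<lambda>(x, y). x + y)"
      using tvs by (simp add: topological_vector_space_def)
    ultimately have "continuous_map ?P TV ((\<lambda>(x, y). x + y) \<circ> (\<lambda>b. (y, \<Sum>i<n. b i)))"
      by (rule continuous_map_compose)
    then have "continuous_map ?P TV \<Psi>" by (simp add: o_def \<Psi>_def[abs_def])
    then show "continuous_map ?P (subtopology TV (slice y)) \<Psi>"
      by (rule continuous_map_into_subtopology) (use \<Psi>S topP in auto)
    show "\<Psi> (\<Phi> x) = x" if "x \<in> topspace (subtopology TV (slice y))" for x
    proof -
      have "(\<Sum>i<n. \<Phi> x i) = Q x" by (simp add: \<Phi>_def Q_def)
      then show ?thesis using that by (auto simp: \<Psi>_def topS slice_def R_def)
    qed
    show "\<Phi> (\<Psi> b) = b" if "b \<in> topspace ?P" for b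
    proof (rule extensionalityI[of _ "{..<n}"])
      have b: "b \<in> (\<Pi>\<^sub>E i\<in>{..<n}. B i)" using that topP by simp
      then show "b \<in> extensional {..<n}" by (simp add: PiE_def)
      show "\<Phi> (\<Psi> b) i = b i" if "i \<in> {..<n}" for i
        using p\<Psi>(1)[of b i] b that by (auto simp: \<Phi>_def)
    qed (simp add: \<Phi>_def)
  qed
  then show ?thesis unfolding homeomorphic_map_maps by blast
qed

lemma slice_isomorphism:
  assumes y: "y \<in> V" "Q y = 0" and tvs: "topological_vector_space TV"
  shows "affine_isomorphism_direct_sum TV (slice y) {..<n} TB \<Phi>"
  unfolding affine_isomorphism_direct_sum_def
proof (intro conjI)
  have SV: "x \<in> V" if "x \<in> slice y" for x using that by (simp add: slice_def)
  show "homeomorphic_map (subtopology TV (slice y))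
    (product_topology TB {..<n}) \<Phi>" by (rule slice_homeomorphic[OF assms])
  show "\<forall>i\<in>{..<n}. \<forall>x\<in>slice y. \<forall>z\<in>slice y. \<forall>t.
      \<Phi> ((1 - t) *\<^sub>R x + t *\<^sub>R z) i = (1 - t) *\<^sub>R \<Phi> x i + t *\<^sub>R \<Phi> z i"
    using SV by (simp add: \<Phi>_def p_add p_scale)
  show "\<forall>U. (\<forall>i\<in>{..<n}. openin (TB i) (U i) \<and> 0 \<in> U i) \<longrightarrow>
      (\<exists>W. openin TV W \<and> 0 \<in> W \<and>
         (\<forall>x\<in>slice y. \<forall>z\<in>slice y. x - z \<in> W \<longrightarrow> (\<forall>i\<in>{..<n}. \<Phi> x i - \<Phi> z i \<in> U i)))"
  proof (intro allI impI)
    fix U assume U: "\<forall>i\<in>{..<n}. openin (TB i) (U i) \<and> 0 \<in> U i"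
    have "\<exists>r>0. \<forall>b\<in>B i. N b < r \<longrightarrow> b \<in> U i" if "i < n" for i
    proof -
      have "openin (TB i) (U i)" "0 \<in> U i" using U that by auto
      from normed_set.nhd_0[OF B_normed[OF that] this] show ?thesis .
    qed
    then obtain r where r: "\<And>i. i < n \<Longrightarrow> r i > 0" "\<And>i b. i < n \<Longrightarrow> b \<in> B i \<Longrightarrow> N b < r i \<Longrightarrow> b \<in> U i" by metis
    \<comment> \<open>The element 1 keeps the set nonempty for \<open>Min\<close>.\<close>
    define s where "s = Min (insert 1 (r ` {..<n}))"
    have s: "s > 0" "\<And>i. i < n \<Longrightarrow> s \<le> r i" using r(1) by (auto simp: s_def)
    have "\<Phi> x i - \<Phi> z i \<in> U i" if "x \<in> slice y" "z \<in> slice y" "x - z \<in> {v \<in> V. N v < s}" "i \<in> {..<n}" for x z i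
    proof -
      have i: "i < n" using that by simp
      have eq: "\<Phi> x i - \<Phi> z i = p i (x - z)" using that SV by (simp add: \<Phi>_def p_diff)
      have "N (p i (x - z)) \<le> N (x - z)" using p_contract[OF i] that SV by simp
      then have "N (p i (x - z)) < r i" using that s(2)[OF i] by simp
      then show ?thesis unfolding eq using p_in_B[OF i] that SV by (intro r(2)[OF i]) auto
    qed
    then show "\<exists>W. openin TV W \<and> 0 \<in> W \<and>
         (\<forall>x\<in>slice y. \<forall>z\<in>slice y. x - z \<in> W \<longrightarrow> (\<forall>i\<in>{..<n}. \<Phi> x i - \<Phi> z i \<in> U i))"
      using openin_ball_0 s(1) by (intro exI[of _ "{v \<in> V. N v < s}"]) auto
  qed
  show "\<forall>W. openin TV W \<and> 0 \<in> W \<longrightarrow>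
      (\<exists>U. (\<forall>i\<in>{..<n}. openin (TB i) (U i) \<and> 0 \<in> U i) \<and>
         (\<forall>x\<in>slice y. \<forall>z\<in>slice y. (\<forall>i\<in>{..<n}. \<Phi> x i - \<Phi> z i \<in> U i) \<longrightarrow> x - z \<in> W))"
  proof (intro allI impI)
    fix W assume W: "openin TV W \<and> 0 \<in> W"
    obtain r where r: "r > 0" "\<forall>v\<in>V. N v < r \<longrightarrow> v \<in> W"
      using nhd_0[OF conjunct1[OF W] conjunct2[OF W]] by blast
    \<comment> \<open>With n + 1 in the denominator, n summands stay strictly below
      \<open>r\<close>.\<close>
    define s where "s = r / (real n + 1)"
    have s: "s > 0" "real n * s < r" using r(1) by (simp_all add: s_def field_simps)
    have "x - z \<in> W"
      if xz: "x \<in> slice y" "z \<in> slice y" "\<forall>i\<in>{..<n}. \<Phi> x i - \<Phi> z i \<in> {b \<in> B i. N b < s}" for x z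
    proof -
      have "N (x - z) \<le> (\<Sum>i<n. N (p i x - p i z))"
        unfolding slice_diff[OF xz(1,2)] using SV xz by (intro N_sum_le) auto
      also have "\<dots> \<le> (\<Sum>i<n. s)" using xz(3) by (intro sum_mono) (auto simp: \<Phi>_def intro: less_imp_le)
      also have "\<dots> < r" using s(2) by simp
      finally show ?thesis using SV xz r(2) by simp
    qed
    then show "\<exists>U. (\<forall>i\<in>{..<n}. openin (TB i) (U i) \<and> 0 \<in> U i) \<and>
         (\<forall>x\<in>slice y. \<forall>z\<in>slice y. (\<forall>i\<in>{..<n}. \<Phi> x i - \<Phi> z i \<in> U i) \<longrightarrow> x - z \<in> W)"
      using normed_set.openin_ball_0[OF B_normed] s(1) subspace_0[OF B_subspace]
      by (intro exI[of _ "\<lambda>i. {b \<in> B i. N b < s}"]) auto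
  qed
qed

end

text \<open>The negated hypothesis speaks of every norm defining the topology, so it may be read for
  the norm at hand, which will be the invariant one. Homogeneity extends the estimate from unit
  vectors to all others.\<close>

lemma displacement_gap:
  assumes N: "normed_set (topspace T) N" and T: "norm_topology (topspace T) N = T"
    and no: "\<not> almost_has_invariant_vectors TG T \<rho>"
    and lin: "\<And>g. g \<in> topspace TG \<Longrightarrow> linear_between (topspace T) (topspace T) (\<rho> g)"
  obtains K \<epsilon> where "compactin TG K" "\<epsilon> > 0"
    "\<And>v. v \<in> topspace T \<Longrightarrow> v \<noteq> 0 \<Longrightarrow> \<exists>k\<in>K. \<epsilon> * N v \<le> N (\<rho> k v - v)"
proof -
  interpret normed_set "topspace T" N by (rule N)
  let ?inf = "\<lambda>K. INF v\<in>{v \<in> topspace T. N v = 1}. norm_diameter N ((\<lambda>g. \<rho> g v) ` K)"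
  obtain K where K: "compactin TG K" "?inf K \<noteq> 0"
    using no T norm_on unfolding almost_has_invariant_vectors_def by blast
  have "0 < ?inf K" using K(2) by (simp add: zero_less_iff_neq_zero)
  \<comment> \<open>The infimum may be infinite, for instance on the zero space; a number strictly
    below it is finite.\<close>
  then obtain e where e: "0 < e" "e < ?inf K" using dense by blast
  have e_fin: "e < Orderings.top" using less_le_trans[OF e(2) top_greatest] .
  \<comment> \<open>Half of \<open>e\<close>: the triangle inequality through \<open>v\<close>
    bounds the diameter by twice the largest displacement.\<close>
  define \<epsilon> where "\<epsilon> = enn2real e / 2"
  have \<epsilon>: "\<epsilon> > 0" "e = ennreal (2 * \<epsilon>)" using e(1) e_fin by (auto simp: \<epsilon>_def enn2real_positive_iff)
  have KV: "k \<in> topspace TG" if "k \<in> K" for k using K(1) that by (auto simp: compactin_def)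
  have unit: "\<exists>k\<in>K. \<epsilon> \<le> N (\<rho> k v - v)" if v: "v \<in> topspace T" "N v = 1" for v
  proof (rule ccontr)
    assume "\<not> ?thesis"
    then have small: "\<And>k. k \<in> K \<Longrightarrow> N (\<rho> k v - v) < \<epsilon>" by (meson not_le)
    have "norm_diameter N ((\<lambda>g. \<rho> g v) ` K) \<le> e"
      unfolding norm_diameter_def
    proof (intro SUP_least)
      fix x z assume "x \<in> (\<lambda>g. \<rho> g v) ` K" "z \<in> (\<lambda>g. \<rho> g v) ` K"
      then obtain k l where kl: "k \<in> K" "l \<in> K" "x = \<rho> k v" "z = \<rho> l v" by blast
      have "\<rho> k v \<in> topspace T" "\<rho> l v \<in> topspace T" using linearD(1)[OF lin[OF KV]] kl v by auto
      then have "N (x - z) \<le> 2 * \<epsilon>"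
        using N_triangle[of "\<rho> k v" v "\<rho> l v"] N_diff_commute[of v "\<rho> l v"] small[OF kl(1)] small[OF kl(2)] kl v by simp
      then show "ennreal (N (x - z)) \<le> e" unfolding \<epsilon>(2) by (rule ennreal_leI)
    qed
    moreover have "?inf K \<le> norm_diameter N ((\<lambda>g. \<rho> g v) ` K)" using v by (intro INF_lower) simp
    ultimately show False using e(2) by (meson leD le_less_trans order_trans)
  qed
  have "\<exists>k\<in>K. \<epsilon> * N v \<le> N (\<rho> k v - v)" if v: "v \<in> topspace T" "v \<noteq> 0" for v
  proof -
    have Nv: "N v > 0" using v N_eq_0[OF v(1)] N_nonneg[OF v(1)] by linarith
    define w where "w = inverse (N v) *\<^sub>R v"
    have w: "w \<in> topspace T" "N w = 1" "v = N v *\<^sub>R w" using v Nv by (simp_all add: w_def N_scale)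
    obtain k where k: "k \<in> K" "\<epsilon> \<le> N (\<rho> k w - w)" using unit[OF w(1,2)] by blast
    note l = linearD[OF lin[OF KV[OF k(1)]]]
    have "\<rho> k v = N v *\<^sub>R \<rho> k w" using l(3)[OF w(1), of "N v"] w(3) by simp
    then have "\<rho> k v - v = N v *\<^sub>R (\<rho> k w - w)" using w(3) by (metis scaleR_right_diff_distrib)
    then have "N (\<rho> k v - v) = N v * N (\<rho> k w - w)" using N_scale[of "\<rho> k w - w" "N v"] l(1) w(1) Nv by simp
    then have "\<epsilon> * N v \<le> N (\<rho> k v - v)"
      using mult_left_mono[OF k(2), of "N v"] Nv by (simp add: mult.commute)
    then show ?thesis using k(1) by blast
  qed
  then show ?thesis using that K(1) \<epsilon>(1) by blast
qed

section \<open>Products of groups\<close>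


text \<open>For \<open>J = I - {i}\<close> this is the copy of the factor \<open>G i\<close> in the
  product, for \<open>J = {i}\<close> the product of the other factors.\<close>

definition trivial_on :: "'i set \<Rightarrow> ('i \<Rightarrow> ('g, 'm) monoid_scheme) \<Rightarrow> 'i set \<Rightarrow> ('i \<Rightarrow> 'g) set" where
  "trivial_on I G J = {g \<in> carrier (product_group I G). \<forall>j\<in>J. g j = \<one>\<^bsub>G j\<^esub>}"

definition trivialize :: "'i set \<Rightarrow> ('i \<Rightarrow> ('g, 'm) monoid_scheme) \<Rightarrow> 'i set \<Rightarrow> ('i \<Rightarrow> 'g) \<Rightarrow> 'i \<Rightarrow> 'g" where
  "trivialize I G J g = (\<lambda>j\<in>I. if j \<in> J then \<one>\<^bsub>G j\<^esub> else g j)"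

context
  fixes I :: "'i set" and G :: "'i \<Rightarrow> ('g, 'm) monoid_scheme"
  assumes groups: "\<forall>i\<in>I. group (G i)"
begin

abbreviation "\<P> \<equiv> product_group I G"

lemma group_component: "i \<in> I \<Longrightarrow> group (G i)"
  using groups by blast

lemma one_in [simp]: "i \<in> I \<Longrightarrow> \<one>\<^bsub>G i\<^esub> \<in> carrier (G i)"
  using group_component by (simp add: group.is_monoid)

lemma trivial_on_normal:
  assumes "J \<subseteq> I"
  shows "trivial_on I G J \<lhd> \<P>"
proof -
  interpret P: group \<P> using group_component by simp
  have mem: "i \<in> I" if "i \<in> J" for i using assms that by blast
  have "subgroup (trivial_on I G J) \<P>"
  proof (rule P.subgroupI)
    show "trivial_on I G J \<noteq> {}"
      using P.one_closed mem by (intro ex_in_conv[THEN iffD1] exI[of _ "\<one>\<^bsub>\<P>\<^esub>"])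
        (auto simp: trivial_on_def)
    show "inv\<^bsub>\<P>\<^esub> g \<in> trivial_on I G J" if "g \<in> trivial_on I G J" for g
      using that P.inv_closed[of g] group_component mem
      by (auto simp: trivial_on_def group.is_monoid monoid.inv_one simp del: carrier_product_group)
        (simp add: group.is_monoid monoid.inv_one group_component)
    show "g \<otimes>\<^bsub>\<P>\<^esub> h \<in> trivial_on I G J" if "g \<in> trivial_on I G J" "h \<in> trivial_on I G J" for g h
    proof -
      have "g \<otimes>\<^bsub>\<P>\<^esub> h \<in> carrier \<P>"
        using that by (intro P.m_closed) (simp_all add: trivial_on_def del: carrier_product_group)
      moreover have "(g \<otimes>\<^bsub>\<P>\<^esub> h) j = \<one>\<^bsub>G j\<^esub>" if "j \<in> J" for j
        using that \<open>g \<in> trivial_on I G J\<close> \<open>h \<in> trivial_on I G J\<close> mem[OF that] group.is_monoid[OF group_component[OF mem[OF that]]]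
        by (simp add: trivial_on_def monoid.l_one monoid.one_closed)
      ultimately show ?thesis unfolding trivial_on_def by blast
    qed
  qed (auto simp: trivial_on_def)
  moreover have "x \<otimes>\<^bsub>\<P>\<^esub> h \<otimes>\<^bsub>\<P>\<^esub> inv\<^bsub>\<P>\<^esub> x \<in> trivial_on I G J"
    if x: "x \<in> carrier \<P>" and h: "h \<in> trivial_on I G J" for x h
  proof -
    have hc: "h \<in> carrier \<P>" using h by (simp add: trivial_on_def)
    have "x \<otimes>\<^bsub>\<P>\<^esub> h \<otimes>\<^bsub>\<P>\<^esub> inv\<^bsub>\<P>\<^esub> x \<in> carrier \<P>"
      by (intro P.m_closed P.inv_closed x hc)
    moreover have "(x \<otimes>\<^bsub>\<P>\<^esub> h \<otimes>\<^bsub>\<P>\<^esub> inv\<^bsub>\<P>\<^esub> x) j = \<one>\<^bsub>G j\<^esub>"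
      if j: "j \<in> J" for j
    proof -
      interpret Gj: group "G j" by (rule group_component[OF mem[OF j]])
      have "x j \<in> carrier (G j)" "h j = \<one>\<^bsub>G j\<^esub>" using x h j mem[OF j] by (auto simp: trivial_on_def)
      then show ?thesis using x mem[OF j] group_component by simp
    qed
    ultimately show ?thesis unfolding trivial_on_def by blast
  qed
  ultimately show ?thesis by (simp only: P.normal_inv_iff) blast
qed

lemma trivialize_in:
  "J \<subseteq> I \<Longrightarrow> g \<in> carrier \<P> \<Longrightarrow> trivialize I G J g \<in> trivial_on I G J"
  by (auto simp: trivial_on_def trivialize_def PiE_def Pi_def subset_iff)

lemma trivialize_mult:
  assumes "g \<in> carrier \<P>" "J \<union> J' = I" "J \<inter> J' = {}"
  shows "trivialize I G J g \<otimes>\<^bsub>\<P>\<^esub> trivialize I G J' g = g"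
proof (rule extensionalityI[of _ I])
  show "(trivialize I G J g \<otimes>\<^bsub>\<P>\<^esub> trivialize I G J' g) j = g j" if j: "j \<in> I" for j
  proof -
    interpret Gj: group "G j" by (rule group_component[OF j])
    have "g j \<in> carrier (G j)" "j \<in> J \<longleftrightarrow> j \<notin> J'" using assms j by auto
    then show ?thesis using j by (auto simp: trivialize_def)
  qed
qed (use assms(1) in \<open>auto simp: PiE_def\<close>)

text \<open>In each coordinate one of the two elements is the unit.\<close>

lemma trivial_on_commute:
  assumes "g \<in> trivial_on I G J" "h \<in> trivial_on I G J'" "J \<union> J' = I"
  shows "g \<otimes>\<^bsub>\<P>\<^esub> h = h \<otimes>\<^bsub>\<P>\<^esub> g"
proof -
  have "g j \<otimes>\<^bsub>G j\<^esub> h j = h j \<otimes>\<^bsub>G j\<^esub> g j" if j: "j \<in> I" for j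
  proof -
    interpret Gj: group "G j" by (rule group_component[OF j])
    have "g j \<in> carrier (G j)" "h j \<in> carrier (G j)" "g j = \<one>\<^bsub>G j\<^esub> \<or> h j = \<one>\<^bsub>G j\<^esub>"
      using assms j by (auto simp: trivial_on_def)
    then show ?thesis by auto
  qed
  then show ?thesis by (auto intro: restrict_ext)
qed

text \<open>Coordinates are split off one at a time: \<open>g\<close> is an element of one factor
  times an element that is trivial in one more coordinate.\<close>

lemma trivial_on_generate:
  assumes "finite I" and S: "subgroup S \<P>" and sub: "\<And>i. i \<in> I \<Longrightarrow> trivial_on I G (I - {i}) \<subseteq> S"
  shows "carrier \<P> \<subseteq> S"
proof -
  have "J \<subseteq> I \<Longrightarrow> trivial_on I G (I - J) \<subseteq> S" if "finite J" for J
    using that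
  proof (induction J rule: finite_induct)
    case empty
    have "g = \<one>\<^bsub>\<P>\<^esub>" if "g \<in> trivial_on I G (I - {})" for g
      by (rule extensionalityI[of _ I]) (use that in \<open>auto simp: trivial_on_def PiE_def\<close>)
    then show ?case using subgroup.one_closed[OF S] by blast
  next
    case (insert i J)
    show ?case
    proof
      fix g assume g: "g \<in> trivial_on I G (I - insert i J)"
      then have gc: "g \<in> carrier \<P>" by (simp add: trivial_on_def)
      have "trivialize I G {i} g \<in> trivial_on I G (I - J)" "trivialize I G (I - {i}) g \<in> trivial_on I G (I - {i})"
        using g insert.prems by (auto simp: trivial_on_def trivialize_def PiE_def Pi_def)
      then have "trivialize I G {i} g \<in> S" "trivialize I G (I - {i}) g \<in> S" using insert sub[of i] by auto
      then have *: "trivialize I G {i} g \<otimes>\<^bsub>\<P>\<^esub> trivialize I G (I - {i}) g \<in> S"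
        by (rule subgroup.m_closed[OF S])
      have "{i} \<union> (I - {i}) = I" using insert.prems by blast
      from trivialize_mult[OF gc this Diff_disjoint] show "g \<in> S" using * by (simp only:)
    qed
  qed
  from this[OF \<open>finite I\<close> order_refl] show ?thesis by (auto simp: trivial_on_def)
qed

text \<open>Makes the components of a compact set compact, so that the cocycle is bounded on
  them.\<close>

lemma trivialize_continuous:
  assumes "\<forall>i\<in>I. topspace (TG i) = carrier (G i)"
  shows "continuous_map (product_topology TG I) (product_topology TG I) (trivialize I G J)"
  unfolding continuous_map_componentwise
proof (intro conjI ballI)
  show "trivialize I G J ` topspace (product_topology TG I) \<subseteq> extensional I" by (auto simp: trivialize_def)
  fix k assume k: "k \<in> I"
  show "continuous_map (product_topology TG I) (TG k) (\<lambda>x. trivialize I G J x k)"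
    using k assms continuous_map_product_projection[OF k, of TG] by (simp add: trivialize_def)
qed

end

section \<open>The splitting for a product of topological groups\<close>

theorem theorem3:
  fixes n :: nat
    and G :: "nat \<Rightarrow> 'g monoid"
    and TG :: "nat \<Rightarrow> 'g topology"
    and T :: "'b::real_vector topology"
    and act \<rho> :: "(nat \<Rightarrow> 'g) \<Rightarrow> 'b \<Rightarrow> 'b"
    and c :: "(nat \<Rightarrow> 'g) \<Rightarrow> 'b"
  assumes "n \<ge> 2"
    and "\<And>i. i < n \<Longrightarrow> topological_group (G i) (TG i)"
    and "superreflexive T"
    and "affine_action (product_group {..<n} G) T act \<rho> c"
    and "continuous_action (product_topology TG {..<n}) T act"
    and "uniformly_equicontinuous T (act ` carrier (product_group {..<n} G))"
    and "\<not> (\<exists>x\<in>topspace T. \<forall>g\<in>carrier (product_group {..<n} G). act g x = x)"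
    and "\<not> almost_has_invariant_vectors (product_topology TG {..<n}) T \<rho>"
  shows "\<exists>(S :: 'b set) (V :: nat \<Rightarrow> 'b set) (N :: nat \<Rightarrow> 'b \<Rightarrow> real)
            (\<beta> :: nat \<Rightarrow> (nat \<Rightarrow> 'g) \<Rightarrow> 'b \<Rightarrow> 'b) (\<Phi> :: 'b \<Rightarrow> nat \<Rightarrow> 'b).
      closed_affine_subspace T S \<and> complemented T S \<and>
      (\<forall>g\<in>carrier (product_group {..<n} G). act g ` S \<subseteq> S) \<and>
      (\<forall>i<n.
         banach_space (V i) (N i) \<and> superreflexive (norm_topology (V i) (N i)) \<and>
         (\<exists>\<rho>' c'. affine_action (product_group {..<n} G) (norm_topology (V i) (N i)) (\<beta> i) \<rho>' c') \<and>
         continuous_action (product_topology TG {..<n}) (norm_topology (V i) (N i)) (\<beta> i) \<and>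
         uniformly_equicontinuous (norm_topology (V i) (N i))
           (\<beta> i ` carrier (product_group {..<n} G)) \<and>
         factors_through_component {..<n} G i (V i) (\<beta> i)) \<and>
      affine_isomorphism_direct_sum T S {..<n} (\<lambda>i. norm_topology (V i) (N i)) \<Phi> \<and>
      (\<forall>g\<in>carrier (product_group {..<n} G). \<forall>x\<in>S. \<forall>i<n. \<Phi> (act g x) i = \<beta> i g (\<Phi> x i))"
proof -
  let ?I = "{..<n}"
  define \<G> where "\<G> = product_group ?I G"
  define T\<G> where "T\<G> = product_topology TG ?I"
  have G: "group (G i)" and TG: "topspace (TG i) = carrier (G i)" if "i \<in> ?I" for i
    using assms(2)[of i] that by (auto simp: topological_group_def)
  have Gb: "\<forall>i\<in>?I. group (G i)" and TGb: "\<forall>i\<in>?I. topspace (TG i) = carrier (G i)" using G TG by blast+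
  note triv_in = trivialize_in[where I = ?I and G = G, OF Gb]
    and triv_mult = trivialize_mult[where I = ?I and G = G, OF Gb]
    and triv_commute = trivial_on_commute[where I = ?I and G = G, OF Gb]
    and triv_normal = trivial_on_normal[where I = ?I and G = G, OF Gb]
    and triv_generate = trivial_on_generate[where I = ?I and G = G, OF Gb finite_lessThan]
    and triv_continuous = trivialize_continuous[where I = ?I and G = G and TG = TG, OF Gb TGb]
  have grp: "group \<G>" unfolding \<G>_def by (rule product_group[OF G])
  interpret \<G>: group \<G> by (rule grp)
  have top: "topspace T\<G> = carrier \<G>" using TG by (auto simp: T\<G>_def \<G>_def PiE_def Pi_def)
  note act = assms(4)[folded \<G>_def] and cont = assms(5)[folded T\<G>_def]
  obtain N where T: "norm_topology (topspace T) N = T" and A: "affine_isometric (topspace T) N \<G> \<rho> c"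
    using invariant_renorming[OF grp assms(3) act assms(6)[folded \<G>_def]] by blast
  define V where "V = topspace T"
  have T': "norm_topology V N = T" using T by (simp add: V_def)
  interpret A: affine_isometric V N \<G> \<rho> c using A by (simp add: V_def)
  have tvs: "topological_vector_space (norm_topology V N)"
    using assms(3) T' by (simp add: superreflexive_def)
  have aff: "act g x = A.aff g x" if "g \<in> carrier \<G>" "x \<in> V" for g x
    using act that by (simp add: affine_action_def A.aff_def V_def)
  have act0: "act g 0 = c g" if "g \<in> carrier \<G>" for g
    using aff[OF that A.in_V(1)] linear_more(1)[OF A.\<rho>_lin[OF that] A.sub] by (simp add: A.aff_def)
  let ?triv = "trivialize ?I G"
  define L where "L i = trivial_on ?I G (?I - {i})" for i
  define H where "H i = trivial_on ?I G {i}" for i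
  have LH: "?triv (?I - {i}) g \<in> L i" "?triv {i} g \<in> H i" "?triv (?I - {i}) g \<otimes>\<^bsub>\<G>\<^esub> ?triv {i} g = g"
    if "i < n" "g \<in> carrier \<G>" for i g
    using that triv_in[where J = "?I - {i}" and g = g] triv_in[where J = "{i}" and g = g]
      triv_mult[where g = g and J = "?I - {i}" and J' = "{i}"] by (auto simp: L_def H_def \<G>_def)
  obtain K0 e where K0: "compactin T\<G> K0" and e: "e > 0"
    and gap0: "\<And>v. v \<in> V \<Longrightarrow> v \<noteq> 0 \<Longrightarrow> \<exists>k\<in>K0. e * N v \<le> N (\<rho> k v - v)"
    using displacement_gap[of T N T\<G> \<rho>] A.normed_set_axioms T assms(8)[folded T\<G>_def] A.\<rho>_lin top
    unfolding V_def by metis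
  \<comment> \<open>The unit provides an element for \<open>v = 0\<close> even when
    \<open>K0\<close> is empty, which is possible on the zero space.\<close>
  define K where "K = {\<one>\<^bsub>\<G>\<^esub>} \<union> K0"
  have K: "compactin T\<G> K" unfolding K_def using K0 top by (intro compactin_Un) auto
  have K_sub: "K \<subseteq> carrier \<G>" using K top by (auto simp: compactin_def)
  have gap: "\<exists>k\<in>K. e * N v \<le> N (\<rho> k v - v)" if "v \<in> V" for v
  proof (cases "v = 0")
    case True
    then show ?thesis by (intro bexI[of _ "\<one>\<^bsub>\<G>\<^esub>"]) (auto simp: K_def A.\<rho>_one)
  next
    case False
    then show ?thesis using gap0[OF that] by (auto simp: K_def)
  qed
  \<comment> \<open>The cocycle is \<open>act g 0\<close>, hence continuous in \<open>g\<close> and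
    bounded on the compact image of \<open>K\<close> under \<open>trivialize\<close>.\<close>
  have bound: "\<exists>M. \<forall>k\<in>K. N (c (?triv J k)) \<le> M" if "J \<subseteq> ?I" for J
  proof -
    have "continuous_map T\<G> T\<G> (?triv J)" unfolding T\<G>_def by (rule triv_continuous)
    then have "continuous_map T\<G> (prod_topology T\<G> T) (\<lambda>g. (?triv J g, 0))"
      using A.in_V(1) by (intro continuous_map_pairedI) (auto simp: V_def)
    moreover have "continuous_map (prod_topology T\<G> T) T (\<lambda>(g, x). act g x)"
      using cont by (simp add: continuous_action_def)
    ultimately have "continuous_map T\<G> T ((\<lambda>(g, x). act g x) \<circ> (\<lambda>g. (?triv J g, 0)))"
      by (rule continuous_map_compose)
    then have "compactin (norm_topology V N) (((\<lambda>(g, x). act g x) \<circ> (\<lambda>g. (?triv J g, 0))) ` K)"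
      unfolding T' using K by (rule image_compactin[rotated])
    then obtain M where M: "\<forall>k\<in>K. N (act (?triv J k) 0) \<le> M" using A.compactin_bounded by fastforce
    have "?triv J k \<in> carrier \<G>" if "k \<in> K" for k
      using triv_in[OF \<open>J \<subseteq> ?I\<close>, of k] K_sub that by (auto simp: trivial_on_def \<G>_def)
    then show ?thesis using M act0 by auto
  qed
  obtain M where M: "\<And>i k. i < n \<Longrightarrow> k \<in> K \<Longrightarrow> N (c (?triv (?I - {i}) k)) \<le> M \<and> N (c (?triv {i} k)) \<le> M"
  proof -
    have "\<exists>M. \<forall>k\<in>K. N (c (?triv (?I - {i}) k)) \<le> M \<and> N (c (?triv {i} k)) \<le> M" if i: "i < n" for i
    proof -
      obtain M1 where M1: "\<forall>k\<in>K. N (c (?triv (?I - {i}) k)) \<le> M1" using bound[of "?I - {i}"] by auto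
      obtain M2 where M2: "\<forall>k\<in>K. N (c (?triv {i} k)) \<le> M2" using bound[of "{i}"] i by auto
      show ?thesis using M1 M2 by (intro exI[of _ "max M1 M2"]) (auto simp: le_max_iff_disj)
    qed
    then obtain f where f: "\<And>i. i < n \<Longrightarrow> \<forall>k\<in>K. N (c (?triv (?I - {i}) k)) \<le> f i \<and> N (c (?triv {i} k)) \<le> f i"
      by metis
    have "f i \<le> Max (f ` ?I)" if "i < n" for i using that by simp
    then show thesis using f by (intro that[of "Max (f ` ?I)"]) (meson order_trans)
  qed
  interpret P: product_action V N \<G> \<rho> c n L H K e M
  proof (intro product_action.intro A.affine_isometric_axioms product_action_axioms.intro K_sub e gap)
    show "L i \<lhd> \<G>" "H i \<lhd> \<G>" if "i < n" for i
      unfolding L_def H_def \<G>_def using that by (auto intro: triv_normal)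
    show "l \<otimes>\<^bsub>\<G>\<^esub> h = h \<otimes>\<^bsub>\<G>\<^esub> l" if "i < n" "l \<in> L i" "h \<in> H i" for i l h
      using triv_commute[where g = l and J = "?I - {i}" and h = h and J' = "{i}"] that by (auto simp: L_def H_def \<G>_def)
    show "\<exists>l\<in>L i. \<exists>h\<in>H i. g = l \<otimes>\<^bsub>\<G>\<^esub> h" if "i < n" "g \<in> carrier \<G>" for i g
      using LH[OF that] by metis
    show "L i \<subseteq> H j" if "i < n" "j < n" "i \<noteq> j" for i j
      using that by (auto simp: L_def H_def trivial_on_def)
    show "carrier \<G> \<subseteq> S" if "subgroup S \<G>" "\<And>i. i < n \<Longrightarrow> L i \<subseteq> S" for S
      unfolding \<G>_def using that by (intro triv_generate) (auto simp: L_def \<G>_def)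
    show "\<exists>l\<in>L i. \<exists>h\<in>H i. k = l \<otimes>\<^bsub>\<G>\<^esub> h \<and> N (c l) \<le> M \<and> N (c h) \<le> M" if "i < n" "k \<in> K" for i k
      using LH[OF that(1), of k] K_sub that M[OF that] by (metis subsetD)
  qed
  obtain y where y: "y \<in> V" "P.Q y = 0" "\<And>g. g \<in> carrier \<G> \<Longrightarrow> \<rho> g y + P.R (c g) = y"
    using P.transversal_fixed_point by blast
  have slice_V: "x \<in> V" if "x \<in> P.slice y" for x using that by (simp add: P.slice_def)
  have factors: "factors_through_component ?I G i (P.B i) (P.\<beta> i)" if i: "i < n" for i
  proof -
    interpret Gi: group "G i" using G i by simp
    \<comment> \<open>A section of the coordinate \<open>i\<close>: \<open>g\<close> equals
      \<open>emb (g i)\<close> times an element of \<open>H i\<close>, which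
      \<open>P.\<beta> i\<close> does not see.\<close>
    define emb where "emb a = ?triv (?I - {i}) (\<lambda>_. a)" for a
    have emb_apply: "emb a j = (if j = i then a else \<one>\<^bsub>G j\<^esub>)" if "j < n" for a j
      using that by (auto simp: emb_def trivialize_def)
    have emb_in: "emb a \<in> carrier \<G>" if "a \<in> carrier (G i)" for a
      using that G by (auto simp: \<G>_def emb_def trivialize_def PiE_def Pi_def group.is_monoid monoid.one_closed)
    have emb_mult: "emb (a \<otimes>\<^bsub>G i\<^esub> b) = emb a \<otimes>\<^bsub>\<G>\<^esub> emb b" if "a \<in> carrier (G i)" "b \<in> carrier (G i)" for a b
    proof (rule extensionalityI[of _ ?I])
      show "emb (a \<otimes>\<^bsub>G i\<^esub> b) j = (emb a \<otimes>\<^bsub>\<G>\<^esub> emb b) j" if "j \<in> ?I" for j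
      proof -
        interpret Gj: group "G j" by (rule G[OF that])
        show ?thesis using that by (simp add: \<G>_def emb_apply)
      qed
    qed (auto simp: emb_def trivialize_def \<G>_def)
    have emb_one: "emb \<one>\<^bsub>G i\<^esub> = \<one>\<^bsub>\<G>\<^esub>"
      by (rule extensionalityI[of _ ?I]) (auto simp: emb_apply \<G>_def, auto simp: emb_def trivialize_def)
    have "group_action (G i) (P.B i) (\<lambda>a. P.\<beta> i (emb a))"
      by (rule group_actionI)
        (use i emb_in in \<open>auto simp: Gi.is_group P.\<beta>_in P.\<beta>_extensional P.\<beta>_mult emb_mult emb_one P.\<beta>_one\<close>)
    moreover have "P.\<beta> i g = P.\<beta> i (emb (g i))" if g: "g \<in> carrier \<G>" for g
    proof -
      have "?triv (?I - {i}) g = emb (g i)"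
        by (rule extensionalityI[of _ ?I]) (auto simp: trivialize_def emb_def)
      then have "g = emb (g i) \<otimes>\<^bsub>\<G>\<^esub> ?triv {i} g" "emb (g i) \<in> L i" using LH[OF i g] by auto
      then show ?thesis using P.\<beta>_H[OF i _ LH(2)[OF i g], of "emb (g i)"] i by simp
    qed
    ultimately show ?thesis unfolding factors_through_component_def \<G>_def by blast
  qed
  have parts: "banach_space (P.B i) N \<and> superreflexive (norm_topology (P.B i) N) \<and>
      (\<exists>\<rho>' c'. affine_action \<G> (norm_topology (P.B i) N) (P.\<beta> i) \<rho>' c') \<and>
      continuous_action T\<G> (norm_topology (P.B i) N) (P.\<beta> i) \<and>
      uniformly_equicontinuous (norm_topology (P.B i) N) (P.\<beta> i ` carrier \<G>) \<and>
      factors_through_component ?I G i (P.B i) (P.\<beta> i)" if i: "i < n" for i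
  proof (intro conjI)
    show "\<exists>\<rho>' c'. affine_action \<G> (norm_topology (P.B i) N) (P.\<beta> i) \<rho>' c'"
      by (intro exI) (rule P.\<beta>_affine_action[OF i])
    show "continuous_action T\<G> (norm_topology (P.B i) N) (P.\<beta> i)"
      using P.\<beta>_continuous[OF i _ top aff] cont T' by simp
  qed (rule P.B_banach[OF i] P.B_superreflexive[OF i tvs] P.\<beta>_equicontinuous[OF i] factors[OF i])+
  show ?thesis
    unfolding \<G>_def[symmetric] T\<G>_def[symmetric]
  \<comment> \<open>All summands carry the one invariant norm \<open>N\<close>, restricted to the
    respective spaces of fixed vectors.\<close>
  proof (rule exI[of _ "P.slice y"], rule exI[of _ P.B], rule exI[of _ "\<lambda>_. N"], rule exI[of _ P.\<beta>],
      rule exI[of _ P.\<Phi>], intro conjI)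
    show "closed_affine_subspace T (P.slice y)" "complemented T (P.slice y)"
      "affine_isomorphism_direct_sum T (P.slice y) ?I (\<lambda>i. norm_topology (P.B i) N) P.\<Phi>"
      using P.slice_closed_affine[OF y(1,2)] P.slice_complemented[OF y(1,2) tvs]
        P.slice_isomorphism[OF y(1,2) tvs] unfolding T' .
    show "\<forall>g\<in>carrier \<G>. act g ` P.slice y \<subseteq> P.slice y"
      using P.slice_invariant[OF y(3)] aff slice_V by (simp add: image_subset_iff)
    show "\<forall>g\<in>carrier \<G>. \<forall>x\<in>P.slice y. \<forall>i<n. P.\<Phi> (act g x) i = P.\<beta> i g (P.\<Phi> x i)"
      using P.p_aff slice_V aff by (simp add: P.\<Phi>_def)
  qed (use parts in blast)
qed

end
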